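(* Let $\Omega\subset\mathbb{R}^2$ be a domain, $\vec F\in C^1(\Omega)$ a vector field, $H\in C^1(\Omega)$, and let $u\in C^1(\Omega)$ be a weak solution to $\operatorname{div}\frac{\nabla u+\vec F}{|\nabla u+\vec F|}=H$. Assume further that $N^\perp(\operatorname{curl}\vec F)$ and $N(H)$ exist and are continuous (extended over singular points) in $\Omega$. Suppose also $\operatorname{curl}\vec F\ne0$ in $\Omega$. Then $\mathcal{H}^2(S_{\vec F}(u))=0$.
   Context: A domain is an open connected set. $\mathcal{H}^2$ is the 2-dimensional Hausdorff measure. For $u\in C^1(\Omega)$ the singular set $S_{\vec F}(u)$ is the set of points (singular points) where $\nabla u+\vec F=0$; other points are nonsingular. $u\in C^1(\Omega)$ is a weak solution to $\operatorname{div}\frac{\nabla u+\vec F}{|\nabla u+\vec F|}=H$ if for every $\varphi\in C_0^\infty(\Omega)$ $$\int_{S_{\vec F}(u)}|\nabla\varphi|+\int_{\Omega\setminus S_{\vec F}(u)}\frac{\nabla u+\vec F}{|\nabla u+\vec F|}\cdot\nabla\varphi+\int_\Omega H\varphi\ge 0 .$$ For $\vec F=(F_1,F_2)$, $\operatorname{curl}\vec F:=(F_2)_x-(F_1)_y$. At nonsingular points $N:=\frac{\nabla u+\vec F}{|\nabla u+\vec F|}=(\cos\theta,\sin\theta)$ and $N^\perp:=(\sin\theta,-\cos\theta)$. $N(f)$, $N^\perp(f)$ denote the derivatives of $f$ in the directions $N$, $N^\perp$; "exist and are continuous (extended over singular points) in $\Omega$" means they exist at nonsingular points and extend to continuous functions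 on $\Omega$. *)

theory Defs
  imports "HOL-Analysis.Analysis"
begin

section \<open>Hausdorff measure\<close>

text \<open>
  The usual normalisation is used, so that a set of diameter \<open>d\<close> is weighted with the volume
  of an \<open>n\<close>-dimensional ball of diameter \<open>d\<close>. The covering sets are required to be bounded
  because \<^const>\<open>diameter\<close> is a real number, unspecified for unbounded sets. The empty set
  is weighted with zero also for \<open>n = 0\<close>.
\<close>

definition hausdorff_weight :: "nat \<Rightarrow> 'a::metric_space set \<Rightarrow> ennreal" where
  "hausdorff_weight n U =
     (if U = {} then 0 else ennreal (unit_ball_vol (real n) * (diameter U / 2) ^ n))"

definition hausdorff_content :: "nat \<Rightarrow> real \<Rightarrow> 'a::metric_space set \<Rightarrow> ennreal" where
  "hausdorff_content n \<delta> A =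
     (INF U \<in> {U :: nat \<Rightarrow> 'a set. A \<subseteq> (\<Union>i. U i) \<and> (\<forall>i. bounded (U i) \<and> diameter (U i) \<le> \<delta>)}.
        \<Sum>i. hausdorff_weight n (U i))"

definition hausdorff_measure :: "nat \<Rightarrow> 'a::metric_space set \<Rightarrow> ennreal" where
  "hausdorff_measure n A = (SUP \<delta> \<in> {0<..}. hausdorff_content n \<delta> A)"

section \<open>Differentiability classes\<close>

text \<open>
  \<open>Ck_on k S f\<close> is intended for open \<open>S\<close> in a Euclidean space: all directional derivatives
  of \<open>f\<close> of order at most \<open>k\<close> exist and are continuous on \<open>S\<close>, those of order less than \<open>k\<close>
  being (Frechet) differentiable.
\<close>

primrec Ck_on :: "nat \<Rightarrow> 'a::real_normed_vector set \<Rightarrow> ('a \<Rightarrow> 'b::real_normed_vector) \<Rightarrow> bool" where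
  "Ck_on 0 S f \<longleftrightarrow> continuous_on S f"
| "Ck_on (Suc k) S f \<longleftrightarrow>
     (\<forall>x\<in>S. f differentiable (at x)) \<and> (\<forall>v. Ck_on k S (\<lambda>x. frechet_derivative f (at x) v))"

text \<open>
  An element of \<open>C\<^sub>0\<^sup>\<infinity>(\<Omega>)\<close> is represented by its extension by zero to the whole space.
\<close>

definition test_function_on :: "'a::real_normed_vector set \<Rightarrow> ('a \<Rightarrow> real) \<Rightarrow> bool" where
  "test_function_on \<Omega> \<phi> \<longleftrightarrow>
     (\<forall>k. Ck_on k UNIV \<phi>) \<and> compact (closure {x. \<phi> x \<noteq> 0}) \<and> closure {x. \<phi> x \<noteq> 0} \<subseteq> \<Omega>"

section \<open>Gradient, curl and directional derivatives in the plane\<close>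

definition partial_deriv :: "'n::finite \<Rightarrow> (real^'n \<Rightarrow> 'b::real_normed_vector) \<Rightarrow> real^'n \<Rightarrow> 'b" where
  "partial_deriv i f x = frechet_derivative f (at x) (axis i 1)"

definition gradient :: "(real^'n::finite \<Rightarrow> real) \<Rightarrow> real^'n \<Rightarrow> real^'n" where
  "gradient f x = (\<chi> i. partial_deriv i f x)"

definition curl :: "(real^2 \<Rightarrow> real^2) \<Rightarrow> real^2 \<Rightarrow> real" where
  "curl F x = partial_deriv 1 F x $ 2 - partial_deriv 2 F x $ 1"

definition has_directional_derivative ::
    "('a::real_normed_vector \<Rightarrow> real) \<Rightarrow> real \<Rightarrow> 'a \<Rightarrow> 'a \<Rightarrow> bool" where
  "has_directional_derivative f d v x \<longleftrightarrow>
     ((\<lambda>t. f (x + t *\<^sub>R v)) has_real_derivative d) (at 0)"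

section \<open>The prescribed mean curvature equation\<close>

definition singular_set :: "(real^2) set \<Rightarrow> (real^2 \<Rightarrow> real^2) \<Rightarrow> (real^2 \<Rightarrow> real) \<Rightarrow> (real^2) set" where
  "singular_set \<Omega> F u = {x \<in> \<Omega>. gradient u x + F x = 0}"

definition N_field :: "(real^2 \<Rightarrow> real^2) \<Rightarrow> (real^2 \<Rightarrow> real) \<Rightarrow> real^2 \<Rightarrow> real^2" where
  "N_field F u x = (gradient u x + F x) /\<^sub>R norm (gradient u x + F x)"

definition N_perp :: "(real^2 \<Rightarrow> real^2) \<Rightarrow> (real^2 \<Rightarrow> real) \<Rightarrow> real^2 \<Rightarrow> real^2" where
  "N_perp F u x = vector [N_field F u x $ 2, - (N_field F u x $ 1)]"

definition weak_solution ::
    "(real^2) set \<Rightarrow> (real^2 \<Rightarrow> real^2) \<Rightarrow> (real^2 \<Rightarrow> real) \<Rightarrow> (real^2 \<Rightarrow> real) \<Rightarrow> bool" where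
  "weak_solution \<Omega> F H u \<longleftrightarrow>
     Ck_on 1 \<Omega> u \<and>
     (\<forall>\<phi>. test_function_on \<Omega> \<phi> \<longrightarrow>
        (LBINT x:singular_set \<Omega> F u. norm (gradient \<phi> x))
        + (LBINT x:\<Omega> - singular_set \<Omega> F u. N_field F u x \<bullet> gradient \<phi> x)
        + (LBINT x:\<Omega>. H x * \<phi> x) \<ge> 0)"

text \<open>
  \<open>V(f)\<close> exists at every nonsingular point and extends to a continuous function on \<open>\<Omega>\<close>.
\<close>

definition derivative_along_extends ::
    "(real^2) set \<Rightarrow> (real^2) set \<Rightarrow> (real^2 \<Rightarrow> real^2) \<Rightarrow> (real^2 \<Rightarrow> real) \<Rightarrow> bool" where
  "derivative_along_extends \<Omega> S V f \<longleftrightarrow>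
     (\<exists>g. continuous_on \<Omega> g \<and> (\<forall>x\<in>\<Omega> - S. has_directional_derivative f (g x) (V x) x))"

end

theory Submission
  imports Defs "HOL-Complex_Analysis.Great_Picard"
begin

text \<open>
  Let \<open>V\<close> be the field \<open>\<nabla>u + F\<close> turned clockwise by a right angle, so that the singular set is the
  zero set of \<open>V\<close> and \<open>T = V/|V|\<close> is \<open>N\<^sup>\<bottom>\<close>. The weak equation says that \<open>T\<close> has rotation \<open>-H\<close>
  where \<open>V \<noteq> 0\<close>, and \<open>V\<close> has divergence \<open>curl F\<close> everywhere; say \<open>curl F \<ge> c\<^sub>0 > 0\<close> near a point.

  The circulation of a unit field along a curve is at most the length of the curve, with equality
  for integral curves. Comparing an integral curve of \<open>T\<close> (a characteristic) with its translates shows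
  that it has curvature \<open>-H\<close>; comparing it with curves that share its initial point shows that at the
  end of a characteristic of length \<open>t\<close> neighbouring characteristics diverge at a rate of at most
  \<open>C/t\<close>. Hence \<open>V\<close> flows into a thin strip along the characteristic whose width grows like
  \<open>exp (\<lambda>\<tau>)\<close> with \<open>\<lambda>\<close> a multiple of \<open>C/t\<close>, and since \<open>div V \<ge> c\<^sub>0\<close> this gives \<open>|V| \<ge> \<kappa> t\<close> at the
  end. A characteristic therefore never runs into the singular set, and by compactness every
  singular point, being a limit of nonsingular ones, is the start of a characteristic of a fixed
  length \<open>L\<close> along which \<open>|V| \<ge> \<kappa> \<tau>\<close>.

  Let \<open>S\<^sub>t\<close> be the set of points reached from singular points at time \<open>t\<close>. By uniqueness of
  characteristics the compact sets \<open>S\<^sub>t\<close>, \<open>0 < t < L\<close>, are pairwise disjoint, so one of them is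
  negligible. As \<open>T\<close> is Lipschitz near \<open>S\<^sub>t\<close>, flowing back from \<open>S\<^sub>t\<close> to the singular points is a
  locally Lipschitz map, so the singular set is negligible as well.
\<close>


section \<open>Circulation along segments and ruled strips\<close>

text \<open>The obstacle is regularity: with \<open>u\<close> only \<open>C^1\<close>, both
  \<open>V\<close> and its direction \<open>T\<close> are merely continuous, so neither the
  divergence of \<open>V\<close> nor the rotation of \<open>T\<close> exists pointwise, and the
  equation for the integral curves of \<open>T\<close> has no a priori uniqueness. Every
  differential identity is therefore used in the form of Stokes' theorem on ruled strips, which
  survives uniform limits: for \<open>V\<close> because the gradient part is exact, for
  \<open>T\<close> because mollifying the weak equation yields \<open>C^1\<close> fields with nearly
  the right rotation. Once the curvature is known, a characteristic solves a second-order equation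
  with Lipschitz data, which restores uniqueness. The rate \<open>C/t\<close> is the price of
  spreading a shift \<open>d\<close> over time \<open>t\<close>: the length grows by the order of
  \<open>|d|^2/t\<close>. Over the last half of a characteristic the corresponding exponential
  widening amounts to a factor that does not depend on \<open>t\<close>, which is why the lower
  bound for \<open>|V|\<close> is linear in \<open>t\<close> with a uniform constant and passes to
  limits that start at zeros of \<open>V\<close>.\<close>

definition rot90 :: "real^2 \<Rightarrow> real^2" where
  "rot90 v = vector [- (v $ 2), v $ 1]"

text \<open>The scalar curl of a field, computed from its derivative \<open>L\<close> at a point.
  Taking the linear map as argument lets it be applied to any supplied derivative
  \<open>A' x\<close>.\<close>

definition rot_of :: "(real^2 \<Rightarrow> real^2) \<Rightarrow> real" where
  "rot_of L = L (axis 1 1) $ 2 - L (axis 2 1) $ 1"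

lemma inner_2: "v \<bullet> w = v $ 1 * w $ 1 + v $ 2 * w $ 2" for v w :: "real^2"
  by (simp add: inner_vec_def sum_2)

lemma rot90_nth [simp]: "rot90 v $ 1 = - (v $ 2)" "rot90 v $ 2 = v $ 1"
  by (simp_all add: rot90_def)

lemma linear_rot90: "linear rot90"
  by (intro linearI) (simp_all add: vec_eq_iff forall_2)

lemma bounded_linear_rot90: "bounded_linear rot90"
  using linear_conv_bounded_linear linear_rot90 by blast

lemmas rot90_simps = linear_add [OF linear_rot90] linear_diff [OF linear_rot90]
  linear_scale [OF linear_rot90] linear_0 [OF linear_rot90] linear_neg [OF linear_rot90]

lemma rot90_rot90 [simp]: "rot90 (rot90 v) = - v"
  by (simp add: vec_eq_iff forall_2)

lemma rot90_inner_rot90 [simp]: "rot90 v \<bullet> rot90 w = v \<bullet> w"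
  by (simp add: inner_2)

lemma rot90_inner_self [simp]: "rot90 v \<bullet> v = 0" "v \<bullet> rot90 v = 0"
  by (simp_all add: inner_2)

lemma inner_rot90_right: "v \<bullet> rot90 w = - (rot90 v \<bullet> w)"
  by (simp add: inner_2)

lemma norm_rot90 [simp]: "norm (rot90 v) = norm v"
  by (simp add: norm_eq_sqrt_inner)

lemma rot90_inner_le: "\<bar>rot90 v \<bullet> w\<bar> \<le> norm v * norm w"
  using Cauchy_Schwarz_ineq2 [of "rot90 v" w] by simp

lemma vec2_expand: "v = v $ 1 *\<^sub>R axis 1 1 + v $ 2 *\<^sub>R axis 2 1" for v :: "real^2"
  by (simp add: vec_eq_iff forall_2 axis_def)

lemma linear_vec2_expand:
  fixes L :: "real^2 \<Rightarrow> 'b::real_vector"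
  assumes "linear L"
  shows "L v = v $ 1 *\<^sub>R L (axis 1 1) + v $ 2 *\<^sub>R L (axis 2 1)"
  by (subst vec2_expand [of v]) (simp only: linear_add [OF assms] linear_scale [OF assms])

text \<open>The left side is alternating in \<open>v\<close> and \<open>w\<close>, and alternating
  bilinear forms on the plane are multiples of the area form
  \<open>rot90 v \<bullet> w\<close>.\<close>

lemma rot_of_inner:
  assumes "linear L"
  shows "L v \<bullet> w - L w \<bullet> v = rot_of L * (rot90 v \<bullet> w)"
proof -
  have "L v = v $ 1 *\<^sub>R L (axis 1 1) + v $ 2 *\<^sub>R L (axis 2 1)"
       "L w = w $ 1 *\<^sub>R L (axis 1 1) + w $ 2 *\<^sub>R L (axis 2 1)"
    using linear_vec2_expand [OF assms] by blast+
  then show ?thesis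
    by (simp add: inner_2 rot_of_def algebra_simps)
qed

text \<open>The circulation of \<open>A\<close>, that is its line integral, along the straight
  segment from \<open>p\<close> to \<open>q\<close>.\<close>

definition seg :: "(real^2 \<Rightarrow> real^2) \<Rightarrow> real^2 \<Rightarrow> real^2 \<Rightarrow> real" where
  "seg A p q = integral {0..1} (\<lambda>r. A (p + r *\<^sub>R (q - p)) \<bullet> (q - p))"

lemma seg_same [simp]: "seg A p p = 0"
  by (simp add: seg_def)

lemma integral_flip_unit:
  fixes f :: "real \<Rightarrow> real"
  shows "integral {0..1} (\<lambda>r. f (1 - r)) = integral {0..1} f"
proof -
  have "integral {-1..0} (\<lambda>r. f (- r)) = integral {0..1} f"
    using Henstock_Kurzweil_Integration.integral_reflect_real [of 1 0 f] by (simp only: minus_zero)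
  moreover have "integral {0..1} (\<lambda>r. f (- (r + - 1))) = integral {-1..0} (\<lambda>r. f (- r))"
    using integral_shift_real_ivl [of "-1" "- 1" 0 "\<lambda>r. f (- r)"] by simp
  ultimately show ?thesis by simp
qed

lemma seg_commute: "seg A q p = - seg A p q"
proof -
  have "seg A q p = integral {0..1} (\<lambda>r. - (A (p + (1 - r) *\<^sub>R (q - p)) \<bullet> (q - p)))"
    unfolding seg_def by (intro integral_cong) (simp add: algebra_simps)
  also have "\<dots> = - integral {0..1} (\<lambda>r. A (p + (1 - r) *\<^sub>R (q - p)) \<bullet> (q - p))"
    by simp
  finally show ?thesis
    using integral_flip_unit [of "\<lambda>r. A (p + r *\<^sub>R (q - p)) \<bullet> (q - p)"] by (simp add: seg_def)
qed

text \<open>Differentiate the circulation along the ruling in \<open>\<tau>\<close> under the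
  integral sign and compare with the exact \<open>r\<close>-derivative of
  \<open>A \<bullet> v\<close>. Linear dependence on \<open>r\<close> makes the mixed derivative of
  the ruling map available although \<open>a\<close> and \<open>b\<close> are only
  \<open>C^1\<close>. The strip may overlap itself, areas being counted with sign.\<close>

lemma strip_stokes:
  fixes a b a' b' :: "real \<Rightarrow> real^2"
  assumes st: "s \<le> t"
    and a: "\<And>\<tau>. \<tau> \<in> {s..t} \<Longrightarrow> (a has_vector_derivative a' \<tau>) (at \<tau> within {s..t})"
    and b: "\<And>\<tau>. \<tau> \<in> {s..t} \<Longrightarrow> (b has_vector_derivative b' \<tau>) (at \<tau> within {s..t})"
    and a'[continuous_intros]: "continuous_on {s..t} a'"
    and b'[continuous_intros]: "continuous_on {s..t} b'"
    and A: "\<And>x. x \<in> U \<Longrightarrow> (A has_derivative A' x) (at x)"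
    and A': "\<And>v. continuous_on U (\<lambda>x. A' x v)"
    and U: "\<And>\<tau> r. \<tau> \<in> {s..t} \<Longrightarrow> r \<in> {0..1} \<Longrightarrow> a \<tau> + r *\<^sub>R (b \<tau> - a \<tau>) \<in> U"
  shows "seg A (a t) (b t) - seg A (a s) (b s) =
    integral {s..t} (\<lambda>\<tau>. A (b \<tau>) \<bullet> b' \<tau> - A (a \<tau>) \<bullet> a' \<tau>) +
    integral {s..t} (\<lambda>\<tau>. integral {0..1} (\<lambda>r. rot_of (A' (a \<tau> + r *\<^sub>R (b \<tau> - a \<tau>))) *
        (rot90 (a' \<tau> + r *\<^sub>R (b' \<tau> - a' \<tau>)) \<bullet> (b \<tau> - a \<tau>))))"
proof -
  define X where "X = (\<lambda>\<tau> r. a \<tau> + r *\<^sub>R (b \<tau> - a \<tau>))"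
  define v where "v = (\<lambda>\<tau> r. a' \<tau> + r *\<^sub>R (b' \<tau> - a' \<tau>))"
  define d where "d = (\<lambda>\<tau>. b \<tau> - a \<tau>)"
  define d' where "d' = (\<lambda>\<tau>. b' \<tau> - a' \<tau>)"
  have ca[continuous_intros]: "continuous_on {s..t} a" and cb[continuous_intros]: "continuous_on {s..t} b"
    using a b by (meson continuous_on_vector_derivative)+
  have lin: "linear (A' x)" if "x \<in> U" for x
    using A [OF that] has_derivative_linear by blast
  have XU: "X \<tau> r \<in> U" if "\<tau> \<in> {s..t}" "r \<in> {0..1}" for \<tau> r
    using U that by (simp add: X_def)
  have cA: "continuous_on U A"
    using A by (meson continuous_at_imp_continuous_on has_derivative_continuous)
  let ?P = "{s..t} \<times> {0..1::real}"
  have c1: "continuous_on ?P (\<lambda>p. a (fst p))" "continuous_on ?P (\<lambda>p. b (fst p))"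
    "continuous_on ?P (\<lambda>p. a' (fst p))" "continuous_on ?P (\<lambda>p. b' (fst p))"
    by (auto intro!: continuous_on_compose2 [OF ca] continuous_on_compose2 [OF cb]
        continuous_on_compose2 [OF a'] continuous_on_compose2 [OF b'] continuous_intros)
  have cX: "continuous_on ?P (\<lambda>p. X (fst p) (snd p))"
    unfolding X_def by (intro continuous_intros c1)
  have cv: "continuous_on ?P (\<lambda>p. v (fst p) (snd p))"
    unfolding v_def by (intro continuous_intros c1)
  have cd: "continuous_on ?P (\<lambda>p. d (fst p))" "continuous_on ?P (\<lambda>p. d' (fst p))"
    unfolding d_def d'_def by (intro continuous_intros c1)+
  have cAX: "continuous_on ?P (\<lambda>p. A (X (fst p) (snd p)))"
    by (rule continuous_on_compose2 [OF cA cX]) (auto intro: XU)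
  have cA'X: "continuous_on ?P (\<lambda>p. A' (X (fst p) (snd p)) w)" for w
    by (rule continuous_on_compose2 [OF A' cX]) (auto intro: XU)
  have cA'v: "continuous_on ?P (\<lambda>p. A' (X (fst p) (snd p)) (v (fst p) (snd p)))"
  proof -
    have "continuous_on ?P (\<lambda>p. (v (fst p) (snd p)) $ 1 *\<^sub>R A' (X (fst p) (snd p)) (axis 1 1) +
        (v (fst p) (snd p)) $ 2 *\<^sub>R A' (X (fst p) (snd p)) (axis 2 1))"
      by (intro continuous_intros cA'X cv)
    then show ?thesis
      by (rule continuous_on_eq) (auto intro!: linear_vec2_expand [symmetric] lin XU)
  qed
  have cA'd: "continuous_on ?P (\<lambda>p. A' (X (fst p) (snd p)) (d (fst p)))"
  proof -
    have "continuous_on ?P (\<lambda>p. (d (fst p)) $ 1 *\<^sub>R A' (X (fst p) (snd p)) (axis 1 1) +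
        (d (fst p)) $ 2 *\<^sub>R A' (X (fst p) (snd p)) (axis 2 1))"
      by (intro continuous_intros cA'X cd)
    then show ?thesis
      by (rule continuous_on_eq) (auto intro!: linear_vec2_expand [symmetric] lin XU)
  qed
  have cslice: "continuous_on {0..1} (\<lambda>r. f (\<tau>, r))" if "continuous_on ?P f" "\<tau> \<in> {s..t}"
    for f :: "real \<times> real \<Rightarrow> real" and \<tau>
    by (rule continuous_on_compose2 [OF that(1)]) (use that(2) in \<open>auto intro!: continuous_intros\<close>)
  define f where "f = (\<lambda>\<tau> r. A (X \<tau> r) \<bullet> d \<tau>)"
  \<comment> \<open>\<open>fx\<close> is the \<open>\<tau>\<close>-derivative of
    \<open>A \<bullet> d\<close> and \<open>g\<close> the \<open>r\<close>-derivative of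
    \<open>A \<bullet> v\<close>. Both contain \<open>A \<bullet> d'\<close>, so their difference is
    the antisymmetric expression of \<open>rot_of_inner\<close>.\<close>
  define fx where "fx = (\<lambda>\<tau> r. A' (X \<tau> r) (v \<tau> r) \<bullet> d \<tau> + A (X \<tau> r) \<bullet> d' \<tau>)"
  define g where "g = (\<lambda>\<tau> r. A' (X \<tau> r) (d \<tau>) \<bullet> v \<tau> r + A (X \<tau> r) \<bullet> d' \<tau>)"
  have dd: "(d has_vector_derivative d' \<tau>) (at \<tau> within {s..t})" if "\<tau> \<in> {s..t}" for \<tau>
    unfolding d_def d'_def by (intro derivative_intros a b that)
  have fd: "((\<lambda>\<tau>. f \<tau> r) has_vector_derivative fx \<tau> r) (at \<tau> within {s..t})"
    if "\<tau> \<in> {s..t}" "r \<in> {0..1}" for \<tau> r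
  proof -
    have "((\<lambda>\<tau>. X \<tau> r) has_vector_derivative v \<tau> r) (at \<tau> within {s..t})"
      unfolding X_def v_def by (auto intro!: derivative_eq_intros a b that)
    then have "((A \<circ> (\<lambda>\<tau>. X \<tau> r)) has_vector_derivative A' (X \<tau> r) (v \<tau> r)) (at \<tau> within {s..t})"
      by (rule vector_derivative_diff_chain_within)
        (rule has_derivative_at_withinI [OF A [OF XU [OF that]]])
    from bounded_bilinear.has_vector_derivative [OF bounded_bilinear_inner this dd [OF that(1)]]
    show ?thesis by (simp add: f_def fx_def o_def add.commute)
  qed
  have gd: "((\<lambda>r. A (X \<tau> r) \<bullet> v \<tau> r) has_vector_derivative g \<tau> r) (at r within {0..1})"
    if "\<tau> \<in> {s..t}" "r \<in> {0..1}" for \<tau> r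
  proof -
    have "((\<lambda>r. X \<tau> r) has_vector_derivative d \<tau>) (at r within {0..1})"
      unfolding X_def d_def by (auto intro!: derivative_eq_intros)
    then have 1: "((A \<circ> (\<lambda>r. X \<tau> r)) has_vector_derivative A' (X \<tau> r) (d \<tau>)) (at r within {0..1})"
      by (rule vector_derivative_diff_chain_within)
        (rule has_derivative_at_withinI [OF A [OF XU [OF that]]])
    have 2: "((\<lambda>r. v \<tau> r) has_vector_derivative d' \<tau>) (at r within {0..1})"
      unfolding v_def d'_def by (auto intro!: derivative_eq_intros)
    from bounded_bilinear.has_vector_derivative [OF bounded_bilinear_inner 1 2]
    show ?thesis by (simp add: g_def o_def add.commute)
  qed
  have cf: "continuous_on ?P (\<lambda>p. f (fst p) (snd p))"
    unfolding f_def by (intro continuous_intros cAX cd)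
  have cfx: "continuous_on ?P (\<lambda>p. fx (fst p) (snd p))"
    unfolding fx_def by (intro continuous_intros cAX cd cA'v)
  have cg: "continuous_on ?P (\<lambda>p. g (fst p) (snd p))"
    unfolding g_def by (intro continuous_intros cAX cd cA'd cv)
  have leib: "((\<lambda>\<tau>. integral (cbox 0 1) (f \<tau>)) has_vector_derivative integral (cbox 0 1) (fx \<tau>))
      (at \<tau> within {s..t})" if "\<tau> \<in> {s..t}" for \<tau>
  proof (rule leibniz_rule_vector_derivative)
    show "((\<lambda>x. f x r) has_vector_derivative fx x r) (at x within {s..t})"
      if "x \<in> {s..t}" "r \<in> cbox 0 1" for x r
      using fd that by simp
    show "f x integrable_on cbox 0 1" if "x \<in> {s..t}" for x
      using cslice [OF cf that] by (simp add: integrable_continuous_interval)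
    show "continuous_on ({s..t} \<times> cbox 0 1) (\<lambda>(x, r). fx x r)"
      using cfx by (simp add: case_prod_unfold)
  qed (use that in auto)
  have "(integral (cbox 0 1) \<circ> fx has_integral
      integral (cbox 0 1) (f t) - integral (cbox 0 1) (f s)) {s..t}"
    using fundamental_theorem_of_calculus [OF st leib] by (simp add: o_def)
  then have e1: "seg A (a t) (b t) - seg A (a s) (b s) = integral {s..t} (\<lambda>\<tau>. integral {0..1} (fx \<tau>))"
    by (simp add: seg_def f_def X_def d_def o_def integral_unique)
  have e2: "integral {0..1} (g \<tau>) = A (b \<tau>) \<bullet> b' \<tau> - A (a \<tau>) \<bullet> a' \<tau>" if "\<tau> \<in> {s..t}" for \<tau>
    using fundamental_theorem_of_calculus [of 0 1 "\<lambda>r. A (X \<tau> r) \<bullet> v \<tau> r" "g \<tau>"] gd [OF that]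
    by (simp add: X_def v_def integral_unique)
  define k where "k = (\<lambda>\<tau> r. rot_of (A' (X \<tau> r)) * (rot90 (v \<tau> r) \<bullet> d \<tau>))"
  have kk: "k \<tau> r = fx \<tau> r - g \<tau> r" if "\<tau> \<in> {s..t}" "r \<in> {0..1}" for \<tau> r
    using rot_of_inner [OF lin [OF XU [OF that]], of "v \<tau> r" "d \<tau>"]
    by (simp add: k_def fx_def g_def)
  have e3: "integral {0..1} (fx \<tau>) = (A (b \<tau>) \<bullet> b' \<tau> - A (a \<tau>) \<bullet> a' \<tau>) + integral {0..1} (k \<tau>)"
    if "\<tau> \<in> {s..t}" for \<tau>
  proof -
    have "integral {0..1} (k \<tau>) = integral {0..1} (\<lambda>r. fx \<tau> r - g \<tau> r)"
      by (intro integral_cong kk that)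
    also have "\<dots> = integral {0..1} (fx \<tau>) - integral {0..1} (g \<tau>)"
      using cslice [OF cfx that] cslice [OF cg that]
      by (intro integral_diff) (simp_all add: integrable_continuous_interval)
    finally show ?thesis using e2 [OF that] by simp
  qed
  have ck: "continuous_on {s..t} (\<lambda>\<tau>. integral {0..1} (fx \<tau>))"
    using integral_continuous_on_param [of "{s..t}" 0 1 fx] cfx
    by (simp add: case_prod_unfold)
  have cAab: "continuous_on {s..t} (\<lambda>\<tau>. A (b \<tau>) \<bullet> b' \<tau> - A (a \<tau>) \<bullet> a' \<tau>)"
    by (intro continuous_intros continuous_on_compose2 [OF cA])
      (use U [of _ 1] U [of _ 0] in auto)
  have "integral {s..t} (\<lambda>\<tau>. integral {0..1} (k \<tau>)) =
      integral {s..t} (\<lambda>\<tau>. integral {0..1} (fx \<tau>) - (A (b \<tau>) \<bullet> b' \<tau> - A (a \<tau>) \<bullet> a' \<tau>))"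
    by (intro integral_cong) (simp add: e3)
  also have "\<dots> = integral {s..t} (\<lambda>\<tau>. integral {0..1} (fx \<tau>)) -
      integral {s..t} (\<lambda>\<tau>. A (b \<tau>) \<bullet> b' \<tau> - A (a \<tau>) \<bullet> a' \<tau>)"
    by (intro integral_diff) (simp_all add: integrable_continuous_interval ck cAab)
  finally show ?thesis
    using e1 by (simp add: k_def X_def v_def d_def)
qed

lemma integral_diff_le:
  fixes f g :: "real \<Rightarrow> real"
  assumes "s \<le> t" "continuous_on {s..t} f" "continuous_on {s..t} g"
    "\<And>x. x \<in> {s..t} \<Longrightarrow> \<bar>f x - g x\<bar> \<le> c"
  shows "\<bar>integral {s..t} f - integral {s..t} g\<bar> \<le> c * (t - s)"
proof -
  have "integral {s..t} f - integral {s..t} g = integral {s..t} (\<lambda>x. f x - g x)"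
    using assms by (simp add: integral_diff integrable_continuous_interval)
  moreover have "norm (integral {s..t} (\<lambda>x. f x - g x)) \<le> c * (t - s)"
    using assms by (intro integral_bound continuous_intros) auto
  ultimately show ?thesis by simp
qed

lemma continuous_on_compact_norm_bound:
  fixes f :: "'a::topological_space \<Rightarrow> 'b::real_normed_vector"
  assumes "compact S" "continuous_on S f"
  shows "\<exists>B\<ge>0. \<forall>x\<in>S. norm (f x) \<le> B"
proof -
  obtain B where B: "\<forall>y\<in>f ` S. norm y \<le> B"
    using compact_imp_bounded [OF compact_continuous_image [OF assms(2,1)]] bounded_iff by blast
  show ?thesis by (rule exI [of _ "max B 0"]) (use B in \<open>auto simp: le_max_iff_disj\<close>)
qed

lemma continuous_on_slice:
  assumes "continuous_on ({s..t} \<times> {a..b}) (\<lambda>p. f (fst p) (snd p))" "\<tau> \<in> {s..t}"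
  shows "continuous_on {a..b} (f \<tau>)"
proof -
  have "continuous_on {a..b} (\<lambda>r. f (fst (\<tau>, r)) (snd (\<tau>, r)))"
    by (rule continuous_on_compose2 [OF assms(1)]) (use assms(2) in \<open>auto intro!: continuous_intros\<close>)
  then show ?thesis by simp
qed

lemma continuous_on_param_integral:
  fixes f :: "real \<Rightarrow> real \<Rightarrow> real"
  assumes "continuous_on ({s..t} \<times> {a..b}) (\<lambda>p. f (fst p) (snd p))"
  shows "continuous_on {s..t} (\<lambda>\<tau>. integral {a..b} (f \<tau>))"
  using integral_continuous_on_param [of "{s..t}" a b f] assms by (simp add: case_prod_unfold)

lemma eq_of_le_eps_mult:
  fixes x y C :: real
  assumes "\<And>\<epsilon>. \<epsilon> > 0 \<Longrightarrow> \<bar>x - y\<bar> \<le> \<epsilon> * C"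
  shows "x = y"
proof (rule ccontr)
  assume "x \<noteq> y"
  then have 1: "\<bar>x - y\<bar> > 0" by simp
  have C: "C > 0" using assms [of 1] 1 by simp
  have "\<bar>x - y\<bar> \<le> \<bar>x - y\<bar> / (2 * C) * C"
    by (rule assms) (use 1 C in simp)
  then show False using C 1 by (simp add: field_simps)
qed

text \<open>The merely continuous field \<open>T\<close> has rotation \<open>k\<close> in a sense that is stable under the limits
  taken in Stokes' theorem for ruled strips: locally uniform approximation by \<open>C\<^sup>1\<close> fields whose
  rotations approximate \<open>k\<close>.\<close>

definition weak_rot :: "(real^2) set \<Rightarrow> (real^2 \<Rightarrow> real^2) \<Rightarrow> (real^2 \<Rightarrow> real) \<Rightarrow> bool" where
  "weak_rot G T k \<longleftrightarrow> (\<forall>K \<epsilon>. compact K \<and> K \<subseteq> G \<and> \<epsilon> > 0 \<longrightarrow>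
     (\<exists>A A'. (\<forall>x. (A has_derivative A' x) (at x)) \<and> (\<forall>v. continuous_on UNIV (\<lambda>x. A' x v)) \<and>
        (\<forall>x\<in>K. norm (A x - T x) \<le> \<epsilon> \<and> \<bar>rot_of (A' x) - k x\<bar> \<le> \<epsilon>)))"

lemma segment_point: "p + r *\<^sub>R (q - p) \<in> closed_segment p q" if "r \<in> {0..1}" for p q :: "'a::real_vector"
  using that unfolding closed_segment_def by (auto simp: algebra_simps intro!: exI [of _ r])

lemma seg_diff_le:
  assumes "continuous_on (closed_segment p q) A" "continuous_on (closed_segment p q) T"
    "\<And>x. x \<in> closed_segment p q \<Longrightarrow> norm (A x - T x) \<le> \<epsilon>"
  shows "\<bar>seg A p q - seg T p q\<bar> \<le> \<epsilon> * norm (q - p)"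
proof -
  have "\<bar>seg A p q - seg T p q\<bar> \<le> \<epsilon> * norm (q - p) * (1 - 0)"
    unfolding seg_def
  proof (rule integral_diff_le)
    show "continuous_on {0..1} (\<lambda>r. A (p + r *\<^sub>R (q - p)) \<bullet> (q - p))"
      by (intro continuous_intros continuous_on_compose2 [OF assms(1)]) (auto intro!: segment_point)
    show "continuous_on {0..1} (\<lambda>r. T (p + r *\<^sub>R (q - p)) \<bullet> (q - p))"
      by (intro continuous_intros continuous_on_compose2 [OF assms(2)]) (auto intro!: segment_point)
    fix r :: real assume r: "r \<in> {0..1}"
    let ?x = "p + r *\<^sub>R (q - p)"
    have "\<bar>A ?x \<bullet> (q - p) - T ?x \<bullet> (q - p)\<bar> \<le> norm (A ?x - T ?x) * norm (q - p)"
      by (metis Cauchy_Schwarz_ineq2 inner_diff_left)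
    also have "\<dots> \<le> \<epsilon> * norm (q - p)"
      by (intro mult_right_mono assms(3) segment_point [OF r]) simp
    finally show "\<bar>A ?x \<bullet> (q - p) - T ?x \<bullet> (q - p)\<bar> \<le> \<epsilon> * norm (q - p)" .
  qed simp
  then show ?thesis by simp
qed

text \<open>All terms depend continuously on the field and its rotation, uniformly on the compact
  set swept by the strip, so the identity for the approximating \<open>C^1\<close> fields passes to
  the limit.\<close>

lemma strip_stokes_weak:
  fixes a b a' b' :: "real \<Rightarrow> real^2"
  assumes rot: "weak_rot G T k" and T: "continuous_on G T" and k: "continuous_on G k"
    and st: "s \<le> t"
    and a: "\<And>\<tau>. \<tau> \<in> {s..t} \<Longrightarrow> (a has_vector_derivative a' \<tau>) (at \<tau> within {s..t})"
    and b: "\<And>\<tau>. \<tau> \<in> {s..t} \<Longrightarrow> (b has_vector_derivative b' \<tau>) (at \<tau> within {s..t})"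
    and a': "continuous_on {s..t} a'"
    and b': "continuous_on {s..t} b'"
    and G: "\<And>\<tau> r. \<tau> \<in> {s..t} \<Longrightarrow> r \<in> {0..1} \<Longrightarrow> a \<tau> + r *\<^sub>R (b \<tau> - a \<tau>) \<in> G"
  shows "seg T (a t) (b t) - seg T (a s) (b s) =
    integral {s..t} (\<lambda>\<tau>. T (b \<tau>) \<bullet> b' \<tau> - T (a \<tau>) \<bullet> a' \<tau>) +
    integral {s..t} (\<lambda>\<tau>. integral {0..1} (\<lambda>r. k (a \<tau> + r *\<^sub>R (b \<tau> - a \<tau>)) *
        (rot90 (a' \<tau> + r *\<^sub>R (b' \<tau> - a' \<tau>)) \<bullet> (b \<tau> - a \<tau>))))"
    (is "?L = ?I + ?D")
proof -
  let ?P = "{s..t} \<times> {0..1::real}"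
  define X where "X = (\<lambda>\<tau> r. a \<tau> + r *\<^sub>R (b \<tau> - a \<tau>))"
  define w where "w = (\<lambda>\<tau> r. rot90 (a' \<tau> + r *\<^sub>R (b' \<tau> - a' \<tau>)) \<bullet> (b \<tau> - a \<tau>))"
  have ca: "continuous_on {s..t} a" and cb: "continuous_on {s..t} b"
    using a b by (meson continuous_on_vector_derivative)+
  have c1: "continuous_on ?P (\<lambda>p. a (fst p))" "continuous_on ?P (\<lambda>p. b (fst p))"
    "continuous_on ?P (\<lambda>p. a' (fst p))" "continuous_on ?P (\<lambda>p. b' (fst p))"
    by (auto intro!: continuous_on_compose2 [OF ca] continuous_on_compose2 [OF cb]
        continuous_on_compose2 [OF a'] continuous_on_compose2 [OF b'] continuous_intros)
  have cX: "continuous_on ?P (\<lambda>p. X (fst p) (snd p))"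
    unfolding X_def by (intro continuous_intros c1)
  have cw: "continuous_on ?P (\<lambda>p. w (fst p) (snd p))"
    unfolding w_def
    by (intro continuous_intros bounded_linear.continuous_on [OF bounded_linear_rot90] c1)
  define K where "K = (\<lambda>p. X (fst p) (snd p)) ` ?P"
  have K: "compact K"
    unfolding K_def by (intro compact_continuous_image cX compact_Times) auto
  have KG: "K \<subseteq> G" using G by (auto simp: K_def X_def)
  have XK: "X \<tau> r \<in> K" if "\<tau> \<in> {s..t}" "r \<in> {0..1}" for \<tau> r
    using that by (force simp: K_def)
  have segK: "closed_segment (a \<tau>) (b \<tau>) \<subseteq> K" if "\<tau> \<in> {s..t}" for \<tau>
  proof
    fix x assume "x \<in> closed_segment (a \<tau>) (b \<tau>)"
    then obtain r where "r \<in> {0..1}" "x = X \<tau> r"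
      unfolding closed_segment_def X_def by (auto simp: algebra_simps)
    then show "x \<in> K" using XK that by blast
  qed
  have abK: "a \<tau> \<in> K" "b \<tau> \<in> K" if "\<tau> \<in> {s..t}" for \<tau>
    using segK [OF that] by auto
  obtain B1 where B1: "\<And>\<tau>. \<tau> \<in> {s..t} \<Longrightarrow> norm (a' \<tau>) \<le> B1" "B1 \<ge> 0"
    using continuous_on_compact_norm_bound [OF compact_Icc a'] by blast
  obtain B2 where B2: "\<And>\<tau>. \<tau> \<in> {s..t} \<Longrightarrow> norm (b' \<tau>) \<le> B2" "B2 \<ge> 0"
    using continuous_on_compact_norm_bound [OF compact_Icc b'] by blast
  obtain B3 where B3: "\<And>p. p \<in> ?P \<Longrightarrow> norm (w (fst p) (snd p)) \<le> B3" "B3 \<ge> 0"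
    using continuous_on_compact_norm_bound [OF compact_Times [OF compact_Icc compact_Icc] cw] by blast
  \<comment> \<open>Collects the errors per unit \<open>\<epsilon>\<close>: two end segments, two
    sides and the enclosed area. It must not depend on the approximating field.\<close>
  define C where "C = norm (b t - a t) + norm (b s - a s) + (B1 + B2) * (t - s) + B3 * (t - s)"
  have "\<bar>?L - (?I + ?D)\<bar> \<le> \<epsilon> * C" if \<epsilon>: "\<epsilon> > 0" for \<epsilon>
  proof -
    obtain A A' where AA': "\<forall>x. (A has_derivative A' x) (at x)" "\<forall>v. continuous_on UNIV (\<lambda>x. A' x v)"
        "\<forall>x\<in>K. norm (A x - T x) \<le> \<epsilon> \<and> \<bar>rot_of (A' x) - k x\<bar> \<le> \<epsilon>"
      using rot [unfolded weak_rot_def, rule_format, of K \<epsilon>] K KG \<epsilon> by auto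
    have A: "\<And>x. (A has_derivative A' x) (at x)"
      and A': "\<And>v. continuous_on UNIV (\<lambda>x. A' x v)"
      and AT: "\<And>x. x \<in> K \<Longrightarrow> norm (A x - T x) \<le> \<epsilon>"
      and Ak: "\<And>x. x \<in> K \<Longrightarrow> \<bar>rot_of (A' x) - k x\<bar> \<le> \<epsilon>"
      using AA' by auto
    have cA: "continuous_on S A" for S
      using A by (meson continuous_at_imp_continuous_on has_derivative_continuous)
    have cT: "continuous_on K T" by (rule continuous_on_subset [OF T KG])
    have ck: "continuous_on K k" by (rule continuous_on_subset [OF k KG])
    have cr: "continuous_on UNIV (\<lambda>x. rot_of (A' x))"
      unfolding rot_of_def by (intro continuous_intros A')
    let ?I' = "integral {s..t} (\<lambda>\<tau>. A (b \<tau>) \<bullet> b' \<tau> - A (a \<tau>) \<bullet> a' \<tau>)"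
    let ?D' = "integral {s..t} (\<lambda>\<tau>. integral {0..1} (\<lambda>r. rot_of (A' (X \<tau> r)) * w \<tau> r))"
    have st1: "seg A (a t) (b t) - seg A (a s) (b s) = ?I' + ?D'"
      unfolding X_def w_def
      by (rule strip_stokes [OF st a b a' b' A, of UNIV]) (use A' in auto)
    have e1: "\<bar>seg A (a \<tau>) (b \<tau>) - seg T (a \<tau>) (b \<tau>)\<bar> \<le> \<epsilon> * norm (b \<tau> - a \<tau>)"
      if "\<tau> \<in> {s..t}" for \<tau>
    proof (rule seg_diff_le)
      show "continuous_on (closed_segment (a \<tau>) (b \<tau>)) T"
        by (rule continuous_on_subset [OF cT segK [OF that]])
      show "norm (A x - T x) \<le> \<epsilon>" if "x \<in> closed_segment (a \<tau>) (b \<tau>)" for x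
        using AT segK [OF \<open>\<tau> \<in> {s..t}\<close>] that by auto
    qed (rule cA)
    have e2: "\<bar>?I' - ?I\<bar> \<le> (\<epsilon> * (B1 + B2)) * (t - s)"
    proof (rule integral_diff_le [OF st])
      show "continuous_on {s..t} (\<lambda>\<tau>. A (b \<tau>) \<bullet> b' \<tau> - A (a \<tau>) \<bullet> a' \<tau>)"
        by (intro continuous_intros a' b' continuous_on_compose2 [OF cA [of UNIV]] ca cb) auto
      show "continuous_on {s..t} (\<lambda>\<tau>. T (b \<tau>) \<bullet> b' \<tau> - T (a \<tau>) \<bullet> a' \<tau>)"
        by (intro continuous_intros a' b' continuous_on_compose2 [OF cT] ca cb) (use abK in auto)
      fix \<tau> assume \<tau>: "\<tau> \<in> {s..t}"
      have "\<bar>A (b \<tau>) \<bullet> b' \<tau> - T (b \<tau>) \<bullet> b' \<tau>\<bar> \<le> norm (A (b \<tau>) - T (b \<tau>)) * norm (b' \<tau>)"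
        by (metis Cauchy_Schwarz_ineq2 inner_diff_left)
      also have "\<dots> \<le> \<epsilon> * B2"
        using AT abK \<tau> B2 \<epsilon> by (intro mult_mono) auto
      finally have 1: "\<bar>A (b \<tau>) \<bullet> b' \<tau> - T (b \<tau>) \<bullet> b' \<tau>\<bar> \<le> \<epsilon> * B2" .
      have "\<bar>A (a \<tau>) \<bullet> a' \<tau> - T (a \<tau>) \<bullet> a' \<tau>\<bar> \<le> norm (A (a \<tau>) - T (a \<tau>)) * norm (a' \<tau>)"
        by (metis Cauchy_Schwarz_ineq2 inner_diff_left)
      also have "\<dots> \<le> \<epsilon> * B1"
        using AT abK \<tau> B1 \<epsilon> by (intro mult_mono) auto
      finally have 2: "\<bar>A (a \<tau>) \<bullet> a' \<tau> - T (a \<tau>) \<bullet> a' \<tau>\<bar> \<le> \<epsilon> * B1" .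
      show "\<bar>A (b \<tau>) \<bullet> b' \<tau> - A (a \<tau>) \<bullet> a' \<tau> - (T (b \<tau>) \<bullet> b' \<tau> - T (a \<tau>) \<bullet> a' \<tau>)\<bar> \<le> \<epsilon> * (B1 + B2)"
        using 1 2 by (simp add: distrib_left)
    qed
    have c3: "continuous_on ?P (\<lambda>p. rot_of (A' (X (fst p) (snd p))) * w (fst p) (snd p))"
      by (intro continuous_intros cw continuous_on_compose2 [OF cr cX]) auto
    have c4: "continuous_on ?P (\<lambda>p. k (X (fst p) (snd p)) * w (fst p) (snd p))"
      by (intro continuous_intros cw continuous_on_compose2 [OF ck cX]) (auto intro: XK)
    have "\<bar>?D' - integral {s..t} (\<lambda>\<tau>. integral {0..1} (\<lambda>r. k (X \<tau> r) * w \<tau> r))\<bar> \<le> (\<epsilon> * B3) * (t - s)"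
    proof (rule integral_diff_le [OF st continuous_on_param_integral continuous_on_param_integral])
      fix \<tau> assume \<tau>: "\<tau> \<in> {s..t}"
      have "\<bar>integral {0..1} (\<lambda>r. rot_of (A' (X \<tau> r)) * w \<tau> r) - integral {0..1} (\<lambda>r. k (X \<tau> r) * w \<tau> r)\<bar>
        \<le> \<epsilon> * B3 * (1 - 0)"
      proof (rule integral_diff_le [OF _ continuous_on_slice continuous_on_slice])
        fix r :: real assume r: "r \<in> {0..1}"
        have "\<bar>rot_of (A' (X \<tau> r)) * w \<tau> r - k (X \<tau> r) * w \<tau> r\<bar> =
            \<bar>rot_of (A' (X \<tau> r)) - k (X \<tau> r)\<bar> * \<bar>w \<tau> r\<bar>"
          by (simp add: abs_mult [symmetric] left_diff_distrib)
        also have "\<dots> \<le> \<epsilon> * B3"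
          using Ak [OF XK [OF \<tau> r]] B3(1) [of "(\<tau>, r)"] B3(2) \<tau> r \<epsilon> by (intro mult_mono) auto
        finally show "\<bar>rot_of (A' (X \<tau> r)) * w \<tau> r - k (X \<tau> r) * w \<tau> r\<bar> \<le> \<epsilon> * B3" .
      qed (use c3 c4 \<tau> in auto)
      then show "\<bar>integral {0..1} (\<lambda>r. rot_of (A' (X \<tau> r)) * w \<tau> r) - integral {0..1} (\<lambda>r. k (X \<tau> r) * w \<tau> r)\<bar>
        \<le> \<epsilon> * B3" by simp
    qed (use c3 c4 in auto)
    then have e3: "\<bar>?D' - ?D\<bar> \<le> \<epsilon> * (B3 * (t - s))"
      by (simp add: X_def w_def mult.assoc)
    have e4: "\<bar>seg A (a t) (b t) - seg T (a t) (b t)\<bar> \<le> \<epsilon> * norm (b t - a t)"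
      "\<bar>seg A (a s) (b s) - seg T (a s) (b s)\<bar> \<le> \<epsilon> * norm (b s - a s)"
      using st by (auto intro: e1)
    have e5: "\<epsilon> * C = \<epsilon> * norm (b t - a t) + \<epsilon> * norm (b s - a s) + (\<epsilon> * (B1 + B2)) * (t - s) + \<epsilon> * (B3 * (t - s))"
      by (simp add: C_def algebra_simps)
    show ?thesis unfolding e5 using st1 e2 e3 e4 by linarith
  qed
  then show ?thesis by (rule eq_of_le_eps_mult)
qed

lemmas continuous_on_rot90 [continuous_intros] = bounded_linear.continuous_on [OF bounded_linear_rot90]

lemma in_segment_point:
  assumes "x \<in> closed_segment p q"
  obtains r where "r \<in> {0..1}" "x = p + r *\<^sub>R (q - p)"
proof -
  obtain u where "0 \<le> u" "u \<le> 1" "x = (1 - u) *\<^sub>R p + u *\<^sub>R q"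
    using assms unfolding closed_segment_def by blast
  then show ?thesis by (intro that [of u]) (auto simp: algebra_simps)
qed

lemma seg_const: "seg (\<lambda>_. c) p q = c \<bullet> (q - p)"
  by (simp add: seg_def)

text \<open>Integral curves of \<open>- T\<close> are those of \<open>T\<close> run backwards, so
  this is what lets statements about the past of a curve be turned into statements about its
  future.\<close>

lemma weak_rot_minus:
  assumes "weak_rot G T k"
  shows "weak_rot G (\<lambda>x. - T x) (\<lambda>x. - k x)"
  unfolding weak_rot_def
proof (intro allI impI)
  fix K and \<epsilon> :: real
  assume *: "compact K \<and> K \<subseteq> G \<and> 0 < \<epsilon>"
  obtain A A' where A: "\<forall>x. (A has_derivative A' x) (at x)" "\<forall>v. continuous_on UNIV (\<lambda>x. A' x v)"
      "\<forall>x\<in>K. norm (A x - T x) \<le> \<epsilon> \<and> \<bar>rot_of (A' x) - k x\<bar> \<le> \<epsilon>"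
    using assms [unfolded weak_rot_def, rule_format, of K \<epsilon>] * by auto
  show "\<exists>A A'. (\<forall>x. (A has_derivative A' x) (at x)) \<and> (\<forall>v. continuous_on UNIV (\<lambda>x. A' x v)) \<and>
      (\<forall>x\<in>K. norm (A x - - T x) \<le> \<epsilon> \<and> \<bar>rot_of (A' x) - - k x\<bar> \<le> \<epsilon>)"
  proof (intro exI conjI allI ballI)
    show "((\<lambda>x. - A x) has_derivative (\<lambda>v. - A' x v)) (at x)" for x
      using A(1) by (intro derivative_intros) auto
    show "continuous_on UNIV (\<lambda>x. - A' x v)" for v
      using A(2) by (intro continuous_intros) auto
    show "norm (- A x - - T x) \<le> \<epsilon>" if "x \<in> K" for x
      using A(3) that by (metis minus_diff_minus norm_minus_cancel)
    show "\<bar>rot_of (\<lambda>v. - A' x v) - - k x\<bar> \<le> \<epsilon>" if "x \<in> K" for x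
    proof -
      have "rot_of (\<lambda>v. - A' x v) - - k x = - (rot_of (A' x) - k x)"
        by (simp add: rot_of_def)
      then show ?thesis using A(3) that by (metis abs_minus_cancel)
    qed
  qed
qed

lemma seg_minus: "seg (\<lambda>x. - A x) p q = - seg A p q"
  by (simp add: seg_def)

section \<open>Ordinary differential equations\<close>

text \<open>Gronwall's inequality in both time directions: the bound on \<open>z'\<close> makes
  \<open>z\<close> times \<open>exp (C * \<tau>)\<close> nondecreasing and \<open>z\<close> times
  \<open>exp (- (C * \<tau>))\<close> nonincreasing.\<close>

lemma exp_growth_bound:
  fixes z z' :: "real \<Rightarrow> real"
  assumes st: "\<sigma> \<in> {s..t}" "\<tau> \<in> {s..t}"
    and z: "\<And>\<tau>. \<tau> \<in> {s..t} \<Longrightarrow> (z has_vector_derivative z' \<tau>) (at \<tau> within {s..t})"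
    and z': "\<And>\<tau>. \<tau> \<in> {s..t} \<Longrightarrow> \<bar>z' \<tau>\<bar> \<le> C * z \<tau>"
  shows "z \<tau> \<le> z \<sigma> * exp (C * \<bar>\<tau> - \<sigma>\<bar>)"
proof -
  have cz: "continuous_on {s..t} z"
    by (rule continuous_on_vector_derivative) (rule z)
  have dz: "DERIV z x :> z' x" if "s < x" "x < t" for x
  proof -
    have "at x within {s..t} = at x"
      using that by (intro at_within_interior) auto
    then show ?thesis
      using z [of x] that by (simp add: has_real_derivative_iff_has_vector_derivative)
  qed
  have mono: "z x * exp (C * x) \<le> z y * exp (C * y)" if "x \<le> y" "x \<in> {s..t}" "y \<in> {s..t}" for x y
  proof (rule DERIV_nonneg_imp_increasing_open [OF that(1)])
    fix u assume u: "x < u" "u < y"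
    then have "DERIV (\<lambda>x. z x * exp (C * x)) u :> (z' u + C * z u) * exp (C * u)"
      using that by (auto intro!: derivative_eq_intros dz simp: algebra_simps)
    moreover have "(z' u + C * z u) * exp (C * u) \<ge> 0"
      using z' [of u] that u by (intro mult_nonneg_nonneg) auto
    ultimately show "\<exists>d. DERIV (\<lambda>x. z x * exp (C * x)) u :> d \<and> d \<ge> 0" by blast
  next
    show "continuous_on {x..y} (\<lambda>x. z x * exp (C * x))"
      by (intro continuous_intros continuous_on_subset [OF cz]) (use that in auto)
  qed
  have anti: "z y * exp (- (C * y)) \<le> z x * exp (- (C * x))" if "x \<le> y" "x \<in> {s..t}" "y \<in> {s..t}" for x y
  proof (rule DERIV_nonpos_imp_decreasing_open [OF that(1)])
    fix u assume u: "x < u" "u < y"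
    then have "DERIV (\<lambda>x. z x * exp (- (C * x))) u :> (z' u - C * z u) * exp (- (C * u))"
      using that by (auto intro!: derivative_eq_intros dz simp: algebra_simps)
    moreover have "(z' u - C * z u) * exp (- (C * u)) \<le> 0"
      using z' [of u] that u by (intro mult_nonpos_nonneg) auto
    ultimately show "\<exists>d. DERIV (\<lambda>x. z x * exp (- (C * x))) u :> d \<and> d \<le> 0" by blast
  next
    show "continuous_on {x..y} (\<lambda>x. z x * exp (- (C * x)))"
      by (intro continuous_intros continuous_on_subset [OF cz]) (use that in auto)
  qed
  show ?thesis
  proof (cases "\<sigma> \<le> \<tau>")
    case True
    then show ?thesis
      using anti [OF True] st
      by (simp add: exp_minus exp_diff right_diff_distrib field_simps)
  next
    case False
    then have "\<tau> \<le> \<sigma>" by simp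
    then show ?thesis
      using mono [of \<tau> \<sigma>] st False
      by (simp add: exp_diff right_diff_distrib field_simps)
  qed
qed

section \<open>Existence of integral curves for bounded continuous fields\<close>

lemma eq_of_norm_le_eps_mult:
  fixes x y :: "'a::real_normed_vector"
  assumes "\<And>\<epsilon>. \<epsilon> > 0 \<Longrightarrow> norm (x - y) \<le> \<epsilon> * C"
  shows "x = y"
  using eq_of_le_eps_mult [of "norm (x - y)" 0 C] assms by simp

lemma norm_integral_diff_le:
  fixes f g :: "real \<Rightarrow> 'a::euclidean_space"
  assumes "s \<le> t" "continuous_on {s..t} f" "continuous_on {s..t} g"
    "\<And>x. x \<in> {s..t} \<Longrightarrow> norm (f x - g x) \<le> c"
  shows "norm (integral {s..t} f - integral {s..t} g) \<le> c * (t - s)"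
proof -
  have "integral {s..t} f - integral {s..t} g = integral {s..t} (\<lambda>x. f x - g x)"
    using assms by (simp add: integral_diff integrable_continuous_interval)
  moreover have "norm (integral {s..t} (\<lambda>x. f x - g x)) \<le> c * (t - s)"
    using assms by (intro integral_bound continuous_intros) auto
  ultimately show ?thesis by simp
qed

text \<open>Tonelli's delayed scheme. With delay \<open>h\<close> the right side up to time
  \<open>(j + 1) h\<close> uses only values up to time \<open>j h\<close>, so iteration from the
  constant \<open>p\<close> becomes stationary on each bounded interval after finitely many
  rounds.\<close>

lemma delayed_integral_equation:
  fixes X :: "'a::euclidean_space \<Rightarrow> 'a"
  assumes X: "continuous_on UNIV X" "\<And>x. norm (X x) \<le> 1" and h: "h > 0"
  shows "\<exists>f. (\<forall>x y. norm (f x - f y) \<le> \<bar>x - y\<bar>) \<and> f 0 = p \<and>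
    (\<forall>x\<in>{0..real (Suc n) * h}. f x = p + integral {0..x} (\<lambda>s. X (f (s - h))))"
proof -
  \<comment> \<open>For negative \<open>x\<close> the interval \<open>{0..x}\<close> is empty and
    \<open>\<Phi> f x = p\<close>; this supplies the history needed by the delayed argument.\<close>
  define \<Phi> where "\<Phi> = (\<lambda>f x. p + integral {0..x} (\<lambda>s. X (f (s - h))))"
  define g where "g = (\<lambda>j. (\<Phi> ^^ j) (\<lambda>_. p))"
  have g_Suc: "g (Suc j) = \<Phi> (g j)" for j by (simp add: g_def)
  have lip: "norm (\<Phi> f x - \<Phi> f y) \<le> \<bar>x - y\<bar>" if f: "continuous_on UNIV f" for f x y
  proof -
    have cont: "continuous_on S (\<lambda>s. X (f (s - h)))" for S
      by (intro continuous_on_compose2 [OF X(1)] continuous_on_compose2 [OF f] continuous_intros) auto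
    have *: "norm (\<Phi> f y - \<Phi> f x) \<le> y - x" if "x \<le> y" for x y
    proof -
      have max: "\<Phi> f x = \<Phi> f (max x 0)" for x
        by (cases "x < 0") (auto simp: \<Phi>_def max_def)
      have "integral {0..max x 0} (\<lambda>s. X (f (s - h))) + integral {max x 0..max y 0} (\<lambda>s. X (f (s - h))) =
          integral {0..max y 0} (\<lambda>s. X (f (s - h)))"
        by (rule Henstock_Kurzweil_Integration.integral_combine)
          (use that in \<open>auto intro: integrable_continuous_interval cont\<close>)
      then have "\<Phi> f (max y 0) - \<Phi> f (max x 0) = integral {max x 0..max y 0} (\<lambda>s. X (f (s - h)))"
        by (simp add: \<Phi>_def algebra_simps)
      then have "\<Phi> f y - \<Phi> f x = integral {max x 0..max y 0} (\<lambda>s. X (f (s - h)))"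
        using max [of x] max [of y] by simp
      also have "norm \<dots> \<le> 1 * (max y 0 - max x 0)"
        using that by (intro integral_bound cont X) auto
      also have "\<dots> \<le> y - x" using that by auto
      finally show ?thesis .
    qed
    show ?thesis
      using * [of x y] * [of y x] by (cases "x \<le> y") (auto simp: norm_minus_commute)
  qed
  have lip_cont: "continuous_on UNIV f" if "\<And>x y. norm (f x - f y) \<le> \<bar>x - y\<bar>" for f :: "real \<Rightarrow> 'a"
  proof -
    have "1-lipschitz_on UNIV f"
      by (rule lipschitz_onI) (use that in \<open>auto simp: dist_norm dist_real_def\<close>)
    then show ?thesis by (rule lipschitz_on_continuous_on)
  qed
  have g_lip: "norm (g j x - g j y) \<le> \<bar>x - y\<bar>" for j x y
  proof (induction j arbitrary: x y)
    case 0
    then show ?case by (simp add: g_def)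
  next
    case (Suc j)
    then show ?case unfolding g_Suc by (intro lip lip_cont)
  qed
  have stable: "g (Suc j) x = g j x" if "x \<le> real j * h" for j x
    using that
  proof (induction j arbitrary: x)
    case 0
    then have "integral {0..x} (\<lambda>s. X (g 0 (s - h))) = 0"
      by (cases "x = 0") auto
    then show ?case by (simp add: g_Suc) (simp add: \<Phi>_def g_def)
  next
    case (Suc j)
    have "\<Phi> (g (Suc j)) x = \<Phi> (g j) x"
      unfolding \<Phi>_def
      by (intro arg_cong2 [where f = "(+)"] refl integral_cong arg_cong [where f = X] Suc.IH)
        (use Suc.prems in \<open>auto simp: algebra_simps\<close>)
    then show ?case by (simp only: g_Suc)
  qed
  show ?thesis
  proof (intro exI conjI allI ballI)
    show "norm (g (Suc n) x - g (Suc n) y) \<le> \<bar>x - y\<bar>" for x y by (rule g_lip)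
    show "g (Suc n) 0 = p" by (simp add: g_Suc \<Phi>_def)
    fix x assume x: "x \<in> {0..real (Suc n) * h}"
    have "\<Phi> (g n) x = p + integral {0..x} (\<lambda>s. X (g (Suc n) (s - h)))"
      unfolding \<Phi>_def
      by (intro arg_cong2 [where f = "(+)"] refl integral_cong arg_cong [where f = X] stable [symmetric])
        (use x in \<open>auto simp: algebra_simps\<close>)
    then show "g (Suc n) x = p + integral {0..x} (\<lambda>s. X (g (Suc n) (s - h)))"
      by (simp only: g_Suc)
  qed
qed

text \<open>The delays \<open>L / (n + 1)\<close> tend to zero, and the delayed solutions, all
  1-Lipschitz, have a uniformly convergent subsequence by Arzela-Ascoli.\<close>

theorem peano_existence:
  fixes X :: "'a::euclidean_space \<Rightarrow> 'a"
  assumes X: "continuous_on UNIV X" "\<And>x. norm (X x) \<le> 1" and L: "L > 0"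
  obtains \<gamma> where "\<gamma> 0 = p"
    "\<And>\<tau>. \<tau> \<in> {0..L} \<Longrightarrow> (\<gamma> has_vector_derivative X (\<gamma> \<tau>)) (at \<tau> within {0..L})"
proof -
  define h where "h = (\<lambda>n. L / real (Suc n))"
  have h: "h n > 0" "real (Suc n) * h n = L" for n using L by (auto simp: h_def)
  have "\<forall>n. \<exists>f. (\<forall>x y. norm (f x - f y) \<le> \<bar>x - y\<bar>) \<and> f 0 = p \<and>
      (\<forall>x\<in>{0..L}. f x = p + integral {0..x} (\<lambda>s. X (f (s - h n))))"
    using delayed_integral_equation [OF X h(1)] h(2) by metis
  then obtain f where f: "\<And>n x y. norm (f n x - f n y) \<le> \<bar>x - y\<bar>" "\<And>n. f n 0 = p"
      "\<And>n x. x \<in> {0..L} \<Longrightarrow> f n x = p + integral {0..x} (\<lambda>s. X (f n (s - h n)))"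
    by metis
  have fb: "norm (f n x - p) \<le> \<bar>x\<bar>" for n x
    using f(1) [of n x 0] f(2) by simp
  have "norm (f n x) \<le> norm p + L" if "x \<in> {0..L}" for n x
    using fb [of n x] norm_triangle_sub [of "f n x" p] that by auto
  moreover have "\<exists>d>0. \<forall>n y. y \<in> {0..L} \<and> norm (x - y) < d \<longrightarrow> norm (f n x - f n y) < e"
    if "e > 0" for x e
    using f(1) that by (intro exI [of _ e]) (auto intro: le_less_trans)
  ultimately obtain \<gamma> r where c\<gamma>: "continuous_on {0..L} \<gamma>" and r: "strict_mono (r :: nat \<Rightarrow> nat)"
    and lim: "\<And>e. 0 < e \<Longrightarrow> \<exists>N. \<forall>n x. n \<ge> N \<and> x \<in> {0..L} \<longrightarrow> norm (f (r n) x - \<gamma> x) < e"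
    using Arzela_Ascoli [OF compact_Icc, of 0 L f "norm p + L"] by metis
  \<comment> \<open>Radius \<open>L + 1\<close> instead of \<open>L\<close> because the delayed
    argument \<open>s - h m\<close> can fall below 0, by less than 1.\<close>
  let ?B = "cball p (L + 1)"
  have uc: "uniformly_continuous_on ?B X"
    by (rule compact_uniformly_continuous [OF continuous_on_subset [OF X(1)]]) auto
  have cX: "continuous_on {0..L} (\<lambda>s. X (\<gamma> s))"
    by (rule continuous_on_compose2 [OF X(1) c\<gamma>]) auto
  have \<gamma>B: "norm (\<gamma> x - p) \<le> L" if x: "x \<in> {0..L}" for x
  proof (rule field_le_epsilon)
    fix e :: real assume "e > 0"
    from lim [OF this] obtain N where N: "\<forall>n x. n \<ge> N \<and> x \<in> {0..L} \<longrightarrow> norm (f (r n) x - \<gamma> x) < e" by blast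
    have "norm (\<gamma> x - p) \<le> norm (f (r N) x - p) + norm (f (r N) x - \<gamma> x)"
      using norm_triangle_ineq4 [of "f (r N) x - p" "f (r N) x - \<gamma> x"] by simp
    also have "\<dots> \<le> L + e" using fb [of "r N" x] N x by (intro add_mono) (auto intro: less_imp_le)
    finally show "norm (\<gamma> x - p) \<le> L + e" .
  qed
  have \<gamma>_eq: "\<gamma> x = p + integral {0..x} (\<lambda>s. X (\<gamma> s))" if x: "x \<in> {0..L}" for x
  proof (rule eq_of_norm_le_eps_mult)
    fix \<epsilon> :: real assume \<epsilon>: "\<epsilon> > 0"
    obtain d where d: "d > 0" "\<And>x y. x \<in> ?B \<Longrightarrow> y \<in> ?B \<Longrightarrow> dist y x < d \<Longrightarrow> dist (X y) (X x) < \<epsilon>"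
      using uc \<epsilon> unfolding uniformly_continuous_on_def by metis
    define d' where "d' = min (min d \<epsilon>) 1 / 2"
    have d': "d' > 0" "2 * d' \<le> d" "d' \<le> \<epsilon>" "d' \<le> 1" using d \<epsilon> by (auto simp: d'_def)
    obtain N where N: "\<forall>n x. n \<ge> N \<and> x \<in> {0..L} \<longrightarrow> norm (f (r n) x - \<gamma> x) < d'" using lim [OF d'(1)] by blast
    have "(\<lambda>n. L / real (Suc n)) \<longlonglongrightarrow> 0"
      using tendsto_mult_right_zero [OF LIMSEQ_inverse_real_of_nat, of L] by (simp add: field_simps)
    from order_tendstoD(2) [OF this d'(1)] obtain N' where N': "\<And>n. n \<ge> N' \<Longrightarrow> h n < d'"
      unfolding h_def eventually_sequentially by blast
    define m where "m = r (max N N')"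
    have m: "h m < d'" "\<And>x. x \<in> {0..L} \<Longrightarrow> norm (f m x - \<gamma> x) < d'"
      using N' [of m] N seq_suble [OF r, of "max N N'"] by (auto simp: m_def)
    have cm: "continuous_on S (f m)" for S
    proof -
      have "1-lipschitz_on S (f m)"
        by (rule lipschitz_onI) (use f(1) in \<open>auto simp: dist_norm dist_real_def\<close>)
      then show ?thesis by (rule lipschitz_on_continuous_on)
    qed
    have "norm (integral {0..x} (\<lambda>s. X (f m (s - h m))) - integral {0..x} (\<lambda>s. X (\<gamma> s))) \<le> \<epsilon> * (x - 0)"
    proof (rule norm_integral_diff_le)
      show "continuous_on {0..x} (\<lambda>s. X (f m (s - h m)))"
        by (intro continuous_on_compose2 [OF X(1)] continuous_on_compose2 [OF cm [of UNIV]] continuous_intros) auto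
      show "continuous_on {0..x} (\<lambda>s. X (\<gamma> s))"
        by (rule continuous_on_subset [OF cX]) (use x in auto)
      fix s assume s: "s \<in> {0..x}"
      then have sL: "s \<in> {0..L}" using x by auto
      have "norm (f m (s - h m) - f m s) \<le> h m" using f(1) [of m "s - h m" s] h(1) [of m] by simp
      then have near: "norm (f m (s - h m) - \<gamma> s) < 2 * d'"
        using m(2) [OF sL] m(1) norm_triangle_ineq [of "f m (s - h m) - f m s" "f m s - \<gamma> s"] by simp
      have "norm (f m (s - h m) - p) \<le> L + 1"
        using fb [of m "s - h m"] h(1) [of m] m(1) d'(4) sL by auto
      then have "dist (X (f m (s - h m))) (X (\<gamma> s)) < \<epsilon>"
        using \<gamma>B [OF sL] near d'(2) by (intro d(2)) (auto simp: dist_norm norm_minus_commute)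
      then show "norm (X (f m (s - h m)) - X (\<gamma> s)) \<le> \<epsilon>" by (simp add: dist_norm)
    qed (use x in auto)
    moreover have "\<epsilon> * (x - 0) \<le> \<epsilon> * L" using \<epsilon> x by (intro mult_left_mono) auto
    moreover have "norm (\<gamma> x - f m x) \<le> \<epsilon>"
      using m(2) [OF x] d'(3) by (simp add: norm_minus_commute)
    ultimately have "norm ((\<gamma> x - f m x) + (integral {0..x} (\<lambda>s. X (f m (s - h m))) - integral {0..x} (\<lambda>s. X (\<gamma> s)))) \<le> \<epsilon> + \<epsilon> * L"
      by (intro norm_triangle_le) linarith
    then show "norm (\<gamma> x - (p + integral {0..x} (\<lambda>s. X (\<gamma> s)))) \<le> \<epsilon> * (1 + L)"
      unfolding f(3) [OF x] by (simp add: algebra_simps)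
  qed
  show ?thesis
  proof
    show "\<gamma> 0 = p" using \<gamma>_eq [of 0] L by simp
    fix \<tau> assume \<tau>: "\<tau> \<in> {0..L}"
    have "((\<lambda>x. p + integral {0..x} (\<lambda>s. X (\<gamma> s))) has_vector_derivative X (\<gamma> \<tau>)) (at \<tau> within {0..L})"
      using has_vector_derivative_add [OF has_vector_derivative_const integral_has_vector_derivative [OF cX \<tau>]]
      by simp
    then show "(\<gamma> has_vector_derivative X (\<gamma> \<tau>)) (at \<tau> within {0..L})"
      using has_vector_derivative_transform [OF \<tau>, of \<gamma> "\<lambda>x. p + integral {0..x} (\<lambda>s. X (\<gamma> s))"] \<gamma>_eq
      by blast
  qed
qed

lemma first_exit:
  fixes f :: "real \<Rightarrow> real"
  assumes f: "continuous_on {0..t} f" and "f 0 < c" and ex: "\<tau>' \<in> {0..t}" "f \<tau>' \<ge> c"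
  obtains \<tau> where "\<tau> \<in> {0..t}" "0 < \<tau>" "f \<tau> = c" "\<And>s. s \<in> {0..<\<tau>} \<Longrightarrow> f s < c"
proof -
  define A where "A = {0..t} \<inter> f -` {c..}"
  have A: "closed A" unfolding A_def by (rule continuous_closed_preimage [OF f]) auto
  have ne: "A \<noteq> {}" "bdd_below A" using ex by (auto simp: A_def)
  define \<tau> where "\<tau> = Inf A"
  have \<tau>A: "\<tau> \<in> A" unfolding \<tau>_def by (rule closed_contains_Inf [OF ne A])
  have min: "s \<ge> \<tau>" if "s \<in> A" for s unfolding \<tau>_def by (rule cInf_lower [OF that ne(2)])
  obtain x where x: "0 \<le> x" "x \<le> \<tau>" "f x = c"
    using IVT' [of f 0 c \<tau>] \<tau>A \<open>f 0 < c\<close> continuous_on_subset [OF f, of "{0..\<tau>}"] by (auto simp: A_def)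
  then have "x \<in> A" using \<tau>A by (auto simp: A_def)
  then have "x = \<tau>" using min [of x] x by simp
  show ?thesis
  proof
    show "\<tau> \<in> {0..t}" "f \<tau> = c" using \<tau>A x \<open>x = \<tau>\<close> by (auto simp: A_def)
    then show "0 < \<tau>" using \<open>f 0 < c\<close> by (cases "\<tau> = 0") auto
    show "f s < c" if "s \<in> {0..<\<tau>}" for s
      using min [of s] that \<tau>A by (force simp: A_def)
  qed
qed

section \<open>Characteristics of a unit field with prescribed rotation\<close>

text \<open>The bounds on \<open>k\<close> are global, which spares domain conditions when
  \<open>k\<close> is compared at nearby points; in the application \<open>k\<close> is composed
  with a retraction onto a ball.\<close>

locale unit_field =
  fixes G :: "(real^2) set" and T :: "real^2 \<Rightarrow> real^2" and k :: "real^2 \<Rightarrow> real" and M :: real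
  assumes open_G: "open G"
    and cont_T: "continuous_on G T"
    and unit_T: "\<And>x. x \<in> G \<Longrightarrow> norm (T x) = 1"
    and rot_T: "weak_rot G T k"
    and M_ge: "1 \<le> M"
    and k_bound: "\<And>x. \<bar>k x\<bar> \<le> M"
    and k_lip: "\<And>x y. \<bar>k x - k y\<bar> \<le> M * norm (x - y)"
begin

lemma unit_field_minus: "unit_field G (\<lambda>x. - T x) (\<lambda>x. - k x) M"
proof
  show "\<bar>- k x - - k y\<bar> \<le> M * norm (x - y)" for x y
    using k_lip [of x y] by (simp add: abs_minus_commute)
qed (use open_G cont_T unit_T rot_T M_ge k_bound in \<open>auto intro: weak_rot_minus continuous_intros\<close>)

lemma cont_k: "continuous_on S k"
proof -
  have "M-lipschitz_on S k"
    using k_lip M_ge by (intro lipschitz_onI) (auto simp: dist_real_def dist_norm)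
  then show ?thesis by (rule lipschitz_on_continuous_on)
qed

lemma cont_k_comp [continuous_intros]:
  assumes "continuous_on S f" shows "continuous_on S (\<lambda>x. k (f x))"
  using continuous_on_compose [OF assms cont_k] by (simp add: o_def)

lemma cont_T_comp:
  assumes "continuous_on S f" "\<And>x. x \<in> S \<Longrightarrow> f x \<in> G"
  shows "continuous_on S (\<lambda>x. T (f x))"
proof -
  have "f ` S \<subseteq> G" using assms(2) by auto
  then show ?thesis
    using continuous_on_compose [OF assms(1) continuous_on_subset [OF cont_T]] by (simp add: o_def)
qed

lemma T_inner_le: "x \<in> G \<Longrightarrow> T x \<bullet> v \<le> norm v"
  using norm_cauchy_schwarz [of "T x" v] unit_T by simp

definition is_char :: "(real \<Rightarrow> real^2) \<Rightarrow> real \<Rightarrow> real \<Rightarrow> bool" where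
  "is_char \<gamma> s t \<longleftrightarrow>
     (\<forall>\<tau>\<in>{s..t}. \<gamma> \<tau> \<in> G \<and> (\<gamma> has_vector_derivative T (\<gamma> \<tau>)) (at \<tau> within {s..t}))"

lemma is_charD:
  assumes "is_char \<gamma> s t" "\<tau> \<in> {s..t}"
  shows "\<gamma> \<tau> \<in> G" "(\<gamma> has_vector_derivative T (\<gamma> \<tau>)) (at \<tau> within {s..t})"
  using assms by (auto simp: is_char_def)

lemma is_char_subset:
  assumes "is_char \<gamma> s t" "s \<le> s'" "t' \<le> t"
  shows "is_char \<gamma> s' t'"
  unfolding is_char_def
proof (intro ballI conjI)
  fix \<tau> assume "\<tau> \<in> {s'..t'}"
  then have \<tau>: "\<tau> \<in> {s..t}" using assms by auto
  show "\<gamma> \<tau> \<in> G" by (rule is_charD [OF assms(1) \<tau>])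
  show "(\<gamma> has_vector_derivative T (\<gamma> \<tau>)) (at \<tau> within {s'..t'})"
    by (rule has_vector_derivative_within_subset [OF is_charD(2) [OF assms(1) \<tau>]]) (use assms in auto)
qed

lemma is_char_continuous:
  assumes "is_char \<gamma> s t"
  shows "continuous_on {s..t} \<gamma>" "continuous_on {s..t} (\<lambda>\<tau>. T (\<gamma> \<tau>))"
proof -
  show 1: "continuous_on {s..t} \<gamma>"
    by (rule continuous_on_vector_derivative) (rule is_charD [OF assms])
  show "continuous_on {s..t} (\<lambda>\<tau>. T (\<gamma> \<tau>))"
    by (rule cont_T_comp [OF 1]) (rule is_charD [OF assms])
qed

lemma seg_near:
  assumes "closed_segment p q \<subseteq> G" "\<And>x. x \<in> closed_segment p q \<Longrightarrow> norm (T x - T p) \<le> \<omega>"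
  shows "\<bar>seg T p q - T p \<bullet> (q - p)\<bar> \<le> \<omega> * norm (q - p)"
  using seg_diff_le [OF continuous_on_subset [OF cont_T assms(1)] continuous_on_const assms(2)]
  by (simp add: seg_const)

text \<open>The circulation of \<open>T\<close> along any translate of a characteristic curve is at most the length
  of the curve, with equality for the curve itself. So its derivative with respect to the
  translation vanishes, which is the asserted identity.\<close>

lemma char_T_integral:
  assumes \<gamma>: "is_char \<gamma> s t" and st: "s \<le> t" and e: "norm e \<le> 1"
  shows "(T (\<gamma> t) - T (\<gamma> s)) \<bullet> e = integral {s..t} (\<lambda>\<tau>. k (\<gamma> \<tau>) * (rot90 (T (\<gamma> \<tau>)) \<bullet> e))"
    (is "?L = ?R")
proof (rule eq_of_le_eps_mult)
  fix \<omega> :: real assume \<omega>: "\<omega> > 0"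
  note c\<gamma> = is_char_continuous [OF \<gamma>]
  have "compact (\<gamma> ` {s..t})" "\<gamma> ` {s..t} \<subseteq> G"
    using is_charD [OF \<gamma>] by (auto intro: compact_continuous_image [OF c\<gamma>(1)])
  then obtain e0 where e0: "e0 > 0" "(\<Union>x\<in>\<gamma> ` {s..t}. ball x e0) \<subseteq> G"
    using compact_subset_open_imp_ball_epsilon_subset open_G by blast
  have "\<exists>d>0. \<forall>x. dist x p < d \<longrightarrow> dist (T x) (T p) < \<omega>" if "p \<in> G" for p
  proof -
    have "isCont T p"
      using cont_T open_G that by (simp add: continuous_on_eq_continuous_at)
    then show ?thesis using \<omega> unfolding continuous_at_eps_delta by blast
  qed
  then obtain d1 d2 where d: "d1 > 0" "\<And>x. dist x (\<gamma> s) < d1 \<Longrightarrow> dist (T x) (T (\<gamma> s)) < \<omega>"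
      "d2 > 0" "\<And>x. dist x (\<gamma> t) < d2 \<Longrightarrow> dist (T x) (T (\<gamma> t)) < \<omega>"
    using is_charD(1) [OF \<gamma>, of s] is_charD(1) [OF \<gamma>, of t] st by (metis atLeastAtMost_iff order_refl)
  \<comment> \<open>Continuity of \<open>T\<close> is needed only at the two end points, where it
    evaluates the end segments to first order. The bound by \<open>\<omega>\<close> makes the area
    error, of order \<open>M * \<epsilon>^2\<close>, negligible against
    \<open>\<epsilon>\<close>.\<close>
  define \<epsilon> where "\<epsilon> = min (min e0 (min d1 d2)) \<omega> / 2"
  have \<epsilon>: "\<epsilon> > 0" "\<epsilon> < e0" "\<epsilon> < d1" "\<epsilon> < d2" "\<epsilon> \<le> \<omega>"
    using d e0 \<omega> by (auto simp: \<epsilon>_def)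
  \<comment> \<open>The inequality is one-sided for each \<open>h\<close>; using
    \<open>h = \<epsilon>\<close> and \<open>h = - \<epsilon>\<close> turns it into a bound for the
    absolute value.\<close>
  have main: "h * (?L - ?R) \<le> \<epsilon> * (\<omega> * (2 + M * (t - s)))" if h: "\<bar>h\<bar> = \<epsilon>" for h
  proof -
    have near: "norm (r *\<^sub>R h *\<^sub>R e) \<le> \<epsilon>" if "r \<in> {0..1}" for r
    proof -
      have "norm (r *\<^sub>R h *\<^sub>R e) = r * (\<epsilon> * norm e)" using that h by (simp add: abs_mult)
      also have "\<dots> \<le> 1 * (\<epsilon> * 1)"
        using that e \<epsilon> by (intro mult_mono) auto
      finally show ?thesis by simp
    qed
    have G: "\<gamma> \<tau> + r *\<^sub>R h *\<^sub>R e \<in> G" if "\<tau> \<in> {s..t}" "r \<in> {0..1}" for \<tau> r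
    proof -
      have "\<gamma> \<tau> + r *\<^sub>R h *\<^sub>R e \<in> ball (\<gamma> \<tau>) e0"
        using near [OF that(2)] \<epsilon> by (simp add: dist_norm)
      then show ?thesis using e0 that by blast
    qed
    have seg_b: "\<bar>seg T p (p + h *\<^sub>R e) - h * (T p \<bullet> e)\<bar> \<le> \<omega> * \<epsilon>"
      if p: "p = \<gamma> \<tau>" "\<tau> \<in> {s..t}" and d: "\<And>x. dist x p \<le> \<epsilon> \<Longrightarrow> dist (T x) (T p) < \<omega>" for p \<tau>
    proof -
      have *: "x \<in> G \<and> norm (T x - T p) \<le> \<omega>" if xin: "x \<in> closed_segment p (p + h *\<^sub>R e)" for x
      proof -
        obtain r where r: "r \<in> {0..1}" "x = p + r *\<^sub>R h *\<^sub>R e"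
          using in_segment_point [OF xin] by auto
        have "dist x p \<le> \<epsilon>" using near [OF r(1)] r by (simp add: dist_norm)
        then show ?thesis using G [OF p(2) r(1)] r p d by (simp add: dist_norm less_imp_le)
      qed
      have "\<bar>seg T p (p + h *\<^sub>R e) - T p \<bullet> (p + h *\<^sub>R e - p)\<bar> \<le> \<omega> * norm (p + h *\<^sub>R e - p)"
        by (rule seg_near) (use * in auto)
      also have "\<dots> \<le> \<omega> * \<epsilon>"
        using near [of 1] \<omega> by (intro mult_left_mono) auto
      finally show ?thesis by simp
    qed
    have b1: "\<bar>seg T (\<gamma> s) (\<gamma> s + h *\<^sub>R e) - h * (T (\<gamma> s) \<bullet> e)\<bar> \<le> \<omega> * \<epsilon>"
      by (rule seg_b [of _ s]) (use st d \<epsilon> in auto)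
    have b2: "\<bar>seg T (\<gamma> t) (\<gamma> t + h *\<^sub>R e) - h * (T (\<gamma> t) \<bullet> e)\<bar> \<le> \<omega> * \<epsilon>"
      by (rule seg_b [of _ t]) (use st d \<epsilon> in auto)
    let ?w = "\<lambda>\<tau>. rot90 (T (\<gamma> \<tau>)) \<bullet> (h *\<^sub>R e)"
    have strip: "seg T (\<gamma> t) (\<gamma> t + h *\<^sub>R e) - seg T (\<gamma> s) (\<gamma> s + h *\<^sub>R e) =
        integral {s..t} (\<lambda>\<tau>. T (\<gamma> \<tau> + h *\<^sub>R e) \<bullet> T (\<gamma> \<tau>) - T (\<gamma> \<tau>) \<bullet> T (\<gamma> \<tau>)) +
        integral {s..t} (\<lambda>\<tau>. integral {0..1} (\<lambda>r. k (\<gamma> \<tau> + r *\<^sub>R h *\<^sub>R e) * ?w \<tau>))"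
      using strip_stokes_weak [OF rot_T cont_T cont_k st, of \<gamma> "\<lambda>\<tau>. T (\<gamma> \<tau>)" "\<lambda>\<tau>. \<gamma> \<tau> + h *\<^sub>R e" "\<lambda>\<tau>. T (\<gamma> \<tau>)"]
        is_charD(2) [OF \<gamma>] c\<gamma> G
      by (simp add: has_vector_derivative_add_const)
    have nonpos: "integral {s..t} (\<lambda>\<tau>. T (\<gamma> \<tau> + h *\<^sub>R e) \<bullet> T (\<gamma> \<tau>) - T (\<gamma> \<tau>) \<bullet> T (\<gamma> \<tau>)) \<le> 0"
    proof -
      have "integral {s..t} (\<lambda>\<tau>. T (\<gamma> \<tau> + h *\<^sub>R e) \<bullet> T (\<gamma> \<tau>) - T (\<gamma> \<tau>) \<bullet> T (\<gamma> \<tau>)) \<le> integral {s..t} (\<lambda>_. 0)"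
      proof (rule integral_le)
        have "continuous_on {s..t} (\<lambda>\<tau>. T (\<gamma> \<tau> + h *\<^sub>R e))"
          by (rule cont_T_comp) (use G [of _ 1] c\<gamma> in \<open>auto intro!: continuous_intros\<close>)
        then show "(\<lambda>\<tau>. T (\<gamma> \<tau> + h *\<^sub>R e) \<bullet> T (\<gamma> \<tau>) - T (\<gamma> \<tau>) \<bullet> T (\<gamma> \<tau>)) integrable_on {s..t}"
          by (intro integrable_continuous_interval continuous_intros c\<gamma>)
        fix \<tau> assume \<tau>: "\<tau> \<in> {s..t}"
        have "T (\<gamma> \<tau>) \<bullet> T (\<gamma> \<tau>) = 1" "norm (T (\<gamma> \<tau>)) = 1"
          using unit_T is_charD(1) [OF \<gamma> \<tau>] by (auto simp: dot_square_norm)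
        then show "T (\<gamma> \<tau> + h *\<^sub>R e) \<bullet> T (\<gamma> \<tau>) - T (\<gamma> \<tau>) \<bullet> T (\<gamma> \<tau>) \<le> 0"
          using T_inner_le [OF G [OF \<tau>, of 1], of "T (\<gamma> \<tau>)"] by simp
      qed auto
      then show ?thesis by simp
    qed
    have c4: "continuous_on ({s..t} \<times> {0..1}) (\<lambda>p. k (\<gamma> (fst p) + (snd p) *\<^sub>R h *\<^sub>R e) * ?w (fst p))"
    proof -
      have "continuous_on ({s..t} \<times> {0..1::real}) (\<lambda>p. \<gamma> (fst p))"
        by (rule continuous_on_compose2 [OF c\<gamma>(1)]) (auto intro!: continuous_intros)
      moreover have "continuous_on ({s..t} \<times> {0..1::real}) (\<lambda>p. T (\<gamma> (fst p)))"
        by (rule continuous_on_compose2 [OF c\<gamma>(2)]) (auto intro!: continuous_intros)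
      ultimately show ?thesis
        by (intro continuous_intros)
    qed
    have ck: "continuous_on {s..t} (\<lambda>\<tau>. k (\<gamma> \<tau>) * ?w \<tau>)"
      by (intro continuous_intros c\<gamma>)
    have "\<bar>integral {s..t} (\<lambda>\<tau>. integral {0..1} (\<lambda>r. k (\<gamma> \<tau> + r *\<^sub>R h *\<^sub>R e) * ?w \<tau>)) -
        integral {s..t} (\<lambda>\<tau>. k (\<gamma> \<tau>) * ?w \<tau>)\<bar> \<le> M * \<epsilon> * \<epsilon> * (t - s)"
    proof (rule integral_diff_le [OF st continuous_on_param_integral [OF c4] ck])
      fix \<tau> assume \<tau>: "\<tau> \<in> {s..t}"
      have w: "\<bar>?w \<tau>\<bar> \<le> \<epsilon>"
        using rot90_inner_le [of "T (\<gamma> \<tau>)" "h *\<^sub>R e"] near [of 1] unit_T is_charD(1) [OF \<gamma> \<tau>] by simp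
      have "\<bar>integral {0..1} (\<lambda>r. k (\<gamma> \<tau> + r *\<^sub>R h *\<^sub>R e) * ?w \<tau>) - integral {0..1} (\<lambda>r::real. k (\<gamma> \<tau>) * ?w \<tau>)\<bar>
          \<le> M * \<epsilon> * \<epsilon> * (1 - 0)"
      proof (rule integral_diff_le)
        show "continuous_on {0..1} (\<lambda>r. k (\<gamma> \<tau> + r *\<^sub>R h *\<^sub>R e) * ?w \<tau>)"
          using continuous_on_slice [OF c4 \<tau>] by simp
        fix r :: real assume r: "r \<in> {0..1}"
        have "\<bar>k (\<gamma> \<tau> + r *\<^sub>R h *\<^sub>R e) - k (\<gamma> \<tau>)\<bar> \<le> M * norm (r *\<^sub>R h *\<^sub>R e)"
          using k_lip [of "\<gamma> \<tau> + r *\<^sub>R h *\<^sub>R e" "\<gamma> \<tau>"] by simp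
        also have "\<dots> \<le> M * \<epsilon>" using near [OF r] M_ge by (intro mult_left_mono) auto
        finally have "\<bar>k (\<gamma> \<tau> + r *\<^sub>R h *\<^sub>R e) - k (\<gamma> \<tau>)\<bar> * \<bar>?w \<tau>\<bar> \<le> (M * \<epsilon>) * \<epsilon>"
          using w \<epsilon> M_ge by (intro mult_mono) auto
        then show "\<bar>k (\<gamma> \<tau> + r *\<^sub>R h *\<^sub>R e) * ?w \<tau> - k (\<gamma> \<tau>) * ?w \<tau>\<bar> \<le> M * \<epsilon> * \<epsilon>"
          by (simp add: abs_mult [symmetric] left_diff_distrib)
      qed auto
      then show "\<bar>integral {0..1} (\<lambda>r. k (\<gamma> \<tau> + r *\<^sub>R h *\<^sub>R e) * ?w \<tau>) - k (\<gamma> \<tau>) * ?w \<tau>\<bar> \<le> M * \<epsilon> * \<epsilon>"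
        by simp
    qed
    moreover have "integral {s..t} (\<lambda>\<tau>. k (\<gamma> \<tau>) * ?w \<tau>) = h * ?R"
      by (simp add: mult.left_commute)
    moreover have "M * \<epsilon> * \<epsilon> * (t - s) \<le> M * \<epsilon> * \<omega> * (t - s)"
      using \<epsilon> M_ge st by (intro mult_right_mono mult_left_mono) auto
    moreover have "\<epsilon> * (\<omega> * (2 + M * (t - s))) = 2 * (\<omega> * \<epsilon>) + M * \<epsilon> * \<omega> * (t - s)"
      by (simp add: algebra_simps)
    moreover have "h * (?L - ?R) = h * (T (\<gamma> t) \<bullet> e) - h * (T (\<gamma> s) \<bullet> e) - h * ?R"
      by (simp add: algebra_simps inner_diff_left)
    ultimately show ?thesis using strip nonpos b1 b2 by linarith
  qed
  have "\<epsilon> * \<bar>?L - ?R\<bar> \<le> \<epsilon> * (\<omega> * (2 + M * (t - s)))"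
  proof (cases "?L - ?R \<ge> 0")
    case True
    then show ?thesis using main [of \<epsilon>] \<epsilon> by simp
  next
    case False
    have "\<epsilon> * \<bar>?L - ?R\<bar> = - \<epsilon> * (?L - ?R)"
      using False by (simp only: abs_of_neg not_le diff_ge_0_iff_ge diff_less_0_iff_less mult_minus_left mult_minus_right)
    also have "\<dots> \<le> \<epsilon> * (\<omega> * (2 + M * (t - s)))"
      by (rule main) (use \<epsilon> in simp)
    finally show ?thesis .
  qed
  then show "\<bar>?L - ?R\<bar> \<le> \<omega> * (2 + M * (t - s))"
    using \<epsilon> by simp
qed

text \<open>The curvature equation: the velocity of a characteristic turns at rate \<open>k\<close>.
  Along a characteristic \<open>T\<close> is thus differentiable, although it is only continuous as
  a function on the plane.\<close>

lemma char_T_derivative: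
  assumes \<gamma>: "is_char \<gamma> s t" and \<tau>: "\<tau> \<in> {s..t}"
  shows "((\<lambda>\<tau>. T (\<gamma> \<tau>)) has_vector_derivative k (\<gamma> \<tau>) *\<^sub>R rot90 (T (\<gamma> \<tau>))) (at \<tau> within {s..t})"
proof -
  let ?f = "\<lambda>\<tau>. k (\<gamma> \<tau>) *\<^sub>R rot90 (T (\<gamma> \<tau>))"
  note c\<gamma> = is_char_continuous [OF \<gamma>]
  have cf: "continuous_on {s..t} ?f"
    by (intro continuous_intros c\<gamma>)
  have eq: "T (\<gamma> u) = T (\<gamma> s) + integral {s..u} ?f" if u: "u \<in> {s..t}" for u
  proof -
    have int: "?f integrable_on {s..u}"
      by (intro integrable_continuous_interval continuous_on_subset [OF cf]) (use u in auto)
    show ?thesis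
    proof (rule euclidean_eqI)
      fix b :: "real^2" assume b: "b \<in> Basis"
      have "(T (\<gamma> u) - T (\<gamma> s)) \<bullet> b = integral {s..u} (\<lambda>\<tau>. k (\<gamma> \<tau>) * (rot90 (T (\<gamma> \<tau>)) \<bullet> b))"
        by (rule char_T_integral) (use is_char_subset [OF \<gamma>] u b in auto)
      also have "\<dots> = integral {s..u} (\<lambda>\<tau>. ?f \<tau> \<bullet> b)" by simp
      also have "\<dots> = integral {s..u} ?f \<bullet> b"
        using int by (rule integral_component_eq)
      finally show "T (\<gamma> u) \<bullet> b = (T (\<gamma> s) + integral {s..u} ?f) \<bullet> b"
        by (simp add: inner_diff_left inner_add_left)
    qed
  qed
  have "((\<lambda>u. T (\<gamma> s) + integral {s..u} ?f) has_vector_derivative ?f \<tau>) (at \<tau> within {s..t})"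
    using has_vector_derivative_add [OF has_vector_derivative_const integral_has_vector_derivative [OF cf \<tau>]]
    by simp
  then show ?thesis
    using has_vector_derivative_transform [OF \<tau>, of "\<lambda>u. T (\<gamma> u)" "\<lambda>u. T (\<gamma> s) + integral {s..u} ?f"] eq
    by blast
qed

text \<open>By the curvature equation, position and direction together solve a first-order system
  with Lipschitz right side. The state must include the direction because \<open>T\<close> is not
  known to be Lipschitz at this stage. The estimate runs in both time directions.\<close>

lemma char_gronwall:
  assumes x: "is_char x s t" and y: "is_char y s t" and st: "\<sigma> \<in> {s..t}" "\<tau> \<in> {s..t}"
  shows "(norm (x \<tau> - y \<tau>))\<^sup>2 + (norm (T (x \<tau>) - T (y \<tau>)))\<^sup>2 \<le>
    ((norm (x \<sigma> - y \<sigma>))\<^sup>2 + (norm (T (x \<sigma>) - T (y \<sigma>)))\<^sup>2) * exp ((1 + M) * \<bar>\<tau> - \<sigma>\<bar>)"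
proof -
  define d where "d = (\<lambda>\<tau>. x \<tau> - y \<tau>)"
  define w where "w = (\<lambda>\<tau>. T (x \<tau>) - T (y \<tau>))"
  define w' where "w' = (\<lambda>\<tau>. k (x \<tau>) *\<^sub>R rot90 (T (x \<tau>)) - k (y \<tau>) *\<^sub>R rot90 (T (y \<tau>)))"
  define z where "z = (\<lambda>\<tau>. d \<tau> \<bullet> d \<tau> + w \<tau> \<bullet> w \<tau>)"
  define z' where "z' = (\<lambda>\<tau>. 2 * (d \<tau> \<bullet> w \<tau>) + 2 * (w \<tau> \<bullet> w' \<tau>))"
  have "z \<tau> \<le> z \<sigma> * exp ((1 + M) * \<bar>\<tau> - \<sigma>\<bar>)"
  proof (rule exp_growth_bound [OF st])
    fix u assume u: "u \<in> {s..t}"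
    have d: "(d has_vector_derivative w u) (at u within {s..t})"
      unfolding d_def w_def by (intro derivative_intros is_charD [OF x u] is_charD [OF y u])
    have w: "(w has_vector_derivative w' u) (at u within {s..t})"
      unfolding w_def w'_def by (intro derivative_intros char_T_derivative [OF x u] char_T_derivative [OF y u])
    have "((\<lambda>u. d u \<bullet> d u + w u \<bullet> w u) has_vector_derivative
        (d u \<bullet> w u + w u \<bullet> d u) + (w u \<bullet> w' u + w' u \<bullet> w u)) (at u within {s..t})"
      by (intro has_vector_derivative_add bounded_bilinear.has_vector_derivative [OF bounded_bilinear_inner] d w)
    then show "(z has_vector_derivative z' u) (at u within {s..t})"
      by (simp add: z_def z'_def inner_commute)
    \<comment> \<open>The common rotation \<open>k (x u) *\<^sub>R rot90 (w u)\<close> is orthogonal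
      to \<open>w u\<close>, so only the difference of the curvatures contributes.\<close>
    have eq: "w' u = k (x u) *\<^sub>R rot90 (w u) + (k (x u) - k (y u)) *\<^sub>R rot90 (T (y u))"
      by (simp add: w'_def w_def rot90_simps algebra_simps)
    have "w u \<bullet> w' u = (k (x u) - k (y u)) * (w u \<bullet> rot90 (T (y u)))"
      unfolding eq by (simp add: inner_add_right)
    moreover have "\<bar>(k (x u) - k (y u)) * (w u \<bullet> rot90 (T (y u)))\<bar> \<le> (M * norm (d u)) * norm (w u)"
    proof -
      have "\<bar>w u \<bullet> rot90 (T (y u))\<bar> \<le> norm (w u)"
        using Cauchy_Schwarz_ineq2 [of "w u" "rot90 (T (y u))"] unit_T is_charD(1) [OF y u] by simp
      then show ?thesis
        using k_lip [of "x u" "y u"] M_ge unfolding abs_mult d_def by (intro mult_mono) auto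
    qed
    moreover have "\<bar>d u \<bullet> w u\<bar> \<le> norm (d u) * norm (w u)" by (rule Cauchy_Schwarz_ineq2)
    ultimately have "\<bar>z' u\<bar> \<le> (1 + M) * (2 * (norm (d u) * norm (w u)))"
      unfolding z'_def by (simp add: algebra_simps)
    also have "\<dots> \<le> (1 + M) * z u"
      using sum_squares_bound [of "norm (d u)" "norm (w u)"] M_ge
      by (intro mult_left_mono) (auto simp: z_def power2_norm_eq_inner mult.assoc)
    finally show "\<bar>z' u\<bar> \<le> (1 + M) * z u" .
  qed
  then show ?thesis by (simp add: z_def d_def w_def power2_norm_eq_inner)
qed

text \<open>\<open>T\<close> being a function of position, agreement of the positions at
  \<open>\<sigma>\<close> includes agreement of the directions.\<close>

lemma char_unique:
  assumes x: "is_char x s t" and y: "is_char y s t" and st: "\<sigma> \<in> {s..t}" "\<tau> \<in> {s..t}"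
    and "x \<sigma> = y \<sigma>"
  shows "x \<tau> = y \<tau>"
  using char_gronwall [OF x y st] assms(5) by (simp add: sum_power2_le_zero_iff)

text \<open>The comparison curve joins \<open>\<beta> 0\<close> to \<open>\<beta> t + d\<close> along \<open>\<beta> \<tau> + (\<tau>/t) d\<close>. The
  first-order terms of its length and of the enclosed curvature cancel.\<close>

lemma char_seg_le:
  assumes \<beta>: "is_char \<beta> 0 t" and t: "0 < t" "t \<le> 1"
    and G: "\<And>\<tau> r. \<tau> \<in> {0..t} \<Longrightarrow> r \<in> {0..1} \<Longrightarrow> \<beta> \<tau> + r *\<^sub>R d \<in> G"
  shows "seg T (\<beta> t) (\<beta> t + d) \<le> T (\<beta> t) \<bullet> d + (1 + M) / t * (norm d)\<^sup>2"
proof -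
  define b where "b = (\<lambda>\<tau>. \<beta> \<tau> + (\<tau> / t) *\<^sub>R d)"
  define b' where "b' = (\<lambda>\<tau>. T (\<beta> \<tau>) + (1 / t) *\<^sub>R d)"
  define c where "c = (\<lambda>\<tau>. rot90 (T (\<beta> \<tau>)) \<bullet> d)"
  note c\<beta> = is_char_continuous [OF \<beta>]
  have bG: "\<beta> \<tau> + r *\<^sub>R (\<tau> / t) *\<^sub>R d \<in> G" if "\<tau> \<in> {0..t}" "r \<in> {0..1}" for \<tau> r
  proof -
    have "\<tau> / t \<in> {0..1}" using that t by auto
    then have "r * (\<tau> / t) \<in> {0..1}" using that mult_le_one [of r "\<tau> / t"] by auto
    then show ?thesis using G [OF that(1)] by simp
  qed
  have strip: "seg T (\<beta> t) (b t) - seg T (\<beta> 0) (b 0) =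
    integral {0..t} (\<lambda>\<tau>. T (b \<tau>) \<bullet> b' \<tau> - T (\<beta> \<tau>) \<bullet> T (\<beta> \<tau>)) +
    integral {0..t} (\<lambda>\<tau>. integral {0..1} (\<lambda>r. k (\<beta> \<tau> + r *\<^sub>R (b \<tau> - \<beta> \<tau>)) *
        (rot90 (T (\<beta> \<tau>) + r *\<^sub>R (b' \<tau> - T (\<beta> \<tau>))) \<bullet> (b \<tau> - \<beta> \<tau>))))"
  proof (rule strip_stokes_weak [OF rot_T cont_T cont_k])
    show "(b has_vector_derivative b' \<tau>) (at \<tau> within {0..t})" if "\<tau> \<in> {0..t}" for \<tau>
    proof -
      have "((\<lambda>\<tau>. (\<tau> / t) *\<^sub>R d) has_vector_derivative (1 / t) *\<^sub>R d) (at \<tau> within {0..t})"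
        using t by (auto intro!: derivative_eq_intros)
      then show ?thesis
        unfolding b_def b'_def by (intro has_vector_derivative_add is_charD [OF \<beta> that])
    qed
    show "continuous_on {0..t} b'" unfolding b'_def by (intro continuous_intros c\<beta>)
    show "\<beta> \<tau> + r *\<^sub>R (b \<tau> - \<beta> \<tau>) \<in> G" if "\<tau> \<in> {0..t}" "r \<in> {0..1}" for \<tau> r
      using bG [OF that] by (simp add: b_def)
  qed (use t c\<beta> is_charD [OF \<beta>] in auto)
  have eq: "k (\<beta> \<tau> + r *\<^sub>R (b \<tau> - \<beta> \<tau>)) * (rot90 (T (\<beta> \<tau>) + r *\<^sub>R (b' \<tau> - T (\<beta> \<tau>))) \<bullet> (b \<tau> - \<beta> \<tau>)) =
      k (\<beta> \<tau> + r *\<^sub>R (\<tau> / t) *\<^sub>R d) * (\<tau> / t * c \<tau>)" for \<tau> r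
    by (simp add: b_def b'_def c_def rot90_simps inner_add_left)
  have b_le: "T (b \<tau>) \<bullet> b' \<tau> - T (\<beta> \<tau>) \<bullet> T (\<beta> \<tau>) \<le> (T (\<beta> \<tau>) \<bullet> d) / t + (norm d)\<^sup>2 / (2 * t\<^sup>2)"
    if \<tau>: "\<tau> \<in> {0..t}" for \<tau>
  proof -
    have 1: "norm (T (\<beta> \<tau>)) = 1" using unit_T is_charD(1) [OF \<beta> \<tau>] by simp
    then have 2: "T (\<beta> \<tau>) \<bullet> T (\<beta> \<tau>) = 1" by (simp add: dot_square_norm)
    let ?e = "(T (\<beta> \<tau>) \<bullet> d) / t + (norm d)\<^sup>2 / (2 * t\<^sup>2)"
    have "(norm (b' \<tau>))\<^sup>2 = 1 + 2 * ((T (\<beta> \<tau>) \<bullet> d) / t) + (norm d)\<^sup>2 / t\<^sup>2"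
      unfolding power2_norm_eq_inner b'_def
      using 2 t by (simp add: inner_add_left inner_add_right inner_commute power2_eq_square)
    then have e: "(norm (b' \<tau>))\<^sup>2 = 1 + 2 * ?e" by simp
    then have pos: "1 + 2 * ?e \<ge> 0" by (metis zero_le_power2)
    \<comment> \<open>Bounds the square root that gives the length element by its tangent at 1, in
      the squared form \<open>1 + 2 * e \<le> (1 + e)^2\<close>.\<close>
    have sq: "(norm (b' \<tau>))\<^sup>2 \<le> (1 + ?e)\<^sup>2"
    proof -
      have "(1 + r)\<^sup>2 = 1 + 2 * r + r\<^sup>2" for r :: real by (simp add: power2_sum)
      from this [of ?e] show ?thesis unfolding e by simp
    qed
    have "norm (b' \<tau>) \<le> 1 + ?e"
      by (rule power2_le_imp_le [OF sq]) (use pos in simp)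
    moreover have "T (b \<tau>) \<bullet> b' \<tau> \<le> norm (b' \<tau>)"
      using T_inner_le bG [OF \<tau>, of 1] by (simp add: b_def)
    ultimately show ?thesis using 2 by simp
  qed
  define f where "f = (\<lambda>\<tau>. T (b \<tau>) \<bullet> b' \<tau> - T (\<beta> \<tau>) \<bullet> T (\<beta> \<tau>))"
  define g where "g = (\<lambda>\<tau>. integral {0..1} (\<lambda>r. k (\<beta> \<tau> + r *\<^sub>R (\<tau> / t) *\<^sub>R d) * (\<tau> / t * c \<tau>)))"
  define p where "p = (\<lambda>\<tau>. (T (\<beta> \<tau>) \<bullet> d) / t + k (\<beta> \<tau>) * (\<tau> / t * c \<tau>))"
  define C where "C = (norm d)\<^sup>2 / (2 * t\<^sup>2) + M * (norm d)\<^sup>2"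
  have cc: "continuous_on {0..t} c"
    unfolding c_def by (intro continuous_intros c\<beta>)
  have cf: "continuous_on {0..t} f"
  proof -
    have "continuous_on {0..t} (\<lambda>\<tau>. T (b \<tau>))"
    proof (rule cont_T_comp)
      show "continuous_on {0..t} b" unfolding b_def using t by (intro continuous_intros c\<beta>) auto
      show "b \<tau> \<in> G" if "\<tau> \<in> {0..t}" for \<tau> using bG [OF that, of 1] by (simp add: b_def)
    qed
    then show ?thesis
      unfolding f_def b'_def by (intro continuous_intros c\<beta>)
  qed
  have cg2: "continuous_on ({0..t} \<times> {0..1}) (\<lambda>p. k (\<beta> (fst p) + snd p *\<^sub>R (fst p / t) *\<^sub>R d) * (fst p / t * c (fst p)))"
  proof -
    have "continuous_on ({0..t} \<times> {0..1::real}) (\<lambda>p. \<beta> (fst p))"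
      by (rule continuous_on_compose2 [OF c\<beta>(1)]) (auto intro!: continuous_intros)
    moreover have "continuous_on ({0..t} \<times> {0..1::real}) (\<lambda>p. c (fst p))"
      by (rule continuous_on_compose2 [OF cc]) (auto intro!: continuous_intros)
    ultimately show ?thesis
      using t by (intro continuous_intros) auto
  qed
  have cg: "continuous_on {0..t} g"
    unfolding g_def by (rule continuous_on_param_integral [OF cg2])
  have cp: "continuous_on {0..t} p"
    unfolding p_def using t by (intro continuous_intros c\<beta> cc) auto
  have c_le: "\<bar>\<tau> / t * c \<tau>\<bar> \<le> norm d" if \<tau>: "\<tau> \<in> {0..t}" for \<tau>
  proof -
    have "\<bar>c \<tau>\<bar> \<le> norm d"
      using rot90_inner_le [of "T (\<beta> \<tau>)" d] unit_T is_charD(1) [OF \<beta> \<tau>] by (simp add: c_def)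
    then have "\<bar>\<tau> / t\<bar> * \<bar>c \<tau>\<bar> \<le> 1 * norm d"
      using \<tau> t by (intro mult_mono) auto
    then show ?thesis by (simp add: abs_mult)
  qed
  have g_le: "g \<tau> \<le> k (\<beta> \<tau>) * (\<tau> / t * c \<tau>) + M * (norm d)\<^sup>2" if \<tau>: "\<tau> \<in> {0..t}" for \<tau>
  proof -
    have "\<bar>g \<tau> - integral {0..1} (\<lambda>r::real. k (\<beta> \<tau>) * (\<tau> / t * c \<tau>))\<bar> \<le> M * (norm d)\<^sup>2 * (1 - 0)"
      unfolding g_def
    proof (rule integral_diff_le)
      show "continuous_on {0..1} (\<lambda>r. k (\<beta> \<tau> + r *\<^sub>R (\<tau> / t) *\<^sub>R d) * (\<tau> / t * c \<tau>))"
        using continuous_on_slice [OF cg2 \<tau>] by simp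
      fix r :: real assume r: "r \<in> {0..1}"
      define q where "q = \<tau> / t"
      have q: "0 \<le> q" "q \<le> 1" using \<tau> t by (auto simp: q_def)
      then have "\<bar>r * q\<bar> \<le> 1" using r by (simp add: mult_le_one)
      then have "\<bar>r * q\<bar> * norm d \<le> norm d" by (intro mult_left_le_one_le) auto
      then have "norm (r *\<^sub>R (\<tau> / t) *\<^sub>R d) \<le> norm d" unfolding q_def [symmetric] by simp
      then have "M * norm (r *\<^sub>R (\<tau> / t) *\<^sub>R d) \<le> M * norm d"
        using M_ge by (intro mult_left_mono) auto
      then have "\<bar>k (\<beta> \<tau> + r *\<^sub>R (\<tau> / t) *\<^sub>R d) - k (\<beta> \<tau>)\<bar> \<le> M * norm d"
        using k_lip [of "\<beta> \<tau> + r *\<^sub>R (\<tau> / t) *\<^sub>R d" "\<beta> \<tau>"] by simp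
      then have "\<bar>k (\<beta> \<tau> + r *\<^sub>R (\<tau> / t) *\<^sub>R d) - k (\<beta> \<tau>)\<bar> * \<bar>\<tau> / t * c \<tau>\<bar> \<le> (M * norm d) * norm d"
        using c_le [OF \<tau>] M_ge by (intro mult_mono) auto
      then show "\<bar>k (\<beta> \<tau> + r *\<^sub>R (\<tau> / t) *\<^sub>R d) * (\<tau> / t * c \<tau>) - k (\<beta> \<tau>) * (\<tau> / t * c \<tau>)\<bar> \<le> M * (norm d)\<^sup>2"
        by (simp only: left_diff_distrib [symmetric] abs_mult power2_eq_square mult.assoc)
    qed auto
    then show ?thesis by simp
  qed
  have "seg T (\<beta> t) (\<beta> t + d) = integral {0..t} f + integral {0..t} g"
    using strip t unfolding eq f_def g_def by (simp add: b_def)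
  also have "\<dots> = integral {0..t} (\<lambda>\<tau>. f \<tau> + g \<tau>)"
    by (rule integral_add [symmetric]) (intro integrable_continuous_interval cf cg)+
  also have "\<dots> \<le> integral {0..t} (\<lambda>\<tau>. p \<tau> + C)"
  proof (rule integral_le)
    show "f \<tau> + g \<tau> \<le> p \<tau> + C" if "\<tau> \<in> {0..t}" for \<tau>
      using b_le [OF that] g_le [OF that] by (simp add: p_def C_def f_def)
  qed (intro integrable_continuous_interval continuous_intros cf cg cp)+
  \<comment> \<open>By the curvature equation \<open>p\<close> is the derivative of
    \<open>(\<tau> / t) * (T (\<beta> \<tau>) \<bullet> d)\<close>: the first-order change of length
    and the first-order enclosed curvature combine, and only the value at the end survives.\<close>
  also have "((\<lambda>\<tau>. p \<tau> + C) has_integral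
      ((t / t) * (T (\<beta> t) \<bullet> d) + C * t - ((0 / t) * (T (\<beta> 0) \<bullet> d) + C * 0))) {0..t}"
  proof (rule fundamental_theorem_of_calculus)
    fix \<tau> assume \<tau>: "\<tau> \<in> {0..t}"
    have 1: "((\<lambda>\<tau>. T (\<beta> \<tau>) \<bullet> d) has_vector_derivative k (\<beta> \<tau>) * c \<tau>) (at \<tau> within {0..t})"
      using bounded_linear.has_vector_derivative [OF bounded_linear_inner_left char_T_derivative [OF \<beta> \<tau>]]
      by (simp add: c_def)
    have 2: "((\<lambda>\<tau>. \<tau> / t) has_vector_derivative 1 / t) (at \<tau> within {0..t})"
      using t by (auto intro!: derivative_eq_intros)
    have "((\<lambda>\<tau>. (\<tau> / t) * (T (\<beta> \<tau>) \<bullet> d) + C * \<tau>) has_vector_derivative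
        ((\<tau> / t) * (k (\<beta> \<tau>) * c \<tau>) + (1 / t) * (T (\<beta> \<tau>) \<bullet> d)) + C * 1) (at \<tau> within {0..t})"
      by (intro has_vector_derivative_add has_vector_derivative_mult 1 2
          has_vector_derivative_mult_right has_vector_derivative_id)
    then show "((\<lambda>\<tau>. (\<tau> / t) * (T (\<beta> \<tau>) \<bullet> d) + C * \<tau>) has_vector_derivative (p \<tau> + C)) (at \<tau> within {0..t})"
      by (simp add: p_def algebra_simps)
  qed (use t in auto)
  then have "integral {0..t} (\<lambda>\<tau>. p \<tau> + C) = T (\<beta> t) \<bullet> d + C * t"
    using t by (simp add: integral_unique)
  also have "C * t \<le> (1 + M) / t * (norm d)\<^sup>2"
  proof -
    \<comment> \<open>Here \<open>t \<le> 1\<close> lets the curvature error, of order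
      \<open>M * t\<close>, be absorbed in the coefficient \<open>(1 + M) / t\<close>.\<close>
    have "M * t \<le> M * (1 / t)"
      using t M_ge by (intro mult_left_mono) (auto simp: divide_simps mult_le_one)
    then have "(1 / (2 * t) + M * t) * (norm d)\<^sup>2 \<le> ((1 + M) / t) * (norm d)\<^sup>2"
      using t by (intro mult_right_mono) (auto simp: add_divide_distrib intro!: add_mono divide_left_mono)
    moreover have "C * t = (1 / (2 * t) + M * t) * (norm d)\<^sup>2"
      using t by (simp add: C_def field_simps power2_eq_square)
    ultimately show ?thesis by simp
  qed
  finally show ?thesis by simp
qed

section \<open>Reversing and shifting the parameter of a characteristic\<close>

lemma is_char_reverse:
  assumes \<gamma>: "is_char \<gamma> s t"
  shows "unit_field.is_char G (\<lambda>x. - T x) (\<lambda>\<tau>. \<gamma> (c - \<tau>)) (c - t) (c - s)"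
proof -
  interpret neg: unit_field G "\<lambda>x. - T x" "\<lambda>x. - k x" M by (rule unit_field_minus)
  show ?thesis
    unfolding neg.is_char_def
  proof (intro ballI conjI)
    fix \<tau> assume "\<tau> \<in> {c - t..c - s}"
    then have \<tau>: "c - \<tau> \<in> {s..t}" by auto
    show "\<gamma> (c - \<tau>) \<in> G" by (rule is_charD [OF \<gamma> \<tau>])
    have "(\<lambda>\<tau>. c - \<tau>) ` {c - t..c - s} = {s..t}"
      by (auto simp: image_iff intro!: bexI [of _ "c - _"])
    then have 1: "(\<gamma> has_vector_derivative T (\<gamma> (c - \<tau>))) (at (c - \<tau>) within (\<lambda>\<tau>. c - \<tau>) ` {c - t..c - s})"
      using is_charD(2) [OF \<gamma> \<tau>] by simp
    have 2: "((\<lambda>\<tau>. c - \<tau>) has_vector_derivative - 1) (at \<tau> within {c - t..c - s})"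
      by (auto intro!: derivative_eq_intros)
    show "((\<lambda>\<tau>. \<gamma> (c - \<tau>)) has_vector_derivative - T (\<gamma> (c - \<tau>))) (at \<tau> within {c - t..c - s})"
      using vector_diff_chain_within [OF 2 1] by (simp add: o_def)
  qed
qed

lemma is_char_shift:
  assumes "is_char \<gamma> s t"
  shows "is_char (\<lambda>\<tau>. \<gamma> (c + \<tau>)) (s - c) (t - c)"
  unfolding is_char_def
proof (intro ballI conjI)
  fix \<tau> assume "\<tau> \<in> {s - c..t - c}"
  then have \<tau>: "c + \<tau> \<in> {s..t}" by auto
  show "\<gamma> (c + \<tau>) \<in> G" by (rule is_charD [OF assms \<tau>])
  have "(\<lambda>\<tau>. c + \<tau>) ` {s - c..t - c} = {s..t}"
    by (auto simp: image_iff intro!: bexI [of _ "_ - c"])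
  then have 1: "(\<gamma> has_vector_derivative T (\<gamma> (c + \<tau>))) (at (c + \<tau>) within (\<lambda>\<tau>. c + \<tau>) ` {s - c..t - c})"
    using is_charD(2) [OF assms \<tau>] by simp
  have 2: "((\<lambda>\<tau>. c + \<tau>) has_vector_derivative 1) (at \<tau> within {s - c..t - c})"
    by (auto intro!: derivative_eq_intros)
  show "((\<lambda>\<tau>. \<gamma> (c + \<tau>)) has_vector_derivative T (\<gamma> (c + \<tau>))) (at \<tau> within {s - c..t - c})"
    using vector_diff_chain_within [OF 2 1] by (simp add: o_def)
qed

end

section \<open>Stability of characteristics and regularity of the field\<close>

text \<open>Only the size of \<open>a\<close> enters the denominator, so a lower bound for one of
  the two vectors suffices.\<close>

lemma norm_sgn_diff_le:
  fixes a b :: "'a::real_normed_vector"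
  assumes "a \<noteq> 0" "b \<noteq> 0"
  shows "norm (sgn a - sgn b) \<le> 2 * norm (a - b) / norm a"
proof -
  have "norm a *\<^sub>R (sgn a - sgn b) = (a - b) + (norm b - norm a) *\<^sub>R sgn b"
    using assms by (simp add: sgn_div_norm algebra_simps)
  then have "norm a * norm (sgn a - sgn b) = norm ((a - b) + (norm b - norm a) *\<^sub>R sgn b)"
    by (metis norm_scaleR abs_norm_cancel)
  also have "\<dots> \<le> norm (a - b) + \<bar>norm b - norm a\<bar>"
    using norm_triangle_ineq [of "a - b" "(norm b - norm a) *\<^sub>R sgn b"] assms by (simp add: norm_sgn)
  also have "\<dots> \<le> 2 * norm (a - b)"
    using norm_triangle_ineq3 [of a b] by simp
  finally show ?thesis using assms by (simp add: field_simps)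
qed

text \<open>\<open>V\<close> is globally defined and continuous, zeros included; only the rotation
  of its direction is confined to the nonsingular part of the ball.\<close>

locale flow_field =
  fixes V :: "real^2 \<Rightarrow> real^2" and k :: "real^2 \<Rightarrow> real" and M :: real and p\<^sub>0 :: "real^2" and \<rho> :: real
  assumes cont_V: "continuous_on UNIV V"
    and rho: "0 < \<rho>"
    and rot_V: "weak_rot {x \<in> ball p\<^sub>0 \<rho>. V x \<noteq> 0} (\<lambda>x. sgn (V x)) k"
    and M_ge_1: "1 \<le> M"
    and k_le: "\<And>x. \<bar>k x\<bar> \<le> M"
    and k_lipschitz: "\<And>x y. \<bar>k x - k y\<bar> \<le> M * norm (x - y)"
begin

abbreviation G where "G \<equiv> {x \<in> ball p\<^sub>0 \<rho>. V x \<noteq> 0}"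
abbreviation T where "T \<equiv> \<lambda>x. sgn (V x)"

lemma continuous_on_V: "continuous_on S V"
  using cont_V continuous_on_subset by blast

lemma continuous_on_V_comp [continuous_intros]:
  assumes "continuous_on S f" shows "continuous_on S (\<lambda>x. V (f x))"
  using continuous_on_compose [OF assms continuous_on_V] by (simp add: o_def)

lemma open_nonsingular: "open G"
proof -
  have "open {x. V x \<noteq> 0}"
    by (rule open_Collect_neq) (use cont_V in auto)
  moreover have "G = ball p\<^sub>0 \<rho> \<inter> {x. V x \<noteq> 0}" by auto
  ultimately show ?thesis by (metis open_Int open_ball)
qed

sublocale unit_field G T k M
proof
  show "continuous_on G T"
    using continuous_on_V unfolding sgn_div_norm by (intro continuous_intros) auto
qed (use open_nonsingular rot_V M_ge_1 k_le k_lipschitz in \<open>auto simp: norm_sgn\<close>)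

lemma flow_field_minus: "flow_field (\<lambda>x. - V x) (\<lambda>x. - k x) M p\<^sub>0 \<rho>"
proof
  show "weak_rot {x \<in> ball p\<^sub>0 \<rho>. - V x \<noteq> 0} (\<lambda>x. sgn (- V x)) (\<lambda>x. - k x)"
    using weak_rot_minus [OF rot_V] by (simp add: sgn_minus)
  show "\<bar>- k x - - k y\<bar> \<le> M * norm (x - y)" for x y
    using k_lipschitz [of x y] by (simp add: abs_minus_commute)
qed (use cont_V rho M_ge_1 k_le in \<open>auto intro: continuous_intros\<close>)

lemma V_uniformly_continuous:
  assumes "e > 0"
  obtains d where "d > 0" "\<And>x y. x \<in> cball p\<^sub>0 \<rho> \<Longrightarrow> y \<in> cball p\<^sub>0 \<rho> \<Longrightarrow> norm (x - y) \<le> d \<Longrightarrow> norm (V x - V y) < e"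
proof -
  have "uniformly_continuous_on (cball p\<^sub>0 \<rho>) V"
    by (rule compact_uniformly_continuous [OF continuous_on_V]) auto
  then obtain d where d: "d > 0" "\<And>x y. x \<in> cball p\<^sub>0 \<rho> \<Longrightarrow> y \<in> cball p\<^sub>0 \<rho> \<Longrightarrow> dist y x < d \<Longrightarrow> dist (V y) (V x) < e"
    using assms unfolding uniformly_continuous_on_def by metis
  show ?thesis
    by (rule that [of "d / 2"]) (use d in \<open>force simp: dist_norm\<close>)+
qed

text \<open>Since \<open>V\<close> is continuous across its zeros, truncating its length below yields a continuous
  field that can be integrated without leaving its domain.\<close>

lemma truncated_flow:
  assumes "\<delta> > 0"
  shows "\<exists>\<gamma>. \<gamma> 0 = q \<and> continuous_on {0..1} \<gamma> \<and>
    (\<forall>s\<in>{0..1}. \<forall>t\<in>{0..1}. norm (\<gamma> s - \<gamma> t) \<le> \<bar>s - t\<bar>) \<and>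
    (\<forall>t\<in>{0..1}. (\<forall>\<tau>\<in>{0..t}. \<gamma> \<tau> \<in> ball p\<^sub>0 \<rho> \<and> \<delta> \<le> norm (V (\<gamma> \<tau>))) \<longrightarrow> is_char \<gamma> 0 t)"
proof -
  define X where "X = (\<lambda>x. V x /\<^sub>R max \<delta> (norm (V x)))"
  have cX: "continuous_on UNIV X"
    unfolding X_def using assms by (intro continuous_intros cont_V) (auto simp: max_def)
  have nX: "norm (X x) \<le> 1" for x
    using assms by (auto simp: X_def field_simps max_def)
  obtain \<gamma> where \<gamma>: "\<gamma> 0 = q"
    "\<And>\<tau>. \<tau> \<in> {0..1} \<Longrightarrow> (\<gamma> has_vector_derivative X (\<gamma> \<tau>)) (at \<tau> within {0..1})"
    using peano_existence [OF cX nX, of 1 q] by auto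
  show ?thesis
  proof (intro exI conjI ballI impI)
    show "\<gamma> 0 = q" by fact
    show "continuous_on {0..1} \<gamma>"
      by (rule continuous_on_vector_derivative) (rule \<gamma>)
    show "norm (\<gamma> s - \<gamma> t) \<le> \<bar>s - t\<bar>" if "s \<in> {0..1}" "t \<in> {0..1}" for s t
    proof -
      have "norm (\<gamma> s - \<gamma> t) \<le> 1 * norm (s - t)"
      proof (rule differentiable_bound [of "{0..1}" \<gamma> "\<lambda>\<tau> h. h *\<^sub>R X (\<gamma> \<tau>)"])
        show "(\<gamma> has_derivative (\<lambda>h. h *\<^sub>R X (\<gamma> \<tau>))) (at \<tau> within {0..1})" if "\<tau> \<in> {0..1}" for \<tau>
          using \<gamma>(2) [OF that] by (simp add: has_vector_derivative_def)
        show "onorm (\<lambda>h. h *\<^sub>R X (\<gamma> \<tau>)) \<le> 1" for \<tau>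
          using nX [of "\<gamma> \<tau>"] by (intro onorm_le) (simp add: mult_left_le)
      qed (use that in auto)
      then show ?thesis by simp
    qed
    show "is_char \<gamma> 0 t"
      if t: "t \<in> {0..1}" and *: "\<forall>\<tau>\<in>{0..t}. \<gamma> \<tau> \<in> ball p\<^sub>0 \<rho> \<and> \<delta> \<le> norm (V (\<gamma> \<tau>))" for t
      unfolding is_char_def
    proof (intro ballI conjI)
      fix \<tau> assume \<tau>: "\<tau> \<in> {0..t}"
      show "\<gamma> \<tau> \<in> G" using bspec [OF * \<tau>] assms by auto
      have "X (\<gamma> \<tau>) = T (\<gamma> \<tau>)" using bspec [OF * \<tau>] by (simp add: X_def sgn_div_norm max_def)
      then show "(\<gamma> has_vector_derivative T (\<gamma> \<tau>)) (at \<tau> within {0..t})"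
        using has_vector_derivative_within_subset [OF \<gamma>(2), of \<tau> "{0..t}"] \<tau> t by simp
    qed
  qed
qed

text \<open>Quantitative margins: distance \<open>r\<close> to the boundary of the ball and length
  at least \<open>2 * \<delta>\<close> of \<open>V\<close>, so that the neighbourhoods found below
  depend on \<open>\<delta>\<close> and \<open>r\<close> but not on the curve. The factor 2 leaves
  room for nearby curves along which \<open>V\<close> still has length at least
  \<open>\<delta>\<close>.\<close>

definition safe_char :: "real \<Rightarrow> real \<Rightarrow> (real \<Rightarrow> real^2) \<Rightarrow> real \<Rightarrow> bool" where
  "safe_char \<delta> r \<gamma> t \<longleftrightarrow> 0 \<le> t \<and> t \<le> 1 \<and> is_char \<gamma> 0 t \<and>
     (\<forall>\<tau>\<in>{0..t}. \<gamma> \<tau> \<in> cball p\<^sub>0 (\<rho> - r) \<and> 2 * \<delta> \<le> norm (V (\<gamma> \<tau>)))"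

text \<open>A continuation argument. Near the given curve the truncated field is the true one, so a
  truncated solution from \<open>q\<close> is a characteristic until it leaves a thin tube, and the
  Gronwall estimate shows that it cannot reach the boundary of the tube. The initial directions are
  close because \<open>V\<close> is uniformly continuous and bounded away from zero.\<close>

lemma char_stability:
  assumes \<delta>: "\<delta> > 0" and r: "r > 0"
  shows "\<exists>\<eta>>0. \<forall>\<gamma> t q. safe_char \<delta> r \<gamma> t \<and> norm (q - \<gamma> 0) < \<eta> \<longrightarrow>
    (\<exists>\<beta>. is_char \<beta> 0 t \<and> \<beta> 0 = q \<and> (\<forall>\<tau>\<in>{0..t}. norm (\<beta> \<tau> - \<gamma> \<tau>) \<le> r))"
proof -
  obtain d where d: "d > 0" "\<And>x y. x \<in> cball p\<^sub>0 \<rho> \<Longrightarrow> y \<in> cball p\<^sub>0 \<rho> \<Longrightarrow> norm (x - y) \<le> d \<Longrightarrow> norm (V x - V y) < \<delta>"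
    using V_uniformly_continuous [OF \<delta>] by metis
  define r1 where "r1 = min d (r / 2)"
  have r1: "r1 > 0" "r1 \<le> d" "r1 < r" using d r by (auto simp: r1_def)
  \<comment> \<open>With initial errors at most \<open>\<omega>\<close> in position and direction,
    Gronwall gives \<open>2 * \<omega>^2 * exp (1 + M)\<close>, which equals
    \<open>r1^2 * exp (- (1 + M)) / 2\<close> and is less than \<open>r1^2\<close>.\<close>
  define \<omega> where "\<omega> = r1 * exp (- (1 + M)) / 2"
  have \<omega>: "\<omega> > 0" using r1 by (simp add: \<omega>_def)
  have \<omega>r: "\<omega> < r1"
  proof -
    have "exp (- (1 + M)) \<le> 1" using M_ge by simp
    then have "exp (- (1 + M)) / 2 < 1" by linarith
    then have "r1 * (exp (- (1 + M)) / 2) < r1 * 1" using r1 by (intro mult_strict_left_mono) auto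
    then show ?thesis by (simp add: \<omega>_def)
  qed
  obtain d' where d': "d' > 0" "\<And>x y. x \<in> cball p\<^sub>0 \<rho> \<Longrightarrow> y \<in> cball p\<^sub>0 \<rho> \<Longrightarrow> norm (x - y) \<le> d' \<Longrightarrow> norm (V x - V y) < \<delta> * \<omega>"
    using V_uniformly_continuous [of "\<delta> * \<omega>"] \<delta> \<omega> by auto
  show ?thesis
  proof (intro exI [of _ "min \<omega> d'"] conjI allI impI)
    show "min \<omega> d' > 0" using \<omega> d' by simp
    fix \<gamma> t q
    assume "safe_char \<delta> r \<gamma> t \<and> norm (q - \<gamma> 0) < min \<omega> d'"
    then have t: "0 \<le> t" "t \<le> 1" and \<gamma>: "is_char \<gamma> 0 t"
      and *: "\<And>\<tau>. \<tau> \<in> {0..t} \<Longrightarrow> \<gamma> \<tau> \<in> cball p\<^sub>0 (\<rho> - r) \<and> 2 * \<delta> \<le> norm (V (\<gamma> \<tau>))"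
      and q: "norm (q - \<gamma> 0) < min \<omega> d'"
      by (auto simp: safe_char_def)
    have near: "x \<in> ball p\<^sub>0 \<rho>" "\<delta> \<le> norm (V x)" if "norm (x - \<gamma> \<tau>) \<le> r1" "\<tau> \<in> {0..t}" for x \<tau>
    proof -
      have "norm (x - p\<^sub>0) \<le> norm (x - \<gamma> \<tau>) + norm (\<gamma> \<tau> - p\<^sub>0)"
        using norm_triangle_ineq [of "x - \<gamma> \<tau>" "\<gamma> \<tau> - p\<^sub>0"] by simp
      also have "\<dots> < \<rho>" using that(1) * [OF that(2)] r1 by (auto simp: dist_norm norm_minus_commute)
      finally show x: "x \<in> ball p\<^sub>0 \<rho>" by (simp add: dist_norm norm_minus_commute)
      have "norm (V (\<gamma> \<tau>) - V x) < \<delta>"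
        using d(2) [of "\<gamma> \<tau>" x] x that * [OF that(2)] r1 r by (auto simp: norm_minus_commute)
      then show "\<delta> \<le> norm (V x)"
        using * [OF that(2)] norm_triangle_ineq2 [of "V (\<gamma> \<tau>)" "V x"] by linarith
    qed
    have T0: "norm (T q - T (\<gamma> 0)) < \<omega>"
    proof -
      have q1: "q \<in> ball p\<^sub>0 \<rho>" "\<delta> \<le> norm (V q)"
        using near [of q 0] q \<omega>r t by auto
      have g0: "2 * \<delta> \<le> norm (V (\<gamma> 0))" "\<gamma> 0 \<in> cball p\<^sub>0 \<rho>" using * [of 0] t r by auto
      have nz: "V (\<gamma> 0) \<noteq> 0" "V q \<noteq> 0" using g0 q1 \<delta> by auto
      have "norm (V (\<gamma> 0) - V q) < \<delta> * \<omega>"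
        using d'(2) [of "\<gamma> 0" q] g0 q1 q by (auto simp: norm_minus_commute)
      then have "2 * norm (V (\<gamma> 0) - V q) / norm (V (\<gamma> 0)) < 2 * (\<delta> * \<omega>) / norm (V (\<gamma> 0))"
        using nz by (intro divide_strict_right_mono) auto
      also have "\<dots> \<le> 2 * (\<delta> * \<omega>) / (2 * \<delta>)"
        using g0 nz \<delta> \<omega> by (intro divide_left_mono mult_pos_pos) auto
      also have "\<dots> = \<omega>" using \<delta> by simp
      finally show ?thesis
        using norm_sgn_diff_le [OF nz] by (simp add: norm_minus_commute)
    qed
    obtain \<beta> where \<beta>: "\<beta> 0 = q" "continuous_on {0..1} \<beta>"
      "\<forall>t\<in>{0..1}. (\<forall>\<tau>\<in>{0..t}. \<beta> \<tau> \<in> ball p\<^sub>0 \<rho> \<and> \<delta> \<le> norm (V (\<beta> \<tau>))) \<longrightarrow> is_char \<beta> 0 t"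
      using truncated_flow [OF \<delta>, of q] by blast
    have char_\<beta>: "is_char \<beta> 0 u" if "u \<in> {0..t}" "\<And>\<tau>. \<tau> \<in> {0..u} \<Longrightarrow> norm (\<beta> \<tau> - \<gamma> \<tau>) \<le> r1" for u
    proof (rule \<beta>(3) [rule_format])
      show "u \<in> {0..1}" using that t by auto
      show "\<beta> \<tau> \<in> ball p\<^sub>0 \<rho> \<and> \<delta> \<le> norm (V (\<beta> \<tau>))" if "\<tau> \<in> {0..u}" for \<tau>
        using near [of "\<beta> \<tau>" \<tau>] that \<open>u \<in> {0..t}\<close> \<open>\<And>\<tau>. \<tau> \<in> {0..u} \<Longrightarrow> norm (\<beta> \<tau> - \<gamma> \<tau>) \<le> r1\<close> by auto
    qed
    have close: "norm (\<beta> \<tau> - \<gamma> \<tau>) < r1" if \<tau>: "\<tau> \<in> {0..t}" for \<tau>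
    proof (rule ccontr)
      assume neg: "\<not> ?thesis"
      let ?f = "\<lambda>\<tau>. norm (\<beta> \<tau> - \<gamma> \<tau>)"
      have cf: "continuous_on {0..t} ?f"
        by (intro continuous_intros is_char_continuous [OF \<gamma>] continuous_on_subset [OF \<beta>(2)]) (use t in auto)
      have "?f 0 < r1" using q \<beta>(1) \<omega>r by simp
      moreover have "?f \<tau> \<ge> r1" using neg by simp
      ultimately obtain u where u: "u \<in> {0..t}" "0 < u" "?f u = r1" "\<And>s. s \<in> {0..<u} \<Longrightarrow> ?f s < r1"
        using first_exit [OF cf _ \<tau>] by blast
      have le: "?f s \<le> r1" if "s \<in> {0..u}" for s
        using u(3) u(4) [of s] that by (cases "s = u") auto
      have \<beta>u: "is_char \<beta> 0 u"
        by (rule char_\<beta>) (use u le in auto)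
      have "(?f u)\<^sup>2 + (norm (T (\<beta> u) - T (\<gamma> u)))\<^sup>2 \<le>
          ((?f 0)\<^sup>2 + (norm (T (\<beta> 0) - T (\<gamma> 0)))\<^sup>2) * exp ((1 + M) * \<bar>u - 0\<bar>)"
        by (rule char_gronwall [OF \<beta>u is_char_subset [OF \<gamma>]]) (use u in auto)
      also have "\<dots> \<le> (\<omega>\<^sup>2 + \<omega>\<^sup>2) * exp (1 + M)"
      proof (intro mult_mono add_mono power_mono)
        show "?f 0 \<le> \<omega>" using q \<beta>(1) by simp
        show "norm (T (\<beta> 0) - T (\<gamma> 0)) \<le> \<omega>" using T0 \<beta>(1) by simp
        show "exp ((1 + M) * \<bar>u - 0\<bar>) \<le> exp (1 + M)"
          using u t M_ge mult_left_le [of u "1 + M"] by (simp add: mult.commute)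
      qed auto
      also have "\<dots> = r1\<^sup>2 * (exp (- (1 + M)) / 2)"
      proof -
        have "exp (- (1 + M)) * exp (1 + M) = 1" by (simp only: exp_add [symmetric]) simp
        moreover have "(\<omega>\<^sup>2 + \<omega>\<^sup>2) * exp (1 + M) =
            r1\<^sup>2 * (exp (- (1 + M)) / 2) * (exp (- (1 + M)) * exp (1 + M))"
          unfolding \<omega>_def power2_eq_square by (simp only: field_simps) simp
        ultimately show ?thesis by simp
      qed
      also have "\<dots> < r1\<^sup>2 * 1"
      proof (rule mult_strict_left_mono)
        have "exp (- (1 + M)) \<le> 1" using M_ge by simp
        then show "exp (- (1 + M)) / 2 < 1" by linarith
      qed (use r1 in simp)
      finally have "r1\<^sup>2 + (norm (T (\<beta> u) - T (\<gamma> u)))\<^sup>2 < r1\<^sup>2" using u(3) by simp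
      then show False using zero_le_power2 [of "norm (T (\<beta> u) - T (\<gamma> u))"] by linarith
    qed
    have "is_char \<beta> 0 t"
      by (rule char_\<beta>) (use t close in \<open>auto intro: less_imp_le\<close>)
    moreover have "\<forall>\<tau>\<in>{0..t}. norm (\<beta> \<tau> - \<gamma> \<tau>) \<le> r"
    proof
      show "norm (\<beta> \<tau> - \<gamma> \<tau>) \<le> r" if "\<tau> \<in> {0..t}" for \<tau>
        using close [OF that] r1 by simp
    qed
    ultimately show "\<exists>\<beta>. is_char \<beta> 0 t \<and> \<beta> 0 = q \<and> (\<forall>\<tau>\<in>{0..t}. norm (\<beta> \<tau> - \<gamma> \<tau>) \<le> r)"
      using \<beta>(1) by blast
  qed
qed

section \<open>Time reversal and uniform tubes around characteristics\<close>

lemma reverse_char: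
  "is_char \<gamma> 0 t \<Longrightarrow> unit_field.is_char {x \<in> ball p\<^sub>0 \<rho>. - V x \<noteq> 0} (\<lambda>x. sgn (- V x)) (\<lambda>\<tau>. \<gamma> (t - \<tau>)) 0 t"
  using is_char_reverse [of \<gamma> 0 t t] by (simp add: sgn_minus)

lemma safe_char_reverse:
  assumes "safe_char \<delta> r \<gamma> t"
  shows "flow_field.safe_char (\<lambda>x. - V x) p\<^sub>0 \<rho> \<delta> r (\<lambda>\<tau>. \<gamma> (t - \<tau>)) t"
proof -
  interpret neg: flow_field "\<lambda>x. - V x" "\<lambda>x. - k x" M p\<^sub>0 \<rho> by (rule flow_field_minus)
  show ?thesis
    using assms reverse_char [of \<gamma> t] unfolding safe_char_def neg.safe_char_def by auto
qed

text \<open>Forward stability for the field \<open>- V\<close> and the reversed curve, reversed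
  back; here it is the end point that is prescribed.\<close>

lemma char_back_stability:
  assumes \<delta>: "\<delta> > 0" and r: "r > 0"
  shows "\<exists>\<eta>>0. \<forall>\<gamma> t q. safe_char \<delta> r \<gamma> t \<and> norm (q - \<gamma> t) < \<eta> \<longrightarrow>
    (\<exists>\<beta>. is_char \<beta> 0 t \<and> \<beta> t = q \<and> (\<forall>\<tau>\<in>{0..t}. norm (\<beta> \<tau> - \<gamma> \<tau>) \<le> r))"
proof -
  interpret neg: flow_field "\<lambda>x. - V x" "\<lambda>x. - k x" M p\<^sub>0 \<rho> by (rule flow_field_minus)
  obtain \<eta> where \<eta>: "\<eta> > 0"
    "\<forall>\<gamma> t q. neg.safe_char \<delta> r \<gamma> t \<and> norm (q - \<gamma> 0) < \<eta> \<longrightarrow>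
       (\<exists>\<beta>. neg.is_char \<beta> 0 t \<and> \<beta> 0 = q \<and> (\<forall>\<tau>\<in>{0..t}. norm (\<beta> \<tau> - \<gamma> \<tau>) \<le> r))"
    using neg.char_stability [OF \<delta> r] by blast
  show ?thesis
  proof (intro exI [of _ \<eta>] conjI allI impI \<eta>(1))
    fix \<gamma> t q
    assume *: "safe_char \<delta> r \<gamma> t \<and> norm (q - \<gamma> t) < \<eta>"
    then obtain \<beta> where \<beta>: "neg.is_char \<beta> 0 t" "\<beta> 0 = q" "\<forall>\<tau>\<in>{0..t}. norm (\<beta> \<tau> - \<gamma> (t - \<tau>)) \<le> r"
      using \<eta>(2) [rule_format, of "\<lambda>\<tau>. \<gamma> (t - \<tau>)" t q] safe_char_reverse [of \<delta> r \<gamma> t] by auto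
    show "\<exists>\<beta>. is_char \<beta> 0 t \<and> \<beta> t = q \<and> (\<forall>\<tau>\<in>{0..t}. norm (\<beta> \<tau> - \<gamma> \<tau>) \<le> r)"
    proof (intro exI conjI ballI)
      show "is_char (\<lambda>\<tau>. \<beta> (t - \<tau>)) 0 t"
        using neg.reverse_char [OF \<beta>(1)] by simp
      show "norm (\<beta> (t - \<tau>) - \<gamma> \<tau>) \<le> r" if "\<tau> \<in> {0..t}" for \<tau>
        using \<beta>(3) [rule_format, of "t - \<tau>"] that by simp
    qed (use \<beta> in simp)
  qed
qed

lemma tube:
  assumes \<delta>: "\<delta> > 0" and r: "r > 0"
  shows "\<exists>d>0. d \<le> r \<and>
    (\<forall>x y. y \<in> cball p\<^sub>0 (\<rho> - r) \<and> 2 * \<delta> \<le> norm (V y) \<and> norm (x - y) \<le> d \<longrightarrow> x \<in> G)"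
proof -
  obtain d where d: "d > 0" "\<And>x y. x \<in> cball p\<^sub>0 \<rho> \<Longrightarrow> y \<in> cball p\<^sub>0 \<rho> \<Longrightarrow> norm (x - y) \<le> d \<Longrightarrow> norm (V x - V y) < \<delta>"
    using V_uniformly_continuous [OF \<delta>] by metis
  show ?thesis
  proof (intro exI [of _ "min d (r / 2)"] conjI allI impI)
    fix x y
    assume "y \<in> cball p\<^sub>0 (\<rho> - r) \<and> 2 * \<delta> \<le> norm (V y) \<and> norm (x - y) \<le> min d (r / 2)"
    then have y: "y \<in> cball p\<^sub>0 (\<rho> - r)" "2 * \<delta> \<le> norm (V y)" and xy: "norm (x - y) \<le> min d (r / 2)" by auto
    have "norm (x - p\<^sub>0) \<le> norm (x - y) + norm (y - p\<^sub>0)"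
      using norm_triangle_ineq [of "x - y" "y - p\<^sub>0"] by simp
    also have "\<dots> < \<rho>" using xy y r by (auto simp: dist_norm norm_minus_commute)
    finally have x: "x \<in> ball p\<^sub>0 \<rho>" by (simp add: dist_norm norm_minus_commute)
    have "norm (V y - V x) < \<delta>"
      using d(2) [of y x] x y xy r by (auto simp: norm_minus_commute)
    then have "V x \<noteq> 0" using y(2) \<delta> by auto
    then show "x \<in> G" using x by simp
  qed (use d r in auto)
qed

text \<open>Every \<open>x\<close> near the end is itself the end of a characteristic of the same
  duration \<open>t\<close>, by backward stability, so the comparison of \<open>char_seg_le\<close>
  can be made from \<open>x\<close>. Half of \<open>d0\<close> goes to that nearby characteristic
  and half to the shift \<open>d\<close>.\<close>

lemma seg_upper:
  assumes \<delta>: "\<delta> > 0" and r: "r > 0"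
  shows "\<exists>\<eta>>0. \<forall>\<gamma> t x d. 0 < t \<and> safe_char \<delta> r \<gamma> t \<and> norm (x - \<gamma> t) < \<eta> \<and> norm d < \<eta> \<longrightarrow>
    seg T x (x + d) \<le> T x \<bullet> d + (1 + M) / t * (norm d)\<^sup>2"
proof -
  obtain d0 where d0: "d0 > 0" "d0 \<le> r"
    "\<And>x y. y \<in> cball p\<^sub>0 (\<rho> - r) \<Longrightarrow> 2 * \<delta> \<le> norm (V y) \<Longrightarrow> norm (x - y) \<le> d0 \<Longrightarrow> x \<in> G"
    using tube [OF \<delta> r] by blast
  obtain \<eta> where \<eta>: "\<eta> > 0"
    "\<forall>\<gamma> t q. safe_char \<delta> (d0 / 2) \<gamma> t \<and> norm (q - \<gamma> t) < \<eta> \<longrightarrow>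
       (\<exists>\<beta>. is_char \<beta> 0 t \<and> \<beta> t = q \<and> (\<forall>\<tau>\<in>{0..t}. norm (\<beta> \<tau> - \<gamma> \<tau>) \<le> d0 / 2))"
    using char_back_stability [OF \<delta> half_gt_zero [OF d0(1)]] by blast
  show ?thesis
  proof (intro exI [of _ "min \<eta> (d0 / 2)"] conjI allI impI)
    fix \<gamma> t x and d :: "real^2"
    assume "0 < t \<and> safe_char \<delta> r \<gamma> t \<and> norm (x - \<gamma> t) < min \<eta> (d0 / 2) \<and> norm d < min \<eta> (d0 / 2)"
    then have t: "0 < t" "t \<le> 1" and \<gamma>: "safe_char \<delta> r \<gamma> t"
      and *: "\<And>\<tau>. \<tau> \<in> {0..t} \<Longrightarrow> \<gamma> \<tau> \<in> cball p\<^sub>0 (\<rho> - r) \<and> 2 * \<delta> \<le> norm (V (\<gamma> \<tau>))"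
      and x: "norm (x - \<gamma> t) < min \<eta> (d0 / 2)" and d: "norm d < min \<eta> (d0 / 2)"
      by (auto simp: safe_char_def)
    have "safe_char \<delta> (d0 / 2) \<gamma> t"
      using \<gamma> d0 unfolding safe_char_def by fastforce
    then obtain \<beta> where \<beta>: "is_char \<beta> 0 t" "\<beta> t = x" "\<And>\<tau>. \<tau> \<in> {0..t} \<Longrightarrow> norm (\<beta> \<tau> - \<gamma> \<tau>) \<le> d0 / 2"
      using \<eta>(2) [rule_format, of \<gamma> t x] x by auto
    have "seg T (\<beta> t) (\<beta> t + d) \<le> T (\<beta> t) \<bullet> d + (1 + M) / t * (norm d)\<^sup>2"
    proof (rule char_seg_le [OF \<beta>(1) t])
      fix \<tau> s :: real assume \<tau>: "\<tau> \<in> {0..t}" and s: "s \<in> {0..1}"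
      have "norm (s *\<^sub>R d) \<le> norm d"
        using s by (simp add: mult_left_le_one_le)
      moreover have eq: "\<beta> \<tau> + s *\<^sub>R d - \<gamma> \<tau> = (\<beta> \<tau> - \<gamma> \<tau>) + s *\<^sub>R d" by simp
      ultimately have "norm (\<beta> \<tau> + s *\<^sub>R d - \<gamma> \<tau>) \<le> d0"
        unfolding eq using \<beta>(3) [OF \<tau>] d by (intro norm_triangle_le) simp
      then show "\<beta> \<tau> + s *\<^sub>R d \<in> G"
        by (intro d0(3) [of "\<gamma> \<tau>"]) (use * [OF \<tau>] in auto)
    qed
    then show "seg T x (x + d) \<le> T x \<bullet> d + (1 + M) / t * (norm d)\<^sup>2" using \<beta>(2) by simp
  qed (use \<eta> d0 in auto)
qed

text \<open>Reversal turns the past into the future: the lower bound needs a characteristic of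
  duration \<open>t\<close> leaving the point, where the upper bound needs one arriving.\<close>

lemma seg_lower:
  assumes \<delta>: "\<delta> > 0" and r: "r > 0"
  shows "\<exists>\<eta>>0. \<forall>\<gamma> t x d. 0 < t \<and> safe_char \<delta> r \<gamma> t \<and> norm (x - \<gamma> 0) < \<eta> \<and> norm d < \<eta> \<longrightarrow>
    T x \<bullet> d - (1 + M) / t * (norm d)\<^sup>2 \<le> seg T x (x + d)"
proof -
  interpret neg: flow_field "\<lambda>x. - V x" "\<lambda>x. - k x" M p\<^sub>0 \<rho> by (rule flow_field_minus)
  obtain \<eta> where \<eta>: "\<eta> > 0"
    "\<forall>\<gamma> t x d. 0 < t \<and> neg.safe_char \<delta> r \<gamma> t \<and> norm (x - \<gamma> t) < \<eta> \<and> norm d < \<eta> \<longrightarrow>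
       seg neg.T x (x + d) \<le> neg.T x \<bullet> d + (1 + M) / t * (norm d)\<^sup>2"
    using neg.seg_upper [OF \<delta> r] by blast
  show ?thesis
  proof (intro exI [of _ \<eta>] conjI allI impI \<eta>(1))
    fix \<gamma> t x and d :: "real^2"
    assume *: "0 < t \<and> safe_char \<delta> r \<gamma> t \<and> norm (x - \<gamma> 0) < \<eta> \<and> norm d < \<eta>"
    have "seg neg.T x (x + d) \<le> neg.T x \<bullet> d + (1 + M) / t * (norm d)\<^sup>2"
      using \<eta>(2) [rule_format, of t "\<lambda>\<tau>. \<gamma> (t - \<tau>)" x d] safe_char_reverse [of \<delta> r \<gamma> t] * by simp
    then show "T x \<bullet> d - (1 + M) / t * (norm d)\<^sup>2 \<le> seg T x (x + d)"
      by (simp add: sgn_minus seg_minus)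
  qed
qed

text \<open>Add the upper bounds for the circulations from the end point to \<open>x\<close> and
  back; the circulations cancel. Only the past of the curve enters, hence the inequality is
  one-sided. It is the bound on the rate at which neighbouring characteristics diverge.\<close>

lemma T_one_sided_lipschitz:
  assumes \<delta>: "\<delta> > 0" and r: "r > 0"
  shows "\<exists>\<eta>>0. \<forall>\<gamma> t x. 0 < t \<and> safe_char \<delta> r \<gamma> t \<and> norm (x - \<gamma> t) < \<eta> \<longrightarrow>
    (T x - T (\<gamma> t)) \<bullet> (x - \<gamma> t) \<le> 2 * ((1 + M) / t * (norm (x - \<gamma> t))\<^sup>2)"
proof -
  obtain \<eta> where \<eta>: "\<eta> > 0"
    "\<forall>\<gamma> t x d. 0 < t \<and> safe_char \<delta> r \<gamma> t \<and> norm (x - \<gamma> t) < \<eta> \<and> norm d < \<eta> \<longrightarrow>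
       seg T x (x + d) \<le> T x \<bullet> d + (1 + M) / t * (norm d)\<^sup>2"
    using seg_upper [OF \<delta> r] by blast
  show ?thesis
  proof (intro exI [of _ \<eta>] conjI allI impI \<eta>(1))
    fix \<gamma> t x
    assume *: "0 < t \<and> safe_char \<delta> r \<gamma> t \<and> norm (x - \<gamma> t) < \<eta>"
    define q where "q = \<gamma> t"
    define Q where "Q = (1 + M) / t * (norm (x - q))\<^sup>2"
    have "seg T q (q + (x - q)) \<le> T q \<bullet> (x - q) + Q"
      unfolding Q_def by (rule \<eta>(2) [rule_format, of _ \<gamma>]) (use * \<eta>(1) in \<open>auto simp: q_def\<close>)
    then have 1: "seg T q x \<le> T q \<bullet> (x - q) + Q" by simp
    have "seg T x (x + (q - x)) \<le> T x \<bullet> (q - x) + Q"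
      unfolding Q_def norm_minus_commute [of x]
      by (rule \<eta>(2) [rule_format, of _ \<gamma>]) (use * in \<open>auto simp: q_def norm_minus_commute\<close>)
    then have 2: "- seg T q x \<le> - (T x \<bullet> (x - q)) + Q"
      by (simp add: seg_commute [of T x] inner_diff_right)
    show "(T x - T (\<gamma> t)) \<bullet> (x - \<gamma> t) \<le> 2 * ((1 + M) / t * (norm (x - \<gamma> t))\<^sup>2)"
      using 1 2 unfolding inner_diff_left q_def [symmetric] Q_def [symmetric] by linarith
  qed
qed

section \<open>Two-sided Lipschitz estimate at interior points of characteristics\<close>

lemma char_margin:
  assumes \<gamma>: "is_char \<gamma> s t" and st: "s \<le> t"
  obtains \<delta> r where "\<delta> > 0" "r > 0"
    "\<And>\<tau>. \<tau> \<in> {s..t} \<Longrightarrow> \<gamma> \<tau> \<in> cball p\<^sub>0 (\<rho> - r) \<and> 2 * \<delta> \<le> norm (V (\<gamma> \<tau>))"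
proof -
  note c\<gamma> = is_char_continuous(1) [OF \<gamma>]
  have ne: "{s..t} \<noteq> {}" using st by simp
  have "continuous_on {s..t} (\<lambda>\<tau>. norm (V (\<gamma> \<tau>)))" by (intro continuous_intros c\<gamma>)
  from continuous_attains_inf [OF compact_Icc ne this] obtain a where
    a: "a \<in> {s..t}" "\<And>\<tau>. \<tau> \<in> {s..t} \<Longrightarrow> norm (V (\<gamma> a)) \<le> norm (V (\<gamma> \<tau>))" by blast
  have "continuous_on {s..t} (\<lambda>\<tau>. dist p\<^sub>0 (\<gamma> \<tau>))" by (intro continuous_intros c\<gamma>)
  from continuous_attains_sup [OF compact_Icc ne this] obtain b where
    b: "b \<in> {s..t}" "\<And>\<tau>. \<tau> \<in> {s..t} \<Longrightarrow> dist p\<^sub>0 (\<gamma> \<tau>) \<le> dist p\<^sub>0 (\<gamma> b)" by blast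
  show ?thesis
    by (rule that [of "norm (V (\<gamma> a)) / 2" "\<rho> - dist p\<^sub>0 (\<gamma> b)"])
      (use a b is_charD(1) [OF \<gamma> a(1)] is_charD(1) [OF \<gamma> b(1)] in auto)
qed

text \<open>Stokes on the triangle \<open>q\<close>, \<open>x\<close>, \<open>x + d\<close>, seen as
  the strip between the constant curve \<open>q\<close> and the segment from \<open>x\<close> to
  \<open>x + d\<close>; the right side generously bounds \<open>M\<close> times its area.\<close>

lemma seg_triangle:
  assumes G: "\<And>r \<tau>. r \<in> {0..1} \<Longrightarrow> \<tau> \<in> {0..1} \<Longrightarrow> q + r *\<^sub>R (x + \<tau> *\<^sub>R d - q) \<in> G"
  shows "\<bar>seg T q (x + d) - seg T q x - seg T x (x + d)\<bar> \<le> M * norm d * (norm (x - q) + norm d)"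
proof -
  have "seg T q (x + 1 *\<^sub>R d) - seg T q (x + 0 *\<^sub>R d) =
    integral {0..1} (\<lambda>\<tau>. T (x + \<tau> *\<^sub>R d) \<bullet> d - T q \<bullet> 0) +
    integral {0..1} (\<lambda>\<tau>. integral {0..1} (\<lambda>r. k (q + r *\<^sub>R (x + \<tau> *\<^sub>R d - q)) *
        (rot90 (0 + r *\<^sub>R (d - 0)) \<bullet> (x + \<tau> *\<^sub>R d - q))))"
    by (rule strip_stokes_weak [OF rot_T cont_T cont_k])
      (use G in \<open>auto intro!: derivative_eq_intros\<close>)
  then have eq: "seg T q (x + d) - seg T q x - seg T x (x + d) =
    integral {0..1} (\<lambda>\<tau>. integral {0..1} (\<lambda>r. k (q + r *\<^sub>R (x + \<tau> *\<^sub>R d - q)) *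
        (rot90 (r *\<^sub>R d) \<bullet> (x + \<tau> *\<^sub>R d - q))))" (is "_ = integral _ (\<lambda>\<tau>. integral _ (?h \<tau>))")
    by (simp add: seg_def)
  let ?C = "M * norm d * (norm (x - q) + norm d)"
  have ch: "continuous_on ({0..1} \<times> {0..1}) (\<lambda>p. ?h (fst p) (snd p))"
    by (intro continuous_intros)
  have h: "norm (?h \<tau> r) \<le> ?C" if "\<tau> \<in> {0..1}" "r \<in> {0..1}" for \<tau> r
  proof -
    have 1: "norm (r *\<^sub>R d) \<le> norm d" "norm (\<tau> *\<^sub>R d) \<le> norm d"
      using that by (simp_all add: mult_left_le_one_le)
    have "norm (x + \<tau> *\<^sub>R d - q) \<le> norm (x - q) + norm d"
      using norm_triangle_ineq [of "x - q" "\<tau> *\<^sub>R d"] 1 by (simp add: algebra_simps)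
    then have "norm (r *\<^sub>R d) * norm (x + \<tau> *\<^sub>R d - q) \<le> norm d * (norm (x - q) + norm d)"
      using 1 by (intro mult_mono) auto
    then have "\<bar>rot90 (r *\<^sub>R d) \<bullet> (x + \<tau> *\<^sub>R d - q)\<bar> \<le> norm d * (norm (x - q) + norm d)"
      using rot90_inner_le order_trans by blast
    then have "\<bar>k (q + r *\<^sub>R (x + \<tau> *\<^sub>R d - q))\<bar> * \<bar>rot90 (r *\<^sub>R d) \<bullet> (x + \<tau> *\<^sub>R d - q)\<bar>
        \<le> M * (norm d * (norm (x - q) + norm d))"
      using k_bound M_ge by (intro mult_mono) auto
    then show ?thesis by (simp add: abs_mult mult.assoc)
  qed
  have "norm (integral {0..1} (\<lambda>\<tau>. integral {0..1} (?h \<tau>))) \<le> ?C * (1 - 0)"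
  proof (rule integral_bound)
    show "continuous_on {0..1} (\<lambda>\<tau>. integral {0..1} (?h \<tau>))"
      by (rule continuous_on_param_integral [OF ch])
    fix \<tau> :: real assume \<tau>: "\<tau> \<in> {0..1}"
    have "norm (integral {0..1} (?h \<tau>)) \<le> ?C * (1 - 0)"
      by (rule integral_bound) (use continuous_on_slice [OF ch \<tau>] h [OF \<tau>] in auto)
    then show "norm (integral {0..1} (?h \<tau>)) \<le> ?C" by simp
  qed simp
  then show ?thesis unfolding eq by simp
qed

text \<open>Near a point with both a past and a future, the circulation from \<open>x\<close> to
  \<open>x + d\<close> is pinned from both sides to \<open>T x \<bullet> d\<close> up to a quadratic
  error. Going from \<open>q\<close> to \<open>x + d\<close> directly or through \<open>x\<close>
  then compares \<open>T q \<bullet> d\<close> with \<open>T x \<bullet> d\<close>.\<close>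

lemma T_locally_lipschitz:
  assumes \<gamma>: "is_char \<gamma> 0 t2" and t: "0 < t" "t < t2" "t2 \<le> 1"
  obtains \<eta> B where "\<eta> > 0" "B \<ge> 0" "\<And>x. norm (x - \<gamma> t) < \<eta> \<Longrightarrow> norm (T x - T (\<gamma> t)) \<le> B * norm (x - \<gamma> t)"
proof -
  obtain \<delta> r where \<delta>r: "\<delta> > 0" "r > 0"
    "\<And>\<tau>. \<tau> \<in> {0..t2} \<Longrightarrow> \<gamma> \<tau> \<in> cball p\<^sub>0 (\<rho> - r) \<and> 2 * \<delta> \<le> norm (V (\<gamma> \<tau>))"
    using char_margin [OF \<gamma>] t by auto
  have \<gamma>1: "is_char \<gamma> 0 t" by (rule is_char_subset [OF \<gamma>]) (use t in auto)
  have "is_char \<gamma> t t2" by (rule is_char_subset [OF \<gamma>]) (use t in auto)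
  from is_char_shift [OF this, of t] have \<gamma>2: "is_char (\<lambda>\<tau>. \<gamma> (t + \<tau>)) 0 (t2 - t)" by simp
  have safe: "safe_char \<delta> r \<gamma> t" "safe_char \<delta> r (\<lambda>\<tau>. \<gamma> (t + \<tau>)) (t2 - t)"
    using \<gamma>1 \<gamma>2 t \<delta>r(3) by (auto simp: safe_char_def)
  obtain \<eta>1 where \<eta>1: "\<eta>1 > 0"
    "\<forall>x d. norm (x - \<gamma> t) < \<eta>1 \<and> norm d < \<eta>1 \<longrightarrow> seg T x (x + d) \<le> T x \<bullet> d + (1 + M) / t * (norm d)\<^sup>2"
    using seg_upper [OF \<delta>r(1,2)] safe(1) t(1) by blast
  obtain \<eta>2 where \<eta>2: "\<eta>2 > 0"
    "\<forall>x d. norm (x - \<gamma> (t + 0)) < \<eta>2 \<and> norm d < \<eta>2 \<longrightarrow>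
      T x \<bullet> d - (1 + M) / (t2 - t) * (norm d)\<^sup>2 \<le> seg T x (x + d)"
  proof -
    obtain \<eta> where \<eta>: "\<eta> > 0" "\<forall>\<gamma> t x d. 0 < t \<and> safe_char \<delta> r \<gamma> t \<and> norm (x - \<gamma> 0) < \<eta> \<and> norm d < \<eta> \<longrightarrow>
        T x \<bullet> d - (1 + M) / t * (norm d)\<^sup>2 \<le> seg T x (x + d)"
      using seg_lower [OF \<delta>r(1,2)] by blast
    show thesis
      by (rule that [OF \<eta>(1)]) (use \<eta>(2) [rule_format, OF conjI, OF _ conjI, OF _ safe(2)] t(2) in simp)
  qed
  have "\<gamma> t \<in> G" using is_charD(1) [OF \<gamma>1] t by simp
  then obtain \<eta>3 where \<eta>3: "\<eta>3 > 0" "cball (\<gamma> t) \<eta>3 \<subseteq> G"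
    using open_G open_contains_cball by meson
  define \<eta> where "\<eta> = min (min \<eta>1 \<eta>2) \<eta>3 / 2"
  have \<eta>: "\<eta> > 0" "2 * \<eta> \<le> \<eta>1" "2 * \<eta> \<le> \<eta>2" "2 * \<eta> \<le> \<eta>3"
    using \<eta>1 \<eta>2 \<eta>3 by (auto simp: \<eta>_def)
  define C where "C = max ((1 + M) / t) ((1 + M) / (t2 - t))"
  have C: "(1 + M) / t \<le> C" "(1 + M) / (t2 - t) \<le> C" "C \<ge> 0"
    using t M_ge by (auto simp: C_def le_max_iff_disj)
  define q where "q = \<gamma> t"
  have both: "\<bar>seg T x (x + d) - T x \<bullet> d\<bar> \<le> C * (norm d)\<^sup>2" if "norm (x - q) < 2 * \<eta>" "norm d < 2 * \<eta>" for x d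
    using \<eta>1(2) [rule_format, of x d] \<eta>2(2) [rule_format, of x d] that \<eta> mult_right_mono [OF C(1), of "(norm d)\<^sup>2"]
      mult_right_mono [OF C(2), of "(norm d)\<^sup>2"] by (simp add: q_def abs_le_iff)
  show ?thesis
  \<comment> \<open>With displacements of size \<open>n\<close>: \<open>4 * C\<close> from the side
    \<open>q\<close> to \<open>x + d\<close>, of length up to \<open>2 * n\<close>, \<open>C\<close>
    from each of the other two sides, and \<open>2 * M\<close> from the curvature in the
    triangle.\<close>
  proof (rule that [of \<eta> "6 * C + 2 * M"])
    fix x assume "norm (x - \<gamma> t) < \<eta>"
    then have x: "norm (x - q) < \<eta>" by (simp add: q_def)
    define n where "n = norm (x - q)"
    \<comment> \<open>The test direction is the difference of the field values itself, scaled to the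
      length of \<open>x - q\<close>, so that the inner product returns the norm of
      \<open>T q - T x\<close>.\<close>
    define d where "d = n *\<^sub>R sgn (T q - T x)"
    show "norm (T x - T (\<gamma> t)) \<le> (6 * C + 2 * M) * norm (x - \<gamma> t)"
    proof (cases "x = q \<or> T q = T x")
      case True
      then show ?thesis using C M_ge by (auto simp: q_def intro!: mult_nonneg_nonneg)
    next
      case False
      then have n: "n > 0" and dn: "norm d = n" by (auto simp: d_def n_def norm_sgn)
      have nd: "norm (x - q + d) \<le> 2 * n"
        using norm_triangle_ineq [of "x - q" d] dn by (simp add: n_def)
      have n\<eta>: "n < \<eta>" using x by (simp add: n_def)
      have 1: "\<bar>seg T q (x + d) - T q \<bullet> (x - q + d)\<bar> \<le> C * (2 * n)\<^sup>2"
      proof -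
        have "\<bar>seg T q (q + (x - q + d)) - T q \<bullet> (x - q + d)\<bar> \<le> C * (norm (x - q + d))\<^sup>2"
          by (rule both) (use nd n\<eta> \<eta> in auto)
        also have "\<dots> \<le> C * (2 * n)\<^sup>2"
          using nd C by (intro mult_left_mono power_mono) auto
        finally show ?thesis by (simp add: algebra_simps)
      qed
      have 2: "\<bar>seg T q x - T q \<bullet> (x - q)\<bar> \<le> C * n\<^sup>2"
        using both [of q "x - q"] n\<eta> \<eta> by (simp add: n_def)
      have 3: "\<bar>seg T x (x + d) - T x \<bullet> d\<bar> \<le> C * n\<^sup>2"
        using both [of x d] n\<eta> \<eta> dn by (simp add: n_def)
      have 4: "\<bar>seg T q (x + d) - seg T q x - seg T x (x + d)\<bar> \<le> M * n * (n + n)"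
      proof -
        have "\<bar>seg T q (x + d) - seg T q x - seg T x (x + d)\<bar> \<le> M * norm d * (norm (x - q) + norm d)"
        proof (rule seg_triangle)
          fix r \<tau> :: real assume "r \<in> {0..1}" "\<tau> \<in> {0..1}"
          have "norm (x - q + \<tau> *\<^sub>R d) \<le> n + n"
          proof (rule norm_triangle_le)
            have "norm (\<tau> *\<^sub>R d) \<le> n"
              using \<open>\<tau> \<in> {0..1}\<close> dn n by (simp add: mult_left_le_one_le)
            then show "norm (x - q) + norm (\<tau> *\<^sub>R d) \<le> n + n" by (simp add: n_def)
          qed
          then have "r * norm (x - q + \<tau> *\<^sub>R d) \<le> 1 * (n + n)"
            using \<open>r \<in> {0..1}\<close> by (intro mult_mono) auto
          also have "1 * (n + n) \<le> \<eta>3" using n\<eta> \<eta>(4) by simp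
          finally have "norm (r *\<^sub>R (x - q + \<tau> *\<^sub>R d)) \<le> \<eta>3"
            using \<open>r \<in> {0..1}\<close> by simp
          moreover have "x + \<tau> *\<^sub>R d - q = x - q + \<tau> *\<^sub>R d" by simp
          ultimately have "norm (r *\<^sub>R (x + \<tau> *\<^sub>R d - q)) \<le> \<eta>3" by metis
          then have "q + r *\<^sub>R (x + \<tau> *\<^sub>R d - q) \<in> cball (\<gamma> t) \<eta>3"
            by (simp add: dist_norm q_def)
          then show "q + r *\<^sub>R (x + \<tau> *\<^sub>R d - q) \<in> G" using \<eta>3 by blast
        qed
        then show ?thesis using dn by (simp add: n_def)
      qed
      have "T q \<bullet> (x - q + d) = T q \<bullet> (x - q) + T q \<bullet> d" by (rule inner_add_right)
      moreover have "C * (2 * n)\<^sup>2 = 4 * (C * n\<^sup>2)" "M * n * (n + n) = 2 * (M * n\<^sup>2)"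
        by (simp_all add: power2_eq_square algebra_simps)
      ultimately have "\<bar>T q \<bullet> d - T x \<bullet> d\<bar> \<le> 6 * (C * n\<^sup>2) + 2 * (M * n\<^sup>2)"
        using 1 2 3 4 by linarith
      moreover have "(T q - T x) \<bullet> d = n * norm (T q - T x)"
        using False by (simp add: d_def sgn_div_norm dot_square_norm power2_eq_square)
      ultimately have "n * norm (T q - T x) \<le> n * ((6 * C + 2 * M) * n)"
        unfolding inner_diff_left by (simp add: power2_eq_square algebra_simps)
      then have "norm (T q - T x) \<le> (6 * C + 2 * M) * n" using n by simp
      then show ?thesis by (simp add: n_def q_def norm_minus_commute)
    qed
  qed (use \<eta> C M_ge in auto)
qed

end

section \<open>Growth along characteristics and negligibility of the zeros\<close>

text \<open>Disjoint subsets of \<open>B\<close> with measure above \<open>1 / (m + 1)\<close> are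
  finite in number, since their total measure is at most that of \<open>B\<close>; the
  non-negligible members form a countable union of such classes.\<close>

lemma countable_positive_measure_disjoint:
  fixes S :: "'i \<Rightarrow> 'a::euclidean_space set"
  assumes disj: "disjoint_family_on S I" and sets: "\<And>i. i \<in> I \<Longrightarrow> S i \<in> lmeasurable"
    and B: "B \<in> lmeasurable" "\<And>i. i \<in> I \<Longrightarrow> S i \<subseteq> B"
  shows "countable {i \<in> I. \<not> negligible (S i)}"
proof -
  define A where "A = (\<lambda>m::nat. {i \<in> I. measure lebesgue (S i) > 1 / real (Suc m)})"
  have fin: "finite (A m)" for m
  proof (rule ccontr)
    assume "infinite (A m)"
    define N where "N = nat \<lceil>measure lebesgue B * real (Suc m)\<rceil>"
    obtain J where J: "J \<subseteq> A m" "finite J" "card J = N"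
      using infinite_arbitrarily_large [OF \<open>infinite (A m)\<close>] by metis
    obtain i where "i \<in> A m - J" using \<open>infinite (A m)\<close> J by (metis Diff_eq_empty_iff ex_in_conv finite_subset)
    then have J': "insert i J \<subseteq> A m" "finite (insert i J)" "card (insert i J) = Suc N" using J by auto
    have sub: "insert i J \<subseteq> I" using J' by (auto simp: A_def)
    have "real (card (insert i J)) * (1 / real (Suc m)) \<le> (\<Sum>j\<in>insert i J. measure lebesgue (S j))"
      by (rule sum_bounded_below) (use J' in \<open>auto simp: A_def\<close>)
    also have "\<dots> = measure lebesgue (\<Union>j\<in>insert i J. S j)"
    proof (rule measure_UNION' [symmetric])
      show "pairwise (\<lambda>i j. disjnt (S i) (S j)) (insert i J)"
        using sub disj unfolding pairwise_def disjnt_def disjoint_family_on_def by blast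
    qed (use J' sub sets in blast)+
    also have "\<dots> \<le> measure lebesgue B"
    proof (rule measure_mono_fmeasurable)
      show "(\<Union>j\<in>insert i J. S j) \<in> sets lebesgue"
        by (rule fmeasurableD, rule fmeasurable.finite_UN) (use J'(2) sub sets in auto)
    qed (use sub B in auto)
    finally have "real (Suc N) \<le> measure lebesgue B * real (Suc m)"
      unfolding J'(3) by (simp add: field_simps)
    moreover have "measure lebesgue B * real (Suc m) \<le> real N" by (simp add: N_def real_nat_ceiling_ge)
    ultimately show False by simp
  qed
  have "{i \<in> I. \<not> negligible (S i)} \<subseteq> (\<Union>m. A m)"
  proof
    fix i assume i: "i \<in> {i \<in> I. \<not> negligible (S i)}"
    then have "measure lebesgue (S i) > 0"
      using sets [of i] by (simp add: negligible_iff_measure zero_less_measure_iff)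
    then obtain m where "1 / real (Suc m) < measure lebesgue (S i)"
      using nat_approx_posE by (metis inverse_eq_divide)
    then show "i \<in> (\<Union>m. A m)" using i by (auto simp: A_def)
  qed
  then show ?thesis
    using fin by (meson countable_UN countable_finite countable_subset countableI_type)
qed

text \<open>\<open>u_deriv\<close> says that the gradient of \<open>u\<close> is
  \<open>rot90 (V x) - F x\<close>. Thus the rotated \<open>V\<close> differs from a
  \<open>C^1\<close> field by an exact one, and the lower bound on the curl of \<open>F\<close> acts
  as one on the divergence of \<open>V\<close>.\<close>

locale curl_flow = flow_field +
  fixes u :: "real^2 \<Rightarrow> real" and F :: "real^2 \<Rightarrow> real^2" and F' :: "real^2 \<Rightarrow> real^2 \<Rightarrow> real^2" and c\<^sub>0 :: real
  assumes u_deriv: "\<And>x. x \<in> ball p\<^sub>0 \<rho> \<Longrightarrow> (u has_derivative (\<lambda>v. (rot90 (V x) - F x) \<bullet> v)) (at x)"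
    and F_deriv: "\<And>x. x \<in> ball p\<^sub>0 \<rho> \<Longrightarrow> (F has_derivative F' x) (at x)"
    and F'_cont: "\<And>v. continuous_on (ball p\<^sub>0 \<rho>) (\<lambda>x. F' x v)"
    and c0_pos: "0 < c\<^sub>0"
    and curl_ge: "\<And>x. x \<in> ball p\<^sub>0 \<rho> \<Longrightarrow> c\<^sub>0 \<le> rot_of (F' x)"
begin

section \<open>Stokes' theorem for the rotated field\<close>

abbreviation W where "W \<equiv> \<lambda>x. rot90 (V x)"

lemma F_cont: "continuous_on (ball p\<^sub>0 \<rho>) F"
  using F_deriv by (meson continuous_at_imp_continuous_on has_derivative_continuous)

lemma F_cont_comp:
  assumes "continuous_on S f" "\<And>x. x \<in> S \<Longrightarrow> f x \<in> ball p\<^sub>0 \<rho>"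
  shows "continuous_on S (\<lambda>x. F (f x))"
proof -
  have "f ` S \<subseteq> ball p\<^sub>0 \<rho>" using assms(2) by auto
  then show ?thesis
    using continuous_on_compose [OF assms(1) continuous_on_subset [OF F_cont]] by (simp add: o_def)
qed

lemma u_along_curve:
  assumes "s \<le> t" "\<And>\<tau>. \<tau> \<in> {s..t} \<Longrightarrow> (b has_vector_derivative b' \<tau>) (at \<tau> within {s..t})"
    "\<And>\<tau>. \<tau> \<in> {s..t} \<Longrightarrow> b \<tau> \<in> ball p\<^sub>0 \<rho>"
  shows "((\<lambda>\<tau>. W (b \<tau>) \<bullet> b' \<tau> - F (b \<tau>) \<bullet> b' \<tau>) has_integral u (b t) - u (b s)) {s..t}"
proof (rule fundamental_theorem_of_calculus [OF assms(1)])
  fix \<tau> assume \<tau>: "\<tau> \<in> {s..t}"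
  have "((u \<circ> b) has_vector_derivative (rot90 (V (b \<tau>)) - F (b \<tau>)) \<bullet> b' \<tau>) (at \<tau> within {s..t})"
    by (rule vector_derivative_diff_chain_within [OF assms(2) [OF \<tau>]])
      (rule has_derivative_at_withinI [OF u_deriv [OF assms(3) [OF \<tau>]]])
  then show "((\<lambda>\<tau>. u (b \<tau>)) has_vector_derivative W (b \<tau>) \<bullet> b' \<tau> - F (b \<tau>) \<bullet> b' \<tau>) (at \<tau> within {s..t})"
    by (simp add: o_def inner_diff_left)
qed

lemma seg_W:
  assumes "closed_segment p q \<subseteq> ball p\<^sub>0 \<rho>"
  shows "seg W p q = u q - u p + seg F p q"
proof -
  have in_ball: "p + r *\<^sub>R (q - p) \<in> ball p\<^sub>0 \<rho>" if "r \<in> {0..1}" for r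
    using segment_point [OF that] assms by blast
  have der: "((\<lambda>r. p + r *\<^sub>R (q - p)) has_vector_derivative q - p) (at r within {0..1})" for r
    by (auto intro!: derivative_eq_intros)
  have 1: "((\<lambda>r. W (p + r *\<^sub>R (q - p)) \<bullet> (q - p) - F (p + r *\<^sub>R (q - p)) \<bullet> (q - p)) has_integral
      u (p + 1 *\<^sub>R (q - p)) - u (p + 0 *\<^sub>R (q - p))) {0..1}"
    by (rule u_along_curve [OF zero_le_one der in_ball])
  have 2: "((\<lambda>r. F (p + r *\<^sub>R (q - p)) \<bullet> (q - p)) has_integral seg F p q) {0..1}"
    unfolding seg_def
    by (intro integrable_integral integrable_continuous_interval continuous_intros F_cont_comp in_ball)
  have "((\<lambda>r. W (p + r *\<^sub>R (q - p)) \<bullet> (q - p)) has_integral u q - u p + seg F p q) {0..1}"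
    using has_integral_add [OF 1 2] by simp
  then show ?thesis by (simp add: seg_def integral_unique)
qed

text \<open>The exact part contributes the values of \<open>u\<close> at the four corners, which
  cancel around the boundary of the strip; what remains is Stokes for the \<open>C^1\<close> field
  \<open>F\<close>.\<close>

lemma strip_stokes_W:
  fixes a b a' b' :: "real \<Rightarrow> real^2"
  assumes st: "s \<le> t"
    and a: "\<And>\<tau>. \<tau> \<in> {s..t} \<Longrightarrow> (a has_vector_derivative a' \<tau>) (at \<tau> within {s..t})"
    and b: "\<And>\<tau>. \<tau> \<in> {s..t} \<Longrightarrow> (b has_vector_derivative b' \<tau>) (at \<tau> within {s..t})"
    and a': "continuous_on {s..t} a'"
    and b': "continuous_on {s..t} b'"
    and G: "\<And>\<tau> r. \<tau> \<in> {s..t} \<Longrightarrow> r \<in> {0..1} \<Longrightarrow> a \<tau> + r *\<^sub>R (b \<tau> - a \<tau>) \<in> ball p\<^sub>0 \<rho>"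
  shows "seg W (a t) (b t) - seg W (a s) (b s) =
    integral {s..t} (\<lambda>\<tau>. W (b \<tau>) \<bullet> b' \<tau> - W (a \<tau>) \<bullet> a' \<tau>) +
    integral {s..t} (\<lambda>\<tau>. integral {0..1} (\<lambda>r. rot_of (F' (a \<tau> + r *\<^sub>R (b \<tau> - a \<tau>))) *
        (rot90 (a' \<tau> + r *\<^sub>R (b' \<tau> - a' \<tau>)) \<bullet> (b \<tau> - a \<tau>))))"
proof -
  have ab: "a \<tau> \<in> ball p\<^sub>0 \<rho>" "b \<tau> \<in> ball p\<^sub>0 \<rho>" if "\<tau> \<in> {s..t}" for \<tau>
    using G [OF that, of 0] G [OF that, of 1] by auto
  have ca: "continuous_on {s..t} a" and cb: "continuous_on {s..t} b"
    by (rule continuous_on_vector_derivative, rule a, assumption)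
      (rule continuous_on_vector_derivative, rule b, assumption)
  have segs: "seg W (a \<tau>) (b \<tau>) = u (b \<tau>) - u (a \<tau>) + seg F (a \<tau>) (b \<tau>)" if "\<tau> \<in> {s..t}" for \<tau>
    by (rule seg_W) (use closed_segment_subset [OF ab [OF that] convex_ball] in auto)
  have F: "seg F (a t) (b t) - seg F (a s) (b s) =
    integral {s..t} (\<lambda>\<tau>. F (b \<tau>) \<bullet> b' \<tau> - F (a \<tau>) \<bullet> a' \<tau>) +
    integral {s..t} (\<lambda>\<tau>. integral {0..1} (\<lambda>r. rot_of (F' (a \<tau> + r *\<^sub>R (b \<tau> - a \<tau>))) *
        (rot90 (a' \<tau> + r *\<^sub>R (b' \<tau> - a' \<tau>)) \<bullet> (b \<tau> - a \<tau>))))"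
    by (rule strip_stokes [OF st a b a' b' F_deriv F'_cont G])
  have "((\<lambda>\<tau>. (W (b \<tau>) \<bullet> b' \<tau> - F (b \<tau>) \<bullet> b' \<tau>) - (W (a \<tau>) \<bullet> a' \<tau> - F (a \<tau>) \<bullet> a' \<tau>)) has_integral
      (u (b t) - u (b s)) - (u (a t) - u (a s))) {s..t}"
    by (intro has_integral_diff u_along_curve st a b ab)
  moreover have "((\<lambda>\<tau>. F (b \<tau>) \<bullet> b' \<tau> - F (a \<tau>) \<bullet> a' \<tau>) has_integral
      integral {s..t} (\<lambda>\<tau>. F (b \<tau>) \<bullet> b' \<tau> - F (a \<tau>) \<bullet> a' \<tau>)) {s..t}"
    by (intro integrable_integral integrable_continuous_interval continuous_intros F_cont_comp ab ca cb a' b')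
  ultimately have "((\<lambda>\<tau>. ((W (b \<tau>) \<bullet> b' \<tau> - F (b \<tau>) \<bullet> b' \<tau>) - (W (a \<tau>) \<bullet> a' \<tau> - F (a \<tau>) \<bullet> a' \<tau>)) +
        (F (b \<tau>) \<bullet> b' \<tau> - F (a \<tau>) \<bullet> a' \<tau>)) has_integral
      ((u (b t) - u (b s)) - (u (a t) - u (a s))) + integral {s..t} (\<lambda>\<tau>. F (b \<tau>) \<bullet> b' \<tau> - F (a \<tau>) \<bullet> a' \<tau>)) {s..t}"
    by (rule has_integral_add)
  moreover have "((W (b \<tau>) \<bullet> b' \<tau> - F (b \<tau>) \<bullet> b' \<tau>) - (W (a \<tau>) \<bullet> a' \<tau> - F (a \<tau>) \<bullet> a' \<tau>)) +
        (F (b \<tau>) \<bullet> b' \<tau> - F (a \<tau>) \<bullet> a' \<tau>) = W (b \<tau>) \<bullet> b' \<tau> - W (a \<tau>) \<bullet> a' \<tau>" for \<tau> by simp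
  ultimately have I: "integral {s..t} (\<lambda>\<tau>. W (b \<tau>) \<bullet> b' \<tau> - W (a \<tau>) \<bullet> a' \<tau>) =
      ((u (b t) - u (b s)) - (u (a t) - u (a s))) + integral {s..t} (\<lambda>\<tau>. F (b \<tau>) \<bullet> b' \<tau> - F (a \<tau>) \<bullet> a' \<tau>)"
    by (simp only: integral_unique)
  show ?thesis using st F I segs [of s] segs [of t] by simp
qed

lemma rot_F'_cont: "continuous_on (ball p\<^sub>0 \<rho>) (\<lambda>x. rot_of (F' x))"
  unfolding rot_of_def by (intro continuous_intros F'_cont)

text \<open>The exponential is the ratio of the strip widths at times \<open>t / 2\<close> and
  \<open>t\<close> in \<open>norm_V_growth\<close>; one factor 1/2 bounds the Jacobian of the strip
  from below, the other is the length of \<open>{t / 2..t}\<close> relative to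
  \<open>t\<close>.\<close>

definition \<kappa> :: real where "\<kappa> = c\<^sub>0 * exp (- (8 * (1 + M))) / 4"

lemma kappa_pos: "\<kappa> > 0"
  using c0_pos by (simp add: \<kappa>_def)

text \<open>The strip between \<open>\<gamma>\<close> and \<open>\<gamma> + \<epsilon> exp (\<lambda> (\<tau> - t)) n\<close>, with \<open>n\<close> the normal, widens
  faster than the characteristics of \<open>T\<close> can diverge, so \<open>V\<close> flows into it through the side.
  As the divergence of \<open>V\<close> is at least \<open>c\<^sub>0\<close>, the flux through the end of the strip is at
  least proportional to its area.\<close>

lemma norm_V_growth:
  assumes \<gamma>: "is_char \<gamma> 0 t" and t: "0 < t" "t \<le> 1"
  shows "\<kappa> * t \<le> norm (V (\<gamma> t))"
proof (rule field_le_epsilon)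
  fix \<theta>2 :: real assume "\<theta>2 > 0"
  define \<theta> where "\<theta> = \<theta>2 / 2"
  have \<theta>: "\<theta> > 0" using \<open>\<theta>2 > 0\<close> by (simp add: \<theta>_def)
  obtain \<delta> r0 where \<delta>: "\<delta> > 0" and r0: "r0 > 0"
    and marg: "\<And>\<tau>. \<tau> \<in> {0..t} \<Longrightarrow> \<gamma> \<tau> \<in> cball p\<^sub>0 (\<rho> - r0) \<and> 2 * \<delta> \<le> norm (V (\<gamma> \<tau>))"
    using char_margin [OF \<gamma>] t by auto
  obtain d0 where d0: "d0 > 0" "d0 \<le> r0"
    "\<And>x y. y \<in> cball p\<^sub>0 (\<rho> - r0) \<Longrightarrow> 2 * \<delta> \<le> norm (V y) \<Longrightarrow> norm (x - y) \<le> d0 \<Longrightarrow> x \<in> G"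
    using tube [OF \<delta> r0] by blast
  obtain \<eta> where \<eta>: "\<eta> > 0"
    "\<forall>\<gamma> t x. 0 < t \<and> safe_char \<delta> r0 \<gamma> t \<and> norm (x - \<gamma> t) < \<eta> \<longrightarrow>
      (T x - T (\<gamma> t)) \<bullet> (x - \<gamma> t) \<le> 2 * ((1 + M) / t * (norm (x - \<gamma> t))\<^sup>2)"
    using T_one_sided_lipschitz [OF \<delta> r0] by blast
  \<comment> \<open>The bound \<open>\<theta>\<close> evaluates the fluxes through the ends of the
    strip; the bound \<open>\<delta> / 2\<close> keeps the direction \<open>T\<close> on the outer
    side within 1/2 of the direction on \<open>\<gamma>\<close>.\<close>
  obtain d1 where d1: "d1 > 0" "\<And>x y. x \<in> cball p\<^sub>0 \<rho> \<Longrightarrow> y \<in> cball p\<^sub>0 \<rho> \<Longrightarrow> norm (x - y) \<le> d1 \<Longrightarrow>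
      norm (V x - V y) < min \<theta> (\<delta> / 2)"
    using V_uniformly_continuous [of "min \<theta> (\<delta> / 2)"] \<theta> \<delta> by auto
  \<comment> \<open>The width at the end of the strip: inside the tube, within reach of the
    one-sided estimate, and so small against the curvature that
    \<open>1 - s \<tau> * k (\<gamma> \<tau>)\<close> lies between 1/2 and 3/2.\<close>
  define \<epsilon> where "\<epsilon> = min (min d0 d1) (min \<eta> (1 / M)) / 2"
  have \<epsilon>: "\<epsilon> > 0" "\<epsilon> \<le> d0" "\<epsilon> \<le> d1" "\<epsilon> < \<eta>" "\<epsilon> * M \<le> 1 / 2"
  proof -
    show "\<epsilon> > 0" using d0 d1 \<eta> M_ge by (simp add: \<epsilon>_def)
    show "\<epsilon> \<le> d0" "\<epsilon> \<le> d1" "\<epsilon> < \<eta>" using d0 d1 \<eta> M_ge by (auto simp: \<epsilon>_def min_def)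
    have "\<epsilon> \<le> 1 / M / 2" by (simp add: \<epsilon>_def)
    then show "\<epsilon> * M \<le> 1 / 2" using M_ge by (simp add: field_simps)
  qed
  \<comment> \<open>On \<open>{t / 2..t}\<close> the normal component of \<open>T\<close> is at most
    \<open>4 * (1 + M) / t\<close>, that is \<open>lam / 4\<close>, times the width. Of the
    remaining factor 4, one factor 2 covers the tangential speed, which is at most 2, and the other
    the cosine \<open>T (b \<tau>) \<bullet> T (\<gamma> \<tau>)\<close>, which is at least
    1/2.\<close>
  define lam where "lam = 16 * (1 + M) / t"
  define s where "s = (\<lambda>\<tau>. \<epsilon> * exp (lam * (\<tau> - t)))"
  define n where "n = (\<lambda>\<tau>. rot90 (T (\<gamma> \<tau>)))"
  define b where "b = (\<lambda>\<tau>. \<gamma> \<tau> + s \<tau> *\<^sub>R n \<tau>)"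
  \<comment> \<open>By the curvature equation the normal turns with velocity
    \<open>- k (\<gamma> \<tau>)\<close> times the tangent, so moving out along it changes the
    tangential speed to \<open>1 - s \<tau> * k (\<gamma> \<tau>)\<close>; the second term is the
    widening.\<close>
  define b' where "b' = (\<lambda>\<tau>. (1 - s \<tau> * k (\<gamma> \<tau>)) *\<^sub>R T (\<gamma> \<tau>) + (lam * s \<tau>) *\<^sub>R n \<tau>)"
  have lam: "lam > 0" using t M_ge by (simp add: lam_def)
  have sub: "{t / 2..t} \<subseteq> {0..t}" using t by auto
  note c\<gamma> = is_char_continuous [OF \<gamma>]
  have s_pos: "s \<tau> > 0" for \<tau> using \<epsilon> by (simp add: s_def)
  have s_le: "s \<tau> \<le> \<epsilon>" if "\<tau> \<le> t" for \<tau>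
    using \<epsilon> lam that by (simp add: s_def mult_left_le mult_nonneg_nonpos)
  have s_ge: "\<epsilon> * exp (- (8 * (1 + M))) \<le> s \<tau>" if "t / 2 \<le> \<tau>" for \<tau>
  proof -
    have "lam * (t / 2) = 8 * (1 + M)" using t by (simp add: lam_def)
    moreover have "lam * (- (t / 2)) \<le> lam * (\<tau> - t)" using lam that by (intro mult_left_mono) auto
    ultimately have "- (8 * (1 + M)) \<le> lam * (\<tau> - t)" by (simp only: mult_minus_right)
    then show ?thesis using \<epsilon> unfolding s_def by (intro mult_left_mono) auto
  qed
  have unit: "norm (T (\<gamma> \<tau>)) = 1" "T (\<gamma> \<tau>) \<bullet> T (\<gamma> \<tau>) = 1" "norm (n \<tau>) = 1" "n \<tau> \<bullet> n \<tau> = 1" if "\<tau> \<in> {0..t}" for \<tau>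
    using unit_T is_charD(1) [OF \<gamma> that] by (auto simp: n_def dot_square_norm)
  have sk: "\<bar>s \<tau> * k (\<gamma> \<tau>)\<bar> \<le> 1 / 2" if "\<tau> \<in> {0..t}" for \<tau>
  proof -
    have "\<bar>s \<tau> * k (\<gamma> \<tau>)\<bar> \<le> \<epsilon> * M"
      using s_le [of \<tau>] s_pos [of \<tau>] k_bound [of "\<gamma> \<tau>"] that unfolding abs_mult by (intro mult_mono) auto
    then show ?thesis using \<epsilon> by simp
  qed
  have x_near: "norm (\<gamma> \<tau> + (r * s \<tau>) *\<^sub>R n \<tau> - \<gamma> \<tau>) \<le> \<epsilon>" if "\<tau> \<in> {0..t}" "r \<in> {0..1}" for \<tau> r
  proof -
    have "norm ((r * s \<tau>) *\<^sub>R n \<tau>) = r * s \<tau>" using that s_pos [of \<tau>] unit [of \<tau>] by simp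
    also have "\<dots> \<le> 1 * \<epsilon>" using that s_le [of \<tau>] s_pos [of \<tau>] by (intro mult_mono) auto
    finally show ?thesis by simp
  qed
  have x_G: "\<gamma> \<tau> + (r * s \<tau>) *\<^sub>R n \<tau> \<in> G" if "\<tau> \<in> {0..t}" "r \<in> {0..1}" for \<tau> r
    using d0(3) [of "\<gamma> \<tau>"] marg [OF that(1)] x_near [OF that] \<epsilon>(2) order_trans by blast
  have x_V: "norm (V (\<gamma> \<tau> + (r * s \<tau>) *\<^sub>R n \<tau>) - V (\<gamma> \<tau>)) < min \<theta> (\<delta> / 2)" if "\<tau> \<in> {0..t}" "r \<in> {0..1}" for \<tau> r
    using x_G [OF that] marg [OF that(1)] x_near [OF that] \<epsilon>(3) r0 by (intro d1(2)) auto
  have b_der: "(b has_vector_derivative b' \<tau>) (at \<tau> within {t / 2..t})" if \<tau>: "\<tau> \<in> {t / 2..t}" for \<tau>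
  proof -
    have \<tau>0: "\<tau> \<in> {0..t}" using \<tau> sub by blast
    have 1: "(\<gamma> has_vector_derivative T (\<gamma> \<tau>)) (at \<tau> within {t / 2..t})"
      by (rule has_vector_derivative_within_subset [OF is_charD(2) [OF \<gamma> \<tau>0] sub])
    have "((\<lambda>\<tau>. T (\<gamma> \<tau>)) has_vector_derivative k (\<gamma> \<tau>) *\<^sub>R n \<tau>) (at \<tau> within {t / 2..t})"
      unfolding n_def by (rule has_vector_derivative_within_subset [OF char_T_derivative [OF \<gamma> \<tau>0] sub])
    from bounded_linear.has_vector_derivative [OF bounded_linear_rot90 this]
    have 2: "(n has_vector_derivative - (k (\<gamma> \<tau>) *\<^sub>R T (\<gamma> \<tau>))) (at \<tau> within {t / 2..t})"
      by (simp add: n_def rot90_simps)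
    have 3: "(s has_field_derivative lam * s \<tau>) (at \<tau> within {t / 2..t})"
      unfolding s_def by (auto intro!: derivative_eq_intros)
    have "(b has_vector_derivative T (\<gamma> \<tau>) + (s \<tau> *\<^sub>R (- (k (\<gamma> \<tau>) *\<^sub>R T (\<gamma> \<tau>))) + (lam * s \<tau>) *\<^sub>R n \<tau>)) (at \<tau> within {t / 2..t})"
      unfolding b_def by (intro has_vector_derivative_add has_vector_derivative_scaleR 1 2 3)
    then show ?thesis by (simp add: b'_def algebra_simps)
  qed
  have VT: "V x = norm (V x) *\<^sub>R T x" for x by (cases "V x = 0") (simp_all add: sgn_div_norm)
  have cs: "continuous_on {t / 2..t} s" unfolding s_def by (intro continuous_intros)
  have cT: "continuous_on {t / 2..t} (\<lambda>\<tau>. T (\<gamma> \<tau>))" by (rule continuous_on_subset [OF c\<gamma>(2) sub])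
  have cg: "continuous_on {t / 2..t} \<gamma>" by (rule continuous_on_subset [OF c\<gamma>(1) sub])
  have cn: "continuous_on {t / 2..t} n" unfolding n_def by (intro continuous_intros cT)
  have cb: "continuous_on {t / 2..t} b" unfolding b_def by (intro continuous_intros cs cg cn)
  have cb': "continuous_on {t / 2..t} b'" unfolding b'_def by (intro continuous_intros cs cg cT cn)
  have pt: "\<gamma> \<tau> + r *\<^sub>R (b \<tau> - \<gamma> \<tau>) = \<gamma> \<tau> + (r * s \<tau>) *\<^sub>R n \<tau>" for \<tau> r
    by (simp add: b_def)
  have strip: "seg W (\<gamma> t) (b t) - seg W (\<gamma> (t / 2)) (b (t / 2)) =
    integral {t / 2..t} (\<lambda>\<tau>. W (b \<tau>) \<bullet> b' \<tau> - W (\<gamma> \<tau>) \<bullet> T (\<gamma> \<tau>)) +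
    integral {t / 2..t} (\<lambda>\<tau>. integral {0..1} (\<lambda>r. rot_of (F' (\<gamma> \<tau> + r *\<^sub>R (b \<tau> - \<gamma> \<tau>))) *
        (rot90 (T (\<gamma> \<tau>) + r *\<^sub>R (b' \<tau> - T (\<gamma> \<tau>))) \<bullet> (b \<tau> - \<gamma> \<tau>))))"
  proof (rule strip_stokes_W [OF _ _ b_der cT cb'])
    show "(\<gamma> has_vector_derivative T (\<gamma> \<tau>)) (at \<tau> within {t / 2..t})" if "\<tau> \<in> {t / 2..t}" for \<tau>
      using has_vector_derivative_within_subset [OF is_charD(2) [OF \<gamma>] sub] that sub by auto
    show "\<gamma> \<tau> + r *\<^sub>R (b \<tau> - \<gamma> \<tau>) \<in> ball p\<^sub>0 \<rho>" if "\<tau> \<in> {t / 2..t}" "r \<in> {0..1}" for \<tau> r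
      using x_G [of \<tau> r] that sub unfolding pt by auto
  qed (use t in auto)
  \<comment> \<open>The widening \<open>lam * s \<tau>\<close> beats the normal component of
    \<open>T\<close>, at most \<open>(lam / 4) * s \<tau>\<close>, so the flow crosses the outer
    side inwards. The inner side carries no flux, being tangent to \<open>V\<close>.\<close>
  have side: "0 \<le> W (b \<tau>) \<bullet> b' \<tau> - W (\<gamma> \<tau>) \<bullet> T (\<gamma> \<tau>)" if \<tau>: "\<tau> \<in> {t / 2..t}" for \<tau>
  proof -
    have \<tau>0: "\<tau> \<in> {0..t}" and \<tau>pos: "0 < \<tau>" using \<tau> sub t by auto
    let ?x = "b \<tau>"
    have bx: "?x - \<gamma> \<tau> = s \<tau> *\<^sub>R n \<tau>" by (simp add: b_def)
    have Wg: "W (\<gamma> \<tau>) \<bullet> T (\<gamma> \<tau>) = 0"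
      using arg_cong [OF VT [of "\<gamma> \<tau>"], of rot90] by (metis inner_scaleR_left mult_zero_right rot90_inner_self(1) rot90_simps(3))
    have safe: "safe_char \<delta> r0 \<gamma> \<tau>"
      using is_char_subset [OF \<gamma>, of 0 \<tau>] \<tau>0 t marg by (auto simp: safe_char_def)
    have "norm (?x - \<gamma> \<tau>) < \<eta>" using x_near [OF \<tau>0, of 1] \<epsilon>(4) by (simp add: b_def)
    then have "(T ?x - T (\<gamma> \<tau>)) \<bullet> (?x - \<gamma> \<tau>) \<le> 2 * ((1 + M) / \<tau> * (norm (?x - \<gamma> \<tau>))\<^sup>2)"
      using \<eta>(2) safe \<tau>pos by blast
    moreover have "norm (?x - \<gamma> \<tau>) = s \<tau>" unfolding bx using unit(3) [OF \<tau>0] s_pos [of \<tau>] by simp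
    moreover have "(T ?x - T (\<gamma> \<tau>)) \<bullet> (?x - \<gamma> \<tau>) = s \<tau> * (T ?x \<bullet> n \<tau>)"
      unfolding bx by (simp add: inner_diff_left n_def)
    moreover have "2 * ((1 + M) / \<tau> * (s \<tau>)\<^sup>2) = s \<tau> * (2 * ((1 + M) / \<tau> * s \<tau>))"
      by (simp add: power2_eq_square)
    ultimately have "s \<tau> * (T ?x \<bullet> n \<tau>) \<le> s \<tau> * (2 * ((1 + M) / \<tau> * s \<tau>))" by (simp only:)
    then have "T ?x \<bullet> n \<tau> \<le> 2 * ((1 + M) / \<tau> * s \<tau>)" by (simp only: mult_le_cancel_left_pos [OF s_pos])
    also have "\<dots> \<le> 2 * ((1 + M) / (t / 2) * s \<tau>)"
      using \<tau> t M_ge s_pos [of \<tau>] by (intro mult_left_mono mult_right_mono divide_left_mono) auto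
    also have "\<dots> = (lam / 4) * s \<tau>" using t by (simp add: lam_def field_simps)
    finally have Tn: "T ?x \<bullet> n \<tau> \<le> (lam / 4) * s \<tau>" .
    have "norm (T (\<gamma> \<tau>) - T ?x) \<le> 2 * norm (V (\<gamma> \<tau>) - V ?x) / norm (V (\<gamma> \<tau>))"
      by (rule norm_sgn_diff_le) (use x_G [OF \<tau>0, of 1] is_charD(1) [OF \<gamma> \<tau>0] in \<open>auto simp: b_def\<close>)
    also have "\<dots> \<le> 2 * (\<delta> / 2) / (2 * \<delta>)"
      using x_V [OF \<tau>0, of 1] marg [OF \<tau>0] \<delta> by (intro frac_le) (auto simp: b_def norm_minus_commute)
    also have "\<dots> = 1 / 2" using \<delta> by simp
    finally have "norm (T (\<gamma> \<tau>) - T ?x) \<le> 1 / 2" .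
    then have "(T (\<gamma> \<tau>) - T ?x) \<bullet> T (\<gamma> \<tau>) \<le> 1 / 2"
      using norm_cauchy_schwarz [of "T (\<gamma> \<tau>) - T ?x" "T (\<gamma> \<tau>)"] unit(1) [OF \<tau>0] by simp
    then have TT: "1 / 2 \<le> T ?x \<bullet> T (\<gamma> \<tau>)" using unit(2) [OF \<tau>0] by (simp add: inner_diff_left)
    let ?a = "1 - s \<tau> * k (\<gamma> \<tau>)"
    have a: "0 \<le> ?a" "?a \<le> 2" using sk [OF \<tau>0] by (auto simp: abs_le_iff)
    have "?a * (T ?x \<bullet> n \<tau>) \<le> ?a * ((lam / 4) * s \<tau>)" by (rule mult_left_mono [OF Tn a(1)])
    also have "\<dots> \<le> 2 * ((lam / 4) * s \<tau>)" using a lam s_pos [of \<tau>] by (intro mult_right_mono) auto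
    finally have p1: "?a * (T ?x \<bullet> n \<tau>) \<le> lam * s \<tau> * (1 / 2)" by simp
    have p2: "lam * s \<tau> * (1 / 2) \<le> lam * s \<tau> * (T ?x \<bullet> T (\<gamma> \<tau>))"
      using TT lam s_pos [of \<tau>] by (intro mult_left_mono) auto
    have "rot90 (T ?x) \<bullet> b' \<tau> = ?a * (rot90 (T ?x) \<bullet> T (\<gamma> \<tau>)) + lam * s \<tau> * (rot90 (T ?x) \<bullet> n \<tau>)"
      by (simp add: b'_def inner_add_right)
    also have "rot90 (T ?x) \<bullet> T (\<gamma> \<tau>) = - (T ?x \<bullet> n \<tau>)" by (simp add: n_def inner_rot90_right)
    also have "rot90 (T ?x) \<bullet> n \<tau> = T ?x \<bullet> T (\<gamma> \<tau>)" unfolding n_def by (rule rot90_inner_rot90)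
    finally have "0 \<le> rot90 (T ?x) \<bullet> b' \<tau>" using p1 p2 by simp
    then have "0 \<le> norm (V ?x) * (rot90 (T ?x) \<bullet> b' \<tau>)" by simp
    also have "\<dots> = W ?x \<bullet> b' \<tau>" using arg_cong [OF VT [of ?x], of rot90] by (simp add: rot90_simps)
    finally show ?thesis using Wg by simp
  qed
  let ?h = "\<lambda>\<tau> r. rot_of (F' (\<gamma> \<tau> + r *\<^sub>R (b \<tau> - \<gamma> \<tau>))) *
        (rot90 (T (\<gamma> \<tau>) + r *\<^sub>R (b' \<tau> - T (\<gamma> \<tau>))) \<bullet> (b \<tau> - \<gamma> \<tau>))"
  define m where "m = c\<^sub>0 * (\<epsilon> * exp (- (8 * (1 + M))) / 2)"
  have h_ge: "m \<le> ?h \<tau> r" if \<tau>: "\<tau> \<in> {t / 2..t}" and r: "r \<in> {0..1}" for \<tau> r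
  proof -
    have \<tau>0: "\<tau> \<in> {0..t}" using \<tau> sub by auto
    have "rot90 (T (\<gamma> \<tau>) + r *\<^sub>R (b' \<tau> - T (\<gamma> \<tau>))) = (1 - r * (s \<tau> * k (\<gamma> \<tau>))) *\<^sub>R n \<tau> - (r * (lam * s \<tau>)) *\<^sub>R T (\<gamma> \<tau>)"
      by (simp add: b'_def n_def rot90_simps algebra_simps)
    moreover have "b \<tau> - \<gamma> \<tau> = s \<tau> *\<^sub>R n \<tau>" by (simp add: b_def)
    moreover have "T (\<gamma> \<tau>) \<bullet> n \<tau> = 0" by (simp add: n_def)
    ultimately have eq: "rot90 (T (\<gamma> \<tau>) + r *\<^sub>R (b' \<tau> - T (\<gamma> \<tau>))) \<bullet> (b \<tau> - \<gamma> \<tau>) = (1 - r * (s \<tau> * k (\<gamma> \<tau>))) * s \<tau>"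
      using unit(4) [OF \<tau>0] by (simp add: inner_diff_left)
    have "\<bar>r * (s \<tau> * k (\<gamma> \<tau>))\<bar> \<le> 1 * (1 / 2)"
      unfolding abs_mult [of r] using sk [OF \<tau>0] r by (intro mult_mono) auto
    then have "1 / 2 \<le> 1 - r * (s \<tau> * k (\<gamma> \<tau>))" by (simp add: abs_le_iff)
    then have "1 / 2 * (\<epsilon> * exp (- (8 * (1 + M)))) \<le> (1 - r * (s \<tau> * k (\<gamma> \<tau>))) * s \<tau>"
      using s_ge [of \<tau>] \<tau> \<epsilon>(1) by (intro mult_mono) auto
    then have "\<epsilon> * exp (- (8 * (1 + M))) / 2 \<le> (1 - r * (s \<tau> * k (\<gamma> \<tau>))) * s \<tau>" by simp
    moreover have "\<gamma> \<tau> + r *\<^sub>R (b \<tau> - \<gamma> \<tau>) \<in> ball p\<^sub>0 \<rho>" using x_G [OF \<tau>0 r] unfolding pt by simp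
    then have "c\<^sub>0 \<le> rot_of (F' (\<gamma> \<tau> + r *\<^sub>R (b \<tau> - \<gamma> \<tau>)))" by (rule curl_ge)
    ultimately show ?thesis
      unfolding m_def eq using c0_pos \<epsilon>(1) by (intro mult_mono) auto
  qed
  have ch: "continuous_on ({t / 2..t} \<times> {0..1}) (\<lambda>p. ?h (fst p) (snd p))"
  proof -
    let ?P = "{t / 2..t} \<times> {0..1::real}"
    have c1: "continuous_on ?P (\<lambda>p. \<gamma> (fst p))" "continuous_on ?P (\<lambda>p. b (fst p))"
      "continuous_on ?P (\<lambda>p. T (\<gamma> (fst p)))" "continuous_on ?P (\<lambda>p. b' (fst p))"
      by (rule continuous_on_compose2 [OF cg] continuous_on_compose2 [OF cb]
          continuous_on_compose2 [OF cT] continuous_on_compose2 [OF cb'];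
          auto intro!: continuous_intros)+
    have "continuous_on ?P (\<lambda>p. \<gamma> (fst p) + snd p *\<^sub>R (b (fst p) - \<gamma> (fst p)))"
      by (intro continuous_intros c1)
    then have "continuous_on ?P (\<lambda>p. rot_of (F' (\<gamma> (fst p) + snd p *\<^sub>R (b (fst p) - \<gamma> (fst p)))))"
      by (rule continuous_on_compose2 [OF rot_F'_cont]) (use x_G sub in \<open>auto simp: pt\<close>)
    then show ?thesis by (intro continuous_intros c1)
  qed
  have area: "m * (t - t / 2) \<le> integral {t / 2..t} (\<lambda>\<tau>. integral {0..1} (?h \<tau>))"
  proof -
    have inner: "m \<le> integral {0..1} (?h \<tau>)" if \<tau>: "\<tau> \<in> {t / 2..t}" for \<tau>
    proof -
      have "integral {0..1::real} (\<lambda>_. m) \<le> integral {0..1} (?h \<tau>)"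
        by (rule integral_le) (use h_ge [OF \<tau>] continuous_on_slice [OF ch \<tau>] in
            \<open>auto intro: integrable_continuous_interval\<close>)
      then show ?thesis by simp
    qed
    have "integral {t / 2..t} (\<lambda>_. m) \<le> integral {t / 2..t} (\<lambda>\<tau>. integral {0..1} (?h \<tau>))"
      by (rule integral_le) (use inner continuous_on_param_integral [OF ch] in
          \<open>auto intro: integrable_continuous_interval\<close>)
    then show ?thesis using t by (simp add: mult.commute)
  qed
  have top: "0 \<le> integral {t / 2..t} (\<lambda>\<tau>. W (b \<tau>) \<bullet> b' \<tau> - W (\<gamma> \<tau>) \<bullet> T (\<gamma> \<tau>))"
    by (rule integral_nonneg) (use side in \<open>auto intro!: integrable_continuous_interval continuous_intros cb cb' cg cT\<close>)
  have seg_bound: "\<bar>seg W (\<gamma> \<tau>) (b \<tau>) - s \<tau> * norm (V (\<gamma> \<tau>))\<bar> \<le> s \<tau> * \<theta>" if \<tau>0: "\<tau> \<in> {0..t}" for \<tau>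
  proof -
    have "\<bar>seg W (\<gamma> \<tau>) (b \<tau>) - seg (\<lambda>_. W (\<gamma> \<tau>)) (\<gamma> \<tau>) (b \<tau>)\<bar> \<le> \<theta> * norm (b \<tau> - \<gamma> \<tau>)"
    proof (rule seg_diff_le)
      show "continuous_on (closed_segment (\<gamma> \<tau>) (b \<tau>)) W"
        by (intro continuous_intros continuous_on_V)
      fix x assume "x \<in> closed_segment (\<gamma> \<tau>) (b \<tau>)"
      then obtain r where r: "r \<in> {0..1}" "x = \<gamma> \<tau> + r *\<^sub>R (b \<tau> - \<gamma> \<tau>)" by (rule in_segment_point)
      have "norm (W x - W (\<gamma> \<tau>)) = norm (V x - V (\<gamma> \<tau>))"
        by (simp add: rot90_simps [symmetric])
      then show "norm (W x - W (\<gamma> \<tau>)) \<le> \<theta>"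
        using x_V [OF \<tau>0 r(1)] r(2) by (simp add: pt)
    qed auto
    moreover have "norm (b \<tau> - \<gamma> \<tau>) = s \<tau>" using unit(3) [OF \<tau>0] s_pos [of \<tau>] by (simp add: b_def)
    moreover have "seg (\<lambda>_. W (\<gamma> \<tau>)) (\<gamma> \<tau>) (b \<tau>) = s \<tau> * norm (V (\<gamma> \<tau>))"
    proof -
      have "W (\<gamma> \<tau>) \<bullet> n \<tau> = norm (V (\<gamma> \<tau>))"
        using arg_cong [OF VT [of "\<gamma> \<tau>"], of rot90] unit(2) [OF \<tau>0]
        by (metis inner_scaleR_left mult.right_neutral n_def rot90_inner_rot90 rot90_simps(3))
      then show ?thesis by (simp add: seg_const b_def)
    qed
    ultimately show ?thesis by (simp add: mult.commute)
  qed
  have st: "s t = \<epsilon>" by (simp add: s_def)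
  have e1: "seg W (\<gamma> t) (b t) \<le> \<epsilon> * norm (V (\<gamma> t)) + \<epsilon> * \<theta>"
    using seg_bound [of t] t unfolding st by (auto simp: abs_le_iff)
  \<comment> \<open>A lower bound is enough here: the flux through the initial end is nonnegative up
    to the oscillation of \<open>V\<close>.\<close>
  have e2: "- (\<epsilon> * \<theta>) \<le> seg W (\<gamma> (t / 2)) (b (t / 2))"
  proof -
    have "s (t / 2) * \<theta> \<le> \<epsilon> * \<theta>" using s_le [of "t / 2"] t \<theta> by (intro mult_right_mono) auto
    moreover have "0 \<le> s (t / 2) * norm (V (\<gamma> (t / 2)))" using s_pos [of "t / 2"] by simp
    moreover have "- (s (t / 2) * \<theta>) \<le> seg W (\<gamma> (t / 2)) (b (t / 2)) - s (t / 2) * norm (V (\<gamma> (t / 2)))"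
      using seg_bound [of "t / 2"] t by (simp only: abs_le_iff) auto
    ultimately show ?thesis by linarith
  qed
  have e3: "m * (t - t / 2) = \<epsilon> * (\<kappa> * t)" by (simp add: m_def \<kappa>_def)
  have "\<epsilon> * (\<kappa> * t) \<le> \<epsilon> * norm (V (\<gamma> t)) + \<epsilon> * \<theta> + \<epsilon> * \<theta>"
    using strip top area e1 e2 e3 by linarith
  then have "\<epsilon> * (\<kappa> * t) \<le> \<epsilon> * (norm (V (\<gamma> t)) + \<theta>2)" by (simp add: \<theta>_def algebra_simps)
  then show "\<kappa> * t \<le> norm (V (\<gamma> t)) + \<theta>2" using \<epsilon>(1) by simp
qed

text \<open>At most 1, as \<open>norm_V_growth\<close> asks, and at most \<open>\<rho> / 4\<close>,
  so that 1-Lipschitz curves starting within \<open>\<rho> / 2\<close> of the centre stay within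
  \<open>3 * \<rho> / 4\<close>.\<close>

definition L :: real where "L = min 1 (\<rho> / 4)"

lemma L: "0 < L" "L \<le> 1" "L \<le> \<rho> / 4"
  using rho by (auto simp: L_def)

text \<open>The truncation level \<open>\<delta>\<close> is never reached: up to
  \<open>\<tau>1\<close> by continuity from \<open>V p\<close>, and at a later first time because
  the curve is a true characteristic up to it, so that \<open>norm_V_growth\<close> gives more than
  \<open>\<kappa> * \<tau>1\<close>, hence more than \<open>\<delta>\<close>. The truncated solution
  is therefore a characteristic on all of \<open>{0..L}\<close>.\<close>

lemma char_exists:
  assumes p: "p \<in> cball p\<^sub>0 (\<rho> / 2)" and Vp: "V p \<noteq> 0"
  shows "\<exists>\<gamma>. \<gamma> 0 = p \<and> is_char \<gamma> 0 L \<and> (\<forall>s\<in>{0..L}. \<forall>t\<in>{0..L}. norm (\<gamma> s - \<gamma> t) \<le> \<bar>s - t\<bar>)"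
proof -
  obtain d1 where d1: "d1 > 0" "\<And>x y. x \<in> cball p\<^sub>0 \<rho> \<Longrightarrow> y \<in> cball p\<^sub>0 \<rho> \<Longrightarrow> norm (x - y) \<le> d1 \<Longrightarrow>
      norm (V x - V y) < norm (V p) / 2"
    using V_uniformly_continuous [of "norm (V p) / 2"] Vp by auto
  define \<tau>1 where "\<tau>1 = min d1 L"
  have \<tau>1: "0 < \<tau>1" "\<tau>1 \<le> d1" using d1 L by (auto simp: \<tau>1_def)
  define \<delta> where "\<delta> = min (norm (V p)) (\<kappa> * \<tau>1) / 2"
  have \<delta>: "0 < \<delta>" "\<delta> \<le> norm (V p) / 2" "\<delta> < \<kappa> * \<tau>1"
  proof -
    have "0 < \<kappa> * \<tau>1" using kappa_pos \<tau>1 by simp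
    moreover have "\<delta> \<le> \<kappa> * \<tau>1 / 2" "\<delta> \<le> norm (V p) / 2" by (simp_all add: \<delta>_def)
    ultimately show "0 < \<delta>" "\<delta> \<le> norm (V p) / 2" "\<delta> < \<kappa> * \<tau>1" using Vp by (auto simp: \<delta>_def)
  qed
  obtain \<gamma> where \<gamma>: "\<gamma> 0 = p" "continuous_on {0..1} \<gamma>"
      "\<forall>s\<in>{0..1}. \<forall>t\<in>{0..1}. norm (\<gamma> s - \<gamma> t) \<le> \<bar>s - t\<bar>"
      "\<forall>t\<in>{0..1}. (\<forall>\<tau>\<in>{0..t}. \<gamma> \<tau> \<in> ball p\<^sub>0 \<rho> \<and> \<delta> \<le> norm (V (\<gamma> \<tau>))) \<longrightarrow> is_char \<gamma> 0 t"
    using truncated_flow [OF \<delta>(1), of p] by blast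
  have near: "norm (\<gamma> \<tau> - p) \<le> \<tau>" if "\<tau> \<in> {0..L}" for \<tau>
    using \<gamma>(3) [rule_format, of \<tau> 0] \<gamma>(1) that L by auto
  have in_ball: "\<gamma> \<tau> \<in> ball p\<^sub>0 \<rho>" if "\<tau> \<in> {0..L}" for \<tau>
  proof -
    have "norm (\<gamma> \<tau> - p\<^sub>0) \<le> norm (\<gamma> \<tau> - p) + norm (p - p\<^sub>0)"
      using norm_triangle_ineq [of "\<gamma> \<tau> - p" "p - p\<^sub>0"] by simp
    also have "\<dots> \<le> \<rho> / 4 + \<rho> / 2" using near [OF that] that L p by (auto simp: dist_norm norm_minus_commute)
    also have "\<dots> < \<rho>" using rho by simp
    finally show ?thesis by (simp add: dist_norm norm_minus_commute)
  qed
  have char: "is_char \<gamma> 0 t" if "t \<in> {0..L}" "\<And>\<tau>. \<tau> \<in> {0..t} \<Longrightarrow> \<delta> \<le> norm (V (\<gamma> \<tau>))" for t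
  proof (rule \<gamma>(4) [rule_format])
    show "t \<in> {0..1}" using that L by auto
    show "\<gamma> \<tau> \<in> ball p\<^sub>0 \<rho> \<and> \<delta> \<le> norm (V (\<gamma> \<tau>))" if "\<tau> \<in> {0..t}" for \<tau>
      using that \<open>t \<in> {0..L}\<close> \<open>\<And>\<tau>. \<tau> \<in> {0..t} \<Longrightarrow> \<delta> \<le> norm (V (\<gamma> \<tau>))\<close> in_ball [of \<tau>] by auto
  qed
  have early: "\<delta> < norm (V (\<gamma> \<tau>))" if \<tau>: "\<tau> \<in> {0..L}" "\<tau> \<le> \<tau>1" for \<tau>
  proof -
    have "norm (V p - V (\<gamma> \<tau>)) < norm (V p) / 2"
    proof (rule d1(2))
      show "p \<in> cball p\<^sub>0 \<rho>" using p rho by auto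
      show "\<gamma> \<tau> \<in> cball p\<^sub>0 \<rho>" using in_ball [OF \<tau>(1)] by auto
      show "norm (p - \<gamma> \<tau>) \<le> d1" using near [OF \<tau>(1)] \<tau> \<tau>1 by (simp add: norm_minus_commute)
    qed
    then have "norm (V p) / 2 < norm (V (\<gamma> \<tau>))"
      using norm_triangle_ineq2 [of "V p" "V (\<gamma> \<tau>)"] by linarith
    then show ?thesis using \<delta> by linarith
  qed
  have all: "\<delta> < norm (V (\<gamma> \<tau>))" if \<tau>: "\<tau> \<in> {0..L}" for \<tau>
  proof (rule ccontr)
    assume neg: "\<not> ?thesis"
    let ?f = "\<lambda>\<tau>. - norm (V (\<gamma> \<tau>))"
    have cf: "continuous_on {0..L} ?f"
      by (intro continuous_intros continuous_on_subset [OF \<gamma>(2)]) (use L in auto)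
    have f0: "?f 0 < - \<delta>" using early [of 0] L \<tau>1 by auto
    have ft: "- \<delta> \<le> ?f \<tau>" using neg by simp
    obtain t where t: "t \<in> {0..L}" "0 < t" "?f t = - \<delta>" "\<And>s. s \<in> {0..<t} \<Longrightarrow> ?f s < - \<delta>"
      using first_exit [OF cf f0 \<tau> ft] by blast
    have "t > \<tau>1" using early [of t] t by force
    have "is_char \<gamma> 0 t"
    proof (rule char [OF t(1)])
      show "\<delta> \<le> norm (V (\<gamma> \<tau>))" if "\<tau> \<in> {0..t}" for \<tau>
        using t(3) t(4) [of \<tau>] that by (cases "\<tau> = t") auto
    qed
    then have "\<kappa> * t \<le> norm (V (\<gamma> t))"
      by (rule norm_V_growth) (use t L in auto)
    moreover have "\<kappa> * \<tau>1 < \<kappa> * t" using \<open>t > \<tau>1\<close> kappa_pos by simp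
    ultimately show False using t(3) \<delta>(3) by simp
  qed
  have "is_char \<gamma> 0 L"
    by (rule char) (use L all in \<open>auto intro: less_imp_le\<close>)
  then show ?thesis using \<gamma> L by (intro exI [of _ \<gamma>]) auto
qed

text \<open>A ray may start at a singular point; the lower bound on \<open>norm (V (\<gamma> \<tau>))\<close> is what keeps the
  limit of a sequence of rays away from the singular set for positive times.\<close>

definition ray :: "(real \<Rightarrow> real^2) \<Rightarrow> bool" where
  "ray \<gamma> \<longleftrightarrow> \<gamma> 0 \<in> cball p\<^sub>0 (\<rho> / 2) \<and> (\<forall>s\<in>{0..L}. \<forall>t\<in>{0..L}. norm (\<gamma> s - \<gamma> t) \<le> \<bar>s - t\<bar>) \<and>
    (\<forall>\<tau>\<in>{0..L}. \<kappa> * \<tau> \<le> norm (V (\<gamma> \<tau>))) \<and> (\<forall>s\<in>{0<..L}. is_char \<gamma> s L)"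

lemma rayD:
  assumes "ray \<gamma>"
  shows "\<gamma> 0 \<in> cball p\<^sub>0 (\<rho> / 2)" "s \<in> {0..L} \<Longrightarrow> t \<in> {0..L} \<Longrightarrow> norm (\<gamma> s - \<gamma> t) \<le> \<bar>s - t\<bar>"
    "s \<in> {0..L} \<Longrightarrow> \<kappa> * s \<le> norm (V (\<gamma> s))" "s \<in> {0<..L} \<Longrightarrow> is_char \<gamma> s L"
  using assms unfolding ray_def by blast+

lemma ray_exists:
  assumes p: "p \<in> cball p\<^sub>0 (\<rho> / 2)" and Vp: "V p \<noteq> 0"
  shows "\<exists>\<gamma>. ray \<gamma> \<and> \<gamma> 0 = p"
proof -
  obtain \<gamma> where \<gamma>: "\<gamma> 0 = p" "is_char \<gamma> 0 L" "\<forall>s\<in>{0..L}. \<forall>t\<in>{0..L}. norm (\<gamma> s - \<gamma> t) \<le> \<bar>s - t\<bar>"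
    using char_exists [OF assms] by blast
  have "\<kappa> * \<tau> \<le> norm (V (\<gamma> \<tau>))" if "\<tau> \<in> {0..L}" for \<tau>
  proof (cases "\<tau> = 0")
    case False
    show ?thesis
      by (rule norm_V_growth [OF is_char_subset [OF \<gamma>(2)]]) (use that False L in auto)
  qed simp
  moreover have "is_char \<gamma> s L" if "s \<in> {0<..L}" for s
    by (rule is_char_subset [OF \<gamma>(2)]) (use that in auto)
  ultimately show ?thesis using \<gamma> p unfolding ray_def by blast
qed

lemma ray_in_ball:
  assumes "ray \<gamma>" "\<tau> \<in> {0..L}"
  shows "\<gamma> \<tau> \<in> cball p\<^sub>0 (3 * \<rho> / 4)"
proof -
  have "norm (\<gamma> \<tau> - \<gamma> 0) \<le> \<bar>\<tau> - 0\<bar>"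
    by (rule rayD [OF assms(1)]) (use assms L in auto)
  moreover have "norm (\<gamma> 0 - p\<^sub>0) \<le> \<rho> / 2"
    using rayD(1) [OF assms(1)] by (simp add: dist_norm norm_minus_commute)
  ultimately show ?thesis
    using norm_triangle_ineq [of "\<gamma> \<tau> - \<gamma> 0" "\<gamma> 0 - p\<^sub>0"] assms(2) L by (auto simp: dist_norm norm_minus_commute)
qed

section \<open>Compactness of rays and density of nonsingular points\<close>

lemma char_integral:
  assumes "is_char \<gamma> s t" "\<tau> \<in> {s..t}"
  shows "\<gamma> \<tau> = \<gamma> s + integral {s..\<tau>} (\<lambda>\<tau>. T (\<gamma> \<tau>))"
proof -
  have "((\<lambda>\<tau>. T (\<gamma> \<tau>)) has_integral \<gamma> \<tau> - \<gamma> s) {s..\<tau>}"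
  proof (rule fundamental_theorem_of_calculus)
    show "(\<gamma> has_vector_derivative T (\<gamma> x)) (at x within {s..\<tau>})" if "x \<in> {s..\<tau>}" for x
      by (rule has_vector_derivative_within_subset [OF is_charD(2) [OF assms(1)]]) (use that assms(2) in auto)
  qed (use assms in auto)
  then show ?thesis by (simp add: integral_unique)
qed

text \<open>Arzela-Ascoli gives the limit curve. The linear lower bound on the length of
  \<open>V\<close> survives the limit and keeps \<open>V\<close> away from zero on
  \<open>{s..L}\<close>, where the integral equation can then be passed to the limit.\<close>

lemma rays_compact:
  assumes g: "\<And>n. ray (g n)"
  shows "\<exists>h r. strict_mono (r :: nat \<Rightarrow> nat) \<and> ray h \<and> (\<forall>\<tau>\<in>{0..L}. (\<lambda>n. g (r n) \<tau>) \<longlonglongrightarrow> h \<tau>)"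
proof -
  have lip: "norm (g n s - g n t) \<le> \<bar>s - t\<bar>" if "s \<in> {0..L}" "t \<in> {0..L}" for n s t
    using g [of n] that by (auto simp: ray_def)
  have "norm (g n x) \<le> norm p\<^sub>0 + \<rho>" if x: "x \<in> {0..L}" for n x
  proof -
    have "norm (g n x - p\<^sub>0) \<le> \<rho>"
      using ray_in_ball [OF g x, of n] rho by (auto simp: dist_norm norm_minus_commute)
    then show ?thesis using norm_triangle_sub [of "g n x" p\<^sub>0] by simp
  qed
  moreover have "\<exists>d>0. \<forall>n y. y \<in> {0..L} \<and> norm (x - y) < d \<longrightarrow> norm (g n x - g n y) < e"
    if "e > 0" "x \<in> {0..L}" for x e
    using lip that by (intro exI [of _ e]) (auto intro: le_less_trans)
  ultimately obtain h r where ch: "continuous_on {0..L} h" and r: "strict_mono (r :: nat \<Rightarrow> nat)"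
    and lim: "\<And>e. 0 < e \<Longrightarrow> \<exists>N. \<forall>n x. n \<ge> N \<and> x \<in> {0..L} \<longrightarrow> norm (g (r n) x - h x) < e"
    using Arzela_Ascoli [OF compact_Icc, of 0 L g "norm p\<^sub>0 + \<rho>"] by metis
  have pw: "(\<lambda>n. g (r n) \<tau>) \<longlonglongrightarrow> h \<tau>" if "\<tau> \<in> {0..L}" for \<tau>
    unfolding LIMSEQ_iff using lim that by blast
  have h0: "h 0 \<in> cball p\<^sub>0 (\<rho> / 2)"
    by (rule closed_sequentially [OF closed_cball _ pw]) (use g L in \<open>auto simp: ray_def\<close>)
  have hlip: "norm (h s - h t) \<le> \<bar>s - t\<bar>" if "s \<in> {0..L}" "t \<in> {0..L}" for s t
    by (rule LIMSEQ_le_const2 [OF tendsto_norm [OF tendsto_diff [OF pw pw]]]) (use that lip in auto)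
  have hball: "h \<tau> \<in> cball p\<^sub>0 (3 * \<rho> / 4)" if "\<tau> \<in> {0..L}" for \<tau>
    by (rule closed_sequentially [OF closed_cball _ pw [OF that]]) (rule ray_in_ball [OF g that])
  have hV: "\<kappa> * \<tau> \<le> norm (V (h \<tau>))" if \<tau>: "\<tau> \<in> {0..L}" for \<tau>
  proof (rule LIMSEQ_le_const)
    have "isCont V (h \<tau>)" using cont_V by (simp add: continuous_on_eq_continuous_at)
    then show "(\<lambda>n. norm (V (g (r n) \<tau>))) \<longlonglongrightarrow> norm (V (h \<tau>))"
      by (intro tendsto_norm isCont_tendsto_compose [OF _ pw [OF \<tau>]])
    show "\<exists>N. \<forall>n\<ge>N. \<kappa> * \<tau> \<le> norm (V (g (r n) \<tau>))" using g \<tau> by (auto simp: ray_def)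
  qed
  have hG: "h \<tau> \<in> G" if "\<tau> \<in> {0<..L}" for \<tau>
  proof -
    have "0 < \<kappa> * \<tau>" using kappa_pos that by simp
    then have "V (h \<tau>) \<noteq> 0" using hV [of \<tau>] that by auto
    then show ?thesis using hball [of \<tau>] that rho by auto
  qed
  have hchar: "is_char h s L" if s: "s \<in> {0<..L}" for s
  proof -
    have sub: "{s..L} \<subseteq> {0..L}" "{s..L} \<subseteq> {0<..L}" using s by auto
    have chs: "continuous_on {s..L} h" by (rule continuous_on_subset [OF ch sub(1)])
    have cTh: "continuous_on {s..L} (\<lambda>\<tau>. T (h \<tau>))"
      by (rule cont_T_comp [OF chs]) (use hG sub in blast)
    have eq: "h \<tau> = h s + integral {s..\<tau>} (\<lambda>\<tau>. T (h \<tau>))" if \<tau>: "\<tau> \<in> {s..L}" for \<tau>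
    proof (rule eq_of_norm_le_eps_mult)
      fix e :: real assume e: "e > 0"
      have ks: "\<kappa> * s > 0" using kappa_pos s by simp
      obtain d where d: "d > 0" "\<And>x y. x \<in> cball p\<^sub>0 \<rho> \<Longrightarrow> y \<in> cball p\<^sub>0 \<rho> \<Longrightarrow> norm (x - y) \<le> d \<Longrightarrow>
          norm (V x - V y) < e * (\<kappa> * s) / 2"
        using V_uniformly_continuous [of "e * (\<kappa> * s) / 2"] ks e by auto
      obtain N where N: "\<forall>n x. n \<ge> N \<and> x \<in> {0..L} \<longrightarrow> norm (g (r n) x - h x) < min d e"
        using lim [of "min d e"] d e by auto
      define f where "f = g (r N)"
      have fh: "norm (f x - h x) < min d e" if "x \<in> {s..L}" for x
        using N that sub by (auto simp: f_def)
      have f_char: "is_char f s L" using g s by (auto simp: ray_def f_def)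
      have "norm (integral {s..\<tau>} (\<lambda>\<tau>. T (f \<tau>)) - integral {s..\<tau>} (\<lambda>\<tau>. T (h \<tau>))) \<le> e * (\<tau> - s)"
      proof (rule norm_integral_diff_le)
        show "continuous_on {s..\<tau>} (\<lambda>\<tau>. T (f \<tau>))"
          by (rule continuous_on_subset [OF is_char_continuous(2) [OF f_char]]) (use \<tau> in auto)
        show "continuous_on {s..\<tau>} (\<lambda>\<tau>. T (h \<tau>))"
          by (rule continuous_on_subset [OF cTh]) (use \<tau> in auto)
        fix x assume x: "x \<in> {s..\<tau>}"
        then have xL: "x \<in> {s..L}" "x \<in> {0..L}" using \<tau> s by auto
        have hx: "h x \<in> G" using hG sub xL by blast
        have fx: "f x \<in> G" by (rule is_charD(1) [OF f_char xL(1)])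
        have "\<kappa> * s \<le> \<kappa> * x" using x kappa_pos by simp
        then have kx: "\<kappa> * s \<le> norm (V (h x))" using hV [OF xL(2)] by linarith
        have "norm (V (h x) - V (f x)) < e * (\<kappa> * s) / 2"
          using hx fx fh [OF xL(1)] by (intro d(2)) (auto simp: norm_minus_commute)
        then have "2 * norm (V (h x) - V (f x)) / norm (V (h x)) \<le> (e * (\<kappa> * s)) / (\<kappa> * s)"
          using kx ks e by (intro frac_le) auto
        also have "\<dots> = e" by (rule nonzero_mult_div_cancel_right) (use ks in linarith)
        finally have "norm (T (h x) - T (f x)) \<le> e"
          using norm_sgn_diff_le [of "V (h x)" "V (f x)"] hx fx by simp
        then show "norm (T (f x) - T (h x)) \<le> e" by (simp add: norm_minus_commute)
      qed (use \<tau> in auto)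
      also have "e * (\<tau> - s) \<le> e * L" using e \<tau> s by (intro mult_left_mono) auto
      finally have 1: "norm (integral {s..\<tau>} (\<lambda>\<tau>. T (f \<tau>)) - integral {s..\<tau>} (\<lambda>\<tau>. T (h \<tau>))) \<le> e * L" .
      have 2: "norm (h \<tau> - f \<tau>) \<le> e" "norm (f s - h s) \<le> e"
        using fh [OF \<tau>] fh [of s] s by (auto simp: norm_minus_commute)
      have "h \<tau> - (h s + integral {s..\<tau>} (\<lambda>\<tau>. T (h \<tau>))) =
          (h \<tau> - f \<tau>) + ((f s - h s) + (integral {s..\<tau>} (\<lambda>\<tau>. T (f \<tau>)) - integral {s..\<tau>} (\<lambda>\<tau>. T (h \<tau>))))"
        using char_integral [OF f_char \<tau>] by simp
      also have "norm \<dots> \<le> e + (e + e * L)"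
        by (intro norm_triangle_mono 1 2)
      finally show "norm (h \<tau> - (h s + integral {s..\<tau>} (\<lambda>\<tau>. T (h \<tau>)))) \<le> e * (2 + L)"
        by (simp add: algebra_simps)
    qed
    show ?thesis
      unfolding is_char_def
    proof (intro ballI conjI)
      fix \<tau> assume \<tau>: "\<tau> \<in> {s..L}"
      show "h \<tau> \<in> G" using hG sub \<tau> by blast
      have "((\<lambda>x. h s + integral {s..x} (\<lambda>\<tau>. T (h \<tau>))) has_vector_derivative T (h \<tau>)) (at \<tau> within {s..L})"
        using has_vector_derivative_add [OF has_vector_derivative_const integral_has_vector_derivative [OF cTh \<tau>]]
        by simp
      then show "(h has_vector_derivative T (h \<tau>)) (at \<tau> within {s..L})"
        using has_vector_derivative_transform [OF \<tau>, of h "\<lambda>x. h s + integral {s..x} (\<lambda>\<tau>. T (h \<tau>))"] eq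
        by blast
    qed
  qed
  have "ray h" unfolding ray_def using h0 hlip hV hchar by blast
  then show ?thesis using r pw by blast
qed

text \<open>If \<open>V\<close> vanished on a ball, every boundary term of Stokes on a small square
  in it would vanish, while the integral of the curl is at least \<open>c\<^sub>0\<close> times the
  area.\<close>

lemma nonsingular_dense:
  assumes x: "x \<in> ball p\<^sub>0 \<rho>" and e: "e > 0"
  shows "\<exists>y. dist x y < e \<and> V y \<noteq> 0"
proof (rule ccontr)
  assume neg: "\<not> ?thesis"
  obtain e1 where e1: "e1 > 0" "ball x e1 \<subseteq> ball p\<^sub>0 \<rho>"
    using x open_contains_ball by (metis open_ball)
  define d where "d = min e e1 / 4"
  have d: "d > 0" "2 * d < e" "2 * d < e1" using e e1 by (auto simp: d_def)
  define a where "a = (\<lambda>\<tau>. x + \<tau> *\<^sub>R axis 1 1 :: real^2)"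
  define b where "b = (\<lambda>\<tau>. x + \<tau> *\<^sub>R axis 1 1 + d *\<^sub>R axis 2 1 :: real^2)"
  have near: "dist x (a \<tau> + r *\<^sub>R (b \<tau> - a \<tau>)) \<le> 2 * d" if "\<tau> \<in> {0..d}" "r \<in> {0..1}" for \<tau> r
  proof -
    have "norm (\<tau> *\<^sub>R axis 1 1 + r *\<^sub>R d *\<^sub>R axis 2 1 :: real^2) \<le> d + 1 * d"
      by (intro norm_triangle_mono) (use that d in \<open>auto simp: mult_left_le_one_le\<close>)
    moreover have "a \<tau> + r *\<^sub>R (b \<tau> - a \<tau>) = x + (\<tau> *\<^sub>R axis 1 1 + r *\<^sub>R d *\<^sub>R axis 2 1)"
      by (simp add: a_def b_def)
    moreover have "dist x (x + v) = norm v" for v :: "real^2" by (simp add: dist_norm)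
    ultimately show ?thesis by (simp only: mult_1 mult_2)
  qed
  have in_ball: "a \<tau> + r *\<^sub>R (b \<tau> - a \<tau>) \<in> ball p\<^sub>0 \<rho>" "V (a \<tau> + r *\<^sub>R (b \<tau> - a \<tau>)) = 0"
    if "\<tau> \<in> {0..d}" "r \<in> {0..1}" for \<tau> r
  proof -
    have "a \<tau> + r *\<^sub>R (b \<tau> - a \<tau>) \<in> ball x e1" using near [OF that] d by auto
    then show "a \<tau> + r *\<^sub>R (b \<tau> - a \<tau>) \<in> ball p\<^sub>0 \<rho>" using e1 by blast
    show "V (a \<tau> + r *\<^sub>R (b \<tau> - a \<tau>)) = 0" using neg near [OF that] d by force
  qed
  have Vab: "V (a \<tau>) = 0" "V (b \<tau>) = 0" if "\<tau> \<in> {0..d}" for \<tau>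
    using in_ball(2) [OF that, of 0] in_ball(2) [OF that, of 1] by auto
  let ?e1 = "axis 1 1 :: real^2"
  have strip: "seg W (a d) (b d) - seg W (a 0) (b 0) =
    integral {0..d} (\<lambda>\<tau>. W (b \<tau>) \<bullet> ?e1 - W (a \<tau>) \<bullet> ?e1) +
    integral {0..d} (\<lambda>\<tau>. integral {0..1} (\<lambda>r. rot_of (F' (a \<tau> + r *\<^sub>R (b \<tau> - a \<tau>))) *
        (rot90 (?e1 + r *\<^sub>R (?e1 - ?e1)) \<bullet> (b \<tau> - a \<tau>))))"
    by (rule strip_stokes_W) (use d in_ball(1) in \<open>auto simp: a_def b_def intro!: derivative_eq_intros\<close>)
  have seg0: "seg W (a \<tau>) (b \<tau>) = 0" if "\<tau> \<in> {0..d}" for \<tau>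
  proof -
    have "seg W (a \<tau>) (b \<tau>) = integral {0..1::real} (\<lambda>_. 0)"
      unfolding seg_def by (intro integral_cong) (use in_ball(2) [OF that] in \<open>simp add: rot90_simps\<close>)
    then show ?thesis by simp
  qed
  have "integral {0..d} (\<lambda>\<tau>. W (b \<tau>) \<bullet> ?e1 - W (a \<tau>) \<bullet> ?e1) = integral {0..d} (\<lambda>_. 0)"
    by (intro integral_cong) (use Vab in \<open>simp add: rot90_simps\<close>)
  moreover have "rot90 ?e1 \<bullet> (b \<tau> - a \<tau>) = d" for \<tau>
    by (simp add: a_def b_def inner_2 axis_def)
  ultimately have zero: "integral {0..d} (\<lambda>\<tau>. integral {0..1} (\<lambda>r. rot_of (F' (a \<tau> + r *\<^sub>R (b \<tau> - a \<tau>))) * d)) = 0"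
    using strip seg0 [of d] seg0 [of 0] d by simp
  have ch: "continuous_on ({0..d} \<times> {0..1}) (\<lambda>p. rot_of (F' (a (fst p) + snd p *\<^sub>R (b (fst p) - a (fst p)))) * d)"
    by (intro continuous_intros continuous_on_compose2 [OF rot_F'_cont])
      (use in_ball(1) in \<open>auto simp: a_def b_def intro!: continuous_intros\<close>)
  have inner: "c\<^sub>0 * d \<le> integral {0..1} (\<lambda>r. rot_of (F' (a \<tau> + r *\<^sub>R (b \<tau> - a \<tau>))) * d)" if \<tau>: "\<tau> \<in> {0..d}" for \<tau>
  proof -
    have "integral {0..1::real} (\<lambda>_. c\<^sub>0 * d) \<le> integral {0..1} (\<lambda>r. rot_of (F' (a \<tau> + r *\<^sub>R (b \<tau> - a \<tau>))) * d)"
    proof (rule integral_le)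
      show "(\<lambda>r. rot_of (F' (a \<tau> + r *\<^sub>R (b \<tau> - a \<tau>))) * d) integrable_on {0..1}"
        by (rule integrable_continuous_interval [OF continuous_on_slice [OF ch \<tau>]])
    qed (use curl_ge in_ball(1) [OF \<tau>] d in \<open>auto intro!: mult_right_mono\<close>)
    then show ?thesis by simp
  qed
  have "integral {0..d} (\<lambda>_. c\<^sub>0 * d) \<le> integral {0..d} (\<lambda>\<tau>. integral {0..1} (\<lambda>r. rot_of (F' (a \<tau> + r *\<^sub>R (b \<tau> - a \<tau>))) * d))"
    by (rule integral_le) (use inner continuous_on_param_integral [OF ch] in \<open>auto intro!: integrable_continuous_interval\<close>)
  then have "c\<^sub>0 * d \<le> 0" using zero d by simp
  then show False using c0_pos d by (simp add: mult_le_0_iff)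
qed

lemma ray_from_singular:
  assumes x: "x \<in> ball p\<^sub>0 (\<rho> / 2)"
  shows "\<exists>\<gamma>. ray \<gamma> \<and> \<gamma> 0 = x"
proof -
  have "\<exists>\<gamma>. ray \<gamma> \<and> dist x (\<gamma> 0) < 1 / real (Suc n)" for n
  proof -
    obtain e1 where e1: "e1 > 0" "ball x e1 \<subseteq> ball p\<^sub>0 (\<rho> / 2)"
      using x open_contains_ball by (metis open_ball)
    obtain y where y: "dist x y < min e1 (1 / real (Suc n))" "V y \<noteq> 0"
      using nonsingular_dense [of x "min e1 (1 / real (Suc n))"] x e1 rho by auto
    then have "y \<in> cball p\<^sub>0 (\<rho> / 2)" using e1 by auto
    then show ?thesis using ray_exists [OF _ y(2)] y(1) by auto
  qed
  then obtain g where g: "\<And>n. ray (g n)" "\<And>n. dist x (g n 0) < 1 / real (Suc n)" by metis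
  obtain h r where h: "strict_mono (r :: nat \<Rightarrow> nat)" "ray h" "\<forall>\<tau>\<in>{0..L}. (\<lambda>n. g (r n) \<tau>) \<longlonglongrightarrow> h \<tau>"
    using rays_compact [of g, OF g(1)] by blast
  have "(\<lambda>n. g n 0) \<longlonglongrightarrow> x"
  proof (rule metric_tendsto_imp_tendsto [OF LIMSEQ_inverse_real_of_nat])
    show "\<forall>\<^sub>F n in sequentially. dist (g n 0) x \<le> dist (inverse (real (Suc n))) 0"
      using g(2) by (auto simp: dist_commute inverse_eq_divide less_imp_le)
  qed
  from LIMSEQ_subseq_LIMSEQ [OF this h(1)] have "(\<lambda>n. g (r n) 0) \<longlonglongrightarrow> x" by (simp add: o_def)
  moreover have "(\<lambda>n. g (r n) 0) \<longlonglongrightarrow> h 0" using h(3) L by auto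
  ultimately have "h 0 = x" using LIMSEQ_unique by blast
  then show ?thesis using h(2) by blast
qed

text \<open>This is \<open>S\<^sub>t\<close>. No choice of rays is made, so that compactness of the
  rays makes it closed.\<close>

definition front :: "real \<Rightarrow> (real^2) set" where
  "front t = {\<gamma> t | \<gamma>. ray \<gamma> \<and> V (\<gamma> 0) = 0}"

lemma front_bounded: "t \<in> {0..L} \<Longrightarrow> front t \<subseteq> cball p\<^sub>0 (3 * \<rho> / 4)"
  using ray_in_ball unfolding front_def by blast

lemma front_closed:
  assumes t: "t \<in> {0..L}"
  shows "closed (front t)"
  unfolding closed_sequential_limits
proof (intro allI impI)
  fix y l assume *: "(\<forall>n. y n \<in> front t) \<and> y \<longlonglongrightarrow> l"
  then have "\<forall>n. \<exists>\<gamma>. ray \<gamma> \<and> V (\<gamma> 0) = 0 \<and> y n = \<gamma> t" unfolding front_def by blast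
  then obtain g where g: "\<And>n. ray (g n)" "\<And>n. V (g n 0) = 0" "\<And>n. y n = g n t" by metis
  obtain h r where h: "strict_mono (r :: nat \<Rightarrow> nat)" "ray h" "\<forall>\<tau>\<in>{0..L}. (\<lambda>n. g (r n) \<tau>) \<longlonglongrightarrow> h \<tau>"
    using rays_compact [of g, OF g(1)] by blast
  have "(\<lambda>n. y (r n)) \<longlonglongrightarrow> l" using LIMSEQ_subseq_LIMSEQ [OF conjunct2 [OF *] h(1)] by (simp add: o_def)
  moreover have "(\<lambda>n. y (r n)) \<longlonglongrightarrow> h t" using h(3) t g(3) by auto
  ultimately have "h t = l" using LIMSEQ_unique by blast
  have "isCont V (h 0)" using cont_V by (simp add: continuous_on_eq_continuous_at)
  moreover have "(\<lambda>n. g (r n) 0) \<longlonglongrightarrow> h 0" using h(3) L by auto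
  ultimately have "(\<lambda>n. V (g (r n) 0)) \<longlonglongrightarrow> V (h 0)" by (rule isCont_tendsto_compose)
  then have "V (h 0) = 0" using g(2) by (simp add: LIMSEQ_const_iff)
  then show "l \<in> front t" using \<open>h t = l\<close> h(2) unfolding front_def by blast
qed

text \<open>Gronwall backwards from \<open>t\<close> to a small \<open>s > 0\<close>, since a ray
  need not be a characteristic at time 0; rays are 1-Lipschitz, so the remaining pieces cost at most
  \<open>2 * s\<close>. In particular rays that meet at time \<open>t\<close> have the same
  start.\<close>

lemma ray_start_dist:
  assumes "ray \<gamma>" "ray \<eta>" and t: "t \<in> {0<..L}"
  shows "(norm (\<gamma> 0 - \<eta> 0)) \<le> sqrt (((norm (\<gamma> t - \<eta> t))\<^sup>2 + (norm (T (\<gamma> t) - T (\<eta> t)))\<^sup>2) * exp (1 + M))"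
    (is "_ \<le> ?Q")
proof (rule field_le_epsilon)
  fix e :: real assume e: "e > 0"
  define s where "s = min (e / 2) t"
  have s: "0 < s" "s \<le> t" "2 * s \<le> e" "s \<in> {0..L}" "0 \<in> {0..L}" using e t by (auto simp: s_def)
  have c: "is_char \<gamma> s L" "is_char \<eta> s L" using assms s by (auto simp: ray_def)
  have "(norm (\<gamma> s - \<eta> s))\<^sup>2 \<le> (norm (\<gamma> s - \<eta> s))\<^sup>2 + (norm (T (\<gamma> s) - T (\<eta> s)))\<^sup>2" by simp
  also have "\<dots> \<le> ((norm (\<gamma> t - \<eta> t))\<^sup>2 + (norm (T (\<gamma> t) - T (\<eta> t)))\<^sup>2) * exp ((1 + M) * \<bar>s - t\<bar>)"
    by (rule char_gronwall [OF c]) (use s t in auto)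
  also have "\<dots> \<le> ((norm (\<gamma> t - \<eta> t))\<^sup>2 + (norm (T (\<gamma> t) - T (\<eta> t)))\<^sup>2) * exp (1 + M)"
  proof (rule mult_left_mono)
    have "(1 + M) * \<bar>s - t\<bar> \<le> (1 + M) * 1" using s t L M_ge by (intro mult_left_mono) auto
    then show "exp ((1 + M) * \<bar>s - t\<bar>) \<le> exp (1 + M)" by simp
  qed simp
  finally have 1: "norm (\<gamma> s - \<eta> s) \<le> ?Q" by (rule real_le_rsqrt)
  have "norm (\<gamma> 0 - \<gamma> s) \<le> \<bar>0 - s\<bar>" "norm (\<eta> s - \<eta> 0) \<le> \<bar>s - 0\<bar>"
    using assms(1,2) s(4,5) unfolding ray_def by blast+
  then have 2: "norm (\<gamma> 0 - \<gamma> s) \<le> s" "norm (\<eta> s - \<eta> 0) \<le> s" using s(1) by auto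
  have "\<gamma> 0 - \<eta> 0 = (\<gamma> 0 - \<gamma> s) + ((\<gamma> s - \<eta> s) + (\<eta> s - \<eta> 0))" by simp
  also have "norm \<dots> \<le> s + (?Q + s)" by (intro norm_triangle_mono 1 2)
  finally show "norm (\<gamma> 0 - \<eta> 0) \<le> ?Q + e" using s(3) by simp
qed

text \<open>If rays from zeros met at times \<open>s < t\<close>, backward uniqueness would identify
  the start of the first with the point of the second at time \<open>t - s\<close>; there
  \<open>V\<close> is nonzero by the growth bound.\<close>

lemma fronts_disjoint: "disjoint_family_on front {0<..<L}"
proof -
  have *: False if st: "0 < s" "s < t" "t < L" and y: "y \<in> front s" "y \<in> front t" for s t y
  proof -
    obtain \<gamma> where \<gamma>: "ray \<gamma>" "V (\<gamma> 0) = 0" "\<gamma> s = y" using y(1) unfolding front_def by blast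
    obtain \<eta> where \<eta>: "ray \<eta>" "\<eta> t = y" using y(2) unfolding front_def by blast
    have "\<gamma> 0 = \<eta> (t - s)"
    \<comment> \<open>Uniqueness applies only on \<open>{q..s}\<close> with \<open>q > 0\<close>,
      where both curves are characteristics; the Lipschitz bound covers the rest as \<open>q\<close>
      tends to 0.\<close>
    proof (rule eq_of_norm_le_eps_mult)
      fix e :: real assume e: "e > 0"
      define q where "q = min e s"
      have q: "0 < q" "q \<le> s" "q \<le> e" using e st by (auto simp: q_def)
      have "is_char \<gamma> q L" "is_char \<eta> (t - s + q) L"
        using \<gamma>(1) \<eta>(1) q st by (auto simp: ray_def)
      then have 1: "is_char \<gamma> q s" "is_char \<eta> (t - s + q) t"
        using is_char_subset st by auto
      have 2: "is_char (\<lambda>\<tau>. \<eta> (t - s + \<tau>)) q s" using is_char_shift [OF 1(2), of "t - s"] by simp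
      have "\<gamma> q = \<eta> (t - s + q)"
        by (rule char_unique [OF 1(1) 2, of s]) (use q \<gamma> \<eta> in auto)
      moreover have "norm (\<gamma> 0 - \<gamma> q) \<le> \<bar>0 - q\<bar>"
        by (rule rayD [OF \<gamma>(1)]) (use q st in auto)
      moreover have "norm (\<eta> (t - s + q) - \<eta> (t - s)) \<le> \<bar>(t - s + q) - (t - s)\<bar>"
      proof -
        have "t - s + q \<in> {0..L}" "t - s \<in> {0..L}" using q st by auto
        then show ?thesis using \<eta>(1) unfolding ray_def by blast
      qed
      ultimately have "norm ((\<gamma> 0 - \<gamma> q) + (\<eta> (t - s + q) - \<eta> (t - s))) \<le> q + q"
        using q by (intro norm_triangle_mono) auto
      then show "norm (\<gamma> 0 - \<eta> (t - s)) \<le> e * 2" using \<open>\<gamma> q = \<eta> (t - s + q)\<close> q by simp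
    qed
    moreover have "\<kappa> * (t - s) \<le> norm (V (\<eta> (t - s)))"
      using \<eta>(1) st by (auto simp: ray_def)
    ultimately have "\<kappa> * (t - s) \<le> 0" using \<gamma>(2) by simp
    then show False using kappa_pos st by (simp add: mult_le_0_iff)
  qed
  show ?thesis
    unfolding disjoint_family_on_def
  proof (intro ballI impI)
    fix s t assume "s \<in> {0<..<L}" "t \<in> {0<..<L}" "s \<noteq> t"
    then show "front s \<inter> front t = {}" using * [of s t] * [of t s] by (cases "s < t") auto
  qed
qed

theorem negligible_zeros: "negligible {x \<in> ball p\<^sub>0 (\<rho> / 2). V x = 0}"
proof -
  have "countable {t \<in> {0<..<L}. \<not> negligible (front t)}"
  proof (rule countable_positive_measure_disjoint [OF fronts_disjoint, of "cball p\<^sub>0 \<rho>"])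
    show sub: "front t \<subseteq> cball p\<^sub>0 \<rho>" if "t \<in> {0<..<L}" for t
      using front_bounded [of t] that rho by auto
    show "front t \<in> lmeasurable" if "t \<in> {0<..<L}" for t
      using front_closed [of t] bounded_subset [OF bounded_cball sub [OF that]] that
      by (intro lmeasurable_compact) (auto simp: compact_eq_bounded_closed)
  qed auto
  moreover have "uncountable {0<..<L}" using uncountable_open_interval L by blast
  ultimately obtain t where t: "t \<in> {0<..<L}" and neg: "negligible (front t)"
    by (metis (mono_tags, lifting) countable_subset mem_Collect_eq subsetI)
  have tL: "t \<in> {0<..L}" using t by auto
  have "\<forall>y\<in>front t. \<exists>\<gamma>. ray \<gamma> \<and> V (\<gamma> 0) = 0 \<and> \<gamma> t = y" unfolding front_def by blast
  then obtain g where g: "\<And>y. y \<in> front t \<Longrightarrow> ray (g y) \<and> V (g y 0) = 0 \<and> g y t = y" by metis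
  define f where "f = (\<lambda>y. g y 0)"
  have "negligible (f ` front t)"
  proof (rule negligible_locally_Lipschitz_image [OF _ neg])
    fix x assume x: "x \<in> front t"
    note gx = g [OF x]
    \<comment> \<open>Restarting at \<open>t / 2\<close> puts \<open>x\<close> strictly inside a
      characteristic, with past \<open>t / 2\<close> and future \<open>L - t\<close>, as
      \<open>T_locally_lipschitz\<close> requires.\<close>
    have char: "is_char (g x) (t / 2) L" using gx t by (auto simp: ray_def)
    from is_char_shift [OF this, of "t / 2"] have "is_char (\<lambda>\<tau>. g x (t / 2 + \<tau>)) 0 (L - t / 2)" by simp
    then obtain \<eta> B where \<eta>: "\<eta> > 0" "B \<ge> 0"
      "\<And>y. norm (y - g x (t / 2 + t / 2)) < \<eta> \<Longrightarrow> norm (T y - T (g x (t / 2 + t / 2))) \<le> B * norm (y - g x (t / 2 + t / 2))"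
      by (rule T_locally_lipschitz [where t = "t / 2"]) (use t L in auto)
    have lip: "norm (T y - T x) \<le> B * norm (y - x)" if "norm (y - x) < \<eta>" for y
      using \<eta>(3) [of y] gx that by simp
    define C where "C = sqrt ((1 + B\<^sup>2) * exp (1 + M))"
    show "\<exists>U C. open U \<and> x \<in> U \<and> (\<forall>y\<in>front t \<inter> U. norm (f y - f x) \<le> C * norm (y - x))"
    proof (intro exI [of _ "ball x \<eta>"] exI [of _ C] conjI ballI)
      fix y assume y: "y \<in> front t \<inter> ball x \<eta>"
      then have gy: "ray (g y)" "g y t = y" using g by auto
      have "norm (f y - f x) \<le> sqrt (((norm (y - x))\<^sup>2 + (norm (T y - T x))\<^sup>2) * exp (1 + M))"
        using ray_start_dist [OF gy(1) _ tL, of "g x"] gx gy by (simp add: f_def)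
      also have "\<dots> \<le> sqrt (((norm (y - x))\<^sup>2 + (B * norm (y - x))\<^sup>2) * exp (1 + M))"
        using lip [of y] y
        by (intro real_sqrt_le_mono mult_right_mono add_left_mono power_mono) (auto simp: dist_norm norm_minus_commute)
      also have "((norm (y - x))\<^sup>2 + (B * norm (y - x))\<^sup>2) * exp (1 + M) = ((1 + B\<^sup>2) * exp (1 + M)) * (norm (y - x))\<^sup>2"
        by (simp add: power_mult_distrib algebra_simps)
      also have "sqrt \<dots> = C * norm (y - x)" by (simp add: C_def real_sqrt_mult)
      finally show "norm (f y - f x) \<le> C * norm (y - x)" .
    qed (use \<eta> in auto)
  qed simp
  moreover have "{x \<in> ball p\<^sub>0 (\<rho> / 2). V x = 0} \<subseteq> f ` front t"
  proof
    fix x assume x: "x \<in> {x \<in> ball p\<^sub>0 (\<rho> / 2). V x = 0}"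
    then obtain \<gamma> where \<gamma>: "ray \<gamma>" "\<gamma> 0 = x" using ray_from_singular by blast
    then have y: "\<gamma> t \<in> front t" using x unfolding front_def by blast
    \<comment> \<open>The chosen ray \<open>g (\<gamma> t)\<close> may differ from
      \<open>\<gamma>\<close>, but both pass through the same point at time \<open>t\<close> and so
      have the same start.\<close>
    have "norm (g (\<gamma> t) 0 - \<gamma> 0) \<le> 0"
      using ray_start_dist [OF _ \<gamma>(1) tL, of "g (\<gamma> t)"] g [OF y] by simp
    then have "f (\<gamma> t) = x" using \<gamma>(2) by (simp add: f_def)
    then show "x \<in> f ` front t" using y by blast
  qed
  ultimately show ?thesis by (rule negligible_subset)
qed

end

section \<open>Bump functions and mollification\<close>

text \<open>For \<open>p = 1\<close> the standard flat function. The polynomial factor in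
  \<open>1/x\<close> makes the family closed under differentiation, \<open>p\<close> going to
  \<open>X^2 * (p - p')\<close>, so that smoothness is an induction.\<close>

definition smooth_exp :: "real poly \<Rightarrow> real \<Rightarrow> real" where
  "smooth_exp p x = (if 0 < x then poly p (inverse x) * exp (- inverse x) else 0)"

lemma poly_times_exp_tendsto_0: "((\<lambda>y. poly p y * exp (- y)) \<longlongrightarrow> 0) at_top" for p :: "real poly"
proof -
  have "((\<lambda>y. \<Sum>i\<le>degree p. coeff p i * (y ^ i / exp y)) \<longlongrightarrow> (\<Sum>i\<le>degree p. coeff p i * 0)) at_top"
    by (intro tendsto_sum tendsto_mult_left tendsto_power_div_exp_0)
  then show ?thesis
    by (simp add: poly_altdef sum_distrib_right exp_minus divide_inverse mult.assoc)
qed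

lemma smooth_exp_deriv:
  "(smooth_exp p has_real_derivative smooth_exp ([:0, 0, 1:] * (p - pderiv p)) x) (at x)"
proof -
  consider "x > 0" | "x < 0" | "x = 0" by linarith
  then show ?thesis
  proof cases
    case 1
    have "((\<lambda>x. poly p (inverse x) * exp (- inverse x)) has_real_derivative
        smooth_exp ([:0, 0, 1:] * (p - pderiv p)) x) (at x)"
      using 1 by (auto intro!: derivative_eq_intros simp: smooth_exp_def power2_eq_square algebra_simps)
    then show ?thesis
      by (rule has_field_derivative_transform_within_open [of _ _ _ "{0<..}"]) (use 1 in \<open>auto simp: smooth_exp_def\<close>)
  next
    case 2
    have "((\<lambda>x. 0) has_real_derivative smooth_exp ([:0, 0, 1:] * (p - pderiv p)) x) (at x)"
      using 2 by (simp add: smooth_exp_def)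
    then show ?thesis
      by (rule has_field_derivative_transform_within_open [of _ _ _ "{..<0}"]) (use 2 in \<open>auto simp: smooth_exp_def\<close>)
  next
    case 3
    \<comment> \<open>The difference quotient at 0 contains a further factor \<open>1/h\<close>,
      which \<open>pCons 0 p\<close> puts into the polynomial.\<close>
    have "((\<lambda>h. poly (pCons 0 p) (inverse h) * exp (- inverse h)) \<longlongrightarrow> 0) (at_right 0)"
      by (rule filterlim_compose [OF poly_times_exp_tendsto_0 filterlim_inverse_at_top_right])
    then have "((\<lambda>h. smooth_exp p h / h) \<longlongrightarrow> 0) (at_right 0)"
      by (rule Lim_transform_eventually)
        (auto simp: eventually_at_right_field smooth_exp_def divide_inverse intro!: exI [of _ 1])
    moreover have "((\<lambda>h. smooth_exp p h / h) \<longlongrightarrow> 0) (at_left 0)"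
      by (rule Lim_transform_eventually [OF tendsto_const])
        (auto simp: eventually_at_left_field smooth_exp_def intro!: exI [of _ "-1"])
    ultimately have "((\<lambda>h. smooth_exp p h / h) \<longlongrightarrow> 0) (at 0)"
      by (simp add: filterlim_at_split)
    then show ?thesis using 3 by (simp add: DERIV_def smooth_exp_def)
  qed
qed

lemma Ck_on_UNIV_SucI:
  assumes "\<And>x. (f has_derivative D x) (at x)" "\<And>v. Ck_on k UNIV (\<lambda>x. D x v)"
  shows "Ck_on (Suc k) UNIV f"
proof -
  have "frechet_derivative f (at x) = D x" for x
    using frechet_derivative_at [OF assms(1)] by simp
  then show ?thesis using assms by (auto simp: differentiable_def)
qed

lemma Ck_on_Suc_frechet:
  assumes "Ck_on (Suc k) UNIV f"
  shows "(f has_derivative frechet_derivative f (at x)) (at x)" "Ck_on k UNIV (\<lambda>x. frechet_derivative f (at x) v)"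
  using assms frechet_derivative_works by auto

lemma Ck_on_UNIV_SucD: "Ck_on (Suc k) UNIV f \<Longrightarrow> Ck_on k UNIV f"
proof (induction k arbitrary: f)
  case 0
  then show ?case
    by (auto intro!: continuous_at_imp_continuous_on differentiable_imp_continuous_within)
next
  case (Suc k)
  show ?case
    by (rule Ck_on_UNIV_SucI [OF Ck_on_Suc_frechet(1) [OF Suc.prems]])
      (rule Suc.IH, rule Ck_on_Suc_frechet(2) [OF Suc.prems])
qed

lemma Ck_on_UNIV_add:
  "Ck_on k UNIV f \<Longrightarrow> Ck_on k UNIV g \<Longrightarrow> Ck_on k UNIV (\<lambda>x. f x + g x)"
proof (induction k arbitrary: f g)
  case 0
  then show ?case by (simp add: continuous_on_add)
next
  case (Suc k)
  show ?case
  proof (rule Ck_on_UNIV_SucI)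
    show "((\<lambda>x. f x + g x) has_derivative
        (\<lambda>v. frechet_derivative f (at x) v + frechet_derivative g (at x) v)) (at x)" for x
      by (rule has_derivative_add [OF Ck_on_Suc_frechet(1) [OF Suc.prems(1)] Ck_on_Suc_frechet(1) [OF Suc.prems(2)]])
    show "Ck_on k UNIV (\<lambda>x. frechet_derivative f (at x) v + frechet_derivative g (at x) v)" for v
      by (rule Suc.IH [OF Ck_on_Suc_frechet(2) [OF Suc.prems(1)] Ck_on_Suc_frechet(2) [OF Suc.prems(2)]])
  qed
qed

lemma Ck_on_UNIV_mult:
  fixes f g :: "'a::real_normed_vector \<Rightarrow> real"
  shows "Ck_on k UNIV f \<Longrightarrow> Ck_on k UNIV g \<Longrightarrow> Ck_on k UNIV (\<lambda>x. f x * g x)"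
proof (induction k arbitrary: f g)
  case 0
  then show ?case by (simp add: continuous_on_mult)
next
  case (Suc k)
  show ?case
  proof (rule Ck_on_UNIV_SucI)
    show "((\<lambda>x. f x * g x) has_derivative
        (\<lambda>v. f x * frechet_derivative g (at x) v + frechet_derivative f (at x) v * g x)) (at x)" for x
      by (rule has_derivative_mult [OF Ck_on_Suc_frechet(1) [OF Suc.prems(1)] Ck_on_Suc_frechet(1) [OF Suc.prems(2)]])
    show "Ck_on k UNIV (\<lambda>x. f x * frechet_derivative g (at x) v + frechet_derivative f (at x) v * g x)" for v
      by (intro Ck_on_UNIV_add Suc.IH Ck_on_UNIV_SucD [OF Suc.prems(1)] Ck_on_UNIV_SucD [OF Suc.prems(2)]
          Ck_on_Suc_frechet(2) [OF Suc.prems(1)] Ck_on_Suc_frechet(2) [OF Suc.prems(2)])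
  qed
qed

text \<open>The directional derivative along \<open>v\<close> is a member of the same family, with
  coefficient \<open>a * l v\<close>; this is why the induction runs over all \<open>a\<close> and
  \<open>p\<close>.\<close>

lemma Ck_on_smooth_exp_affine:
  fixes l :: "'a::real_normed_vector \<Rightarrow> real"
  assumes l: "bounded_linear l"
  shows "Ck_on k UNIV (\<lambda>z. a * smooth_exp p (l z + c))"
proof (induction k arbitrary: a p)
  have der: "((\<lambda>z. a * smooth_exp p (l z + c)) has_derivative
      (\<lambda>v. (a * l v) * smooth_exp ([:0, 0, 1:] * (p - pderiv p)) (l x + c))) (at x)" for a p x
  proof -
    have 1: "((\<lambda>z. l z + c) has_derivative l) (at x)"
      using has_derivative_add [OF bounded_linear_imp_has_derivative [OF l] has_derivative_const] by simp
    have "((\<lambda>z. smooth_exp p (l z + c)) has_derivative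
        (\<lambda>v. smooth_exp ([:0, 0, 1:] * (p - pderiv p)) (l x + c) * l v)) (at x)"
      using has_derivative_compose [OF 1, of "smooth_exp p"] smooth_exp_deriv
      unfolding has_field_derivative_def by blast
    from has_derivative_mult_right [OF this, of a] show ?thesis by (simp add: mult_ac)
  qed
  case 0
  show ?case
    using der by (auto intro!: continuous_at_imp_continuous_on intro: has_derivative_continuous)
  case (Suc k)
  show ?case
    by (rule Ck_on_UNIV_SucI [OF der]) (rule Suc.IH)
qed

lemma Ck_on_smooth_exp:
  assumes "bounded_linear l" "\<And>z. f z = l z + c"
  shows "Ck_on k UNIV (\<lambda>z. smooth_exp p (f z))"
  using Ck_on_smooth_exp_affine [OF assms(1), of k 1 p c] assms(2) by simp

text \<open>A product of one-dimensional bumps: it is even, and its support is a coordinate square,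
  so convolutions with it are integrals over a \<open>cbox\<close>.\<close>

definition bump :: "real \<Rightarrow> real^2 \<Rightarrow> real" where
  "bump \<eta> z = (smooth_exp 1 (\<eta> - z $ 1) * smooth_exp 1 (\<eta> + z $ 1)) *
     (smooth_exp 1 (\<eta> - z $ 2) * smooth_exp 1 (\<eta> + z $ 2))"

lemma smooth_exp_1_nonneg: "0 \<le> smooth_exp 1 x"
  by (simp add: smooth_exp_def)

lemma smooth_exp_1_eq_0_iff: "smooth_exp 1 x = 0 \<longleftrightarrow> x \<le> 0"
  by (simp add: smooth_exp_def)

lemma bump_nonneg: "0 \<le> bump \<eta> z"
  unfolding bump_def by (intro mult_nonneg_nonneg smooth_exp_1_nonneg)

lemma bump_minus: "bump \<eta> (- z) = bump \<eta> z"
  by (simp add: bump_def mult_ac)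

abbreviation square :: "real \<Rightarrow> real^2 \<Rightarrow> (real^2) set" where
  "square \<eta> x \<equiv> cbox (x - (\<chi> i. \<eta>)) (x + (\<chi> i. \<eta>))"

lemma mem_square: "t \<in> square \<eta> x \<longleftrightarrow> \<bar>x $ 1 - t $ 1\<bar> \<le> \<eta> \<and> \<bar>x $ 2 - t $ 2\<bar> \<le> \<eta>"
  by (auto simp: mem_box_cart forall_2 abs_le_iff)

lemma bump_zero_outside: "bump \<eta> (x - t) \<noteq> 0 \<Longrightarrow> t \<in> square \<eta> x"
  unfolding mem_square by (auto simp: bump_def smooth_exp_1_eq_0_iff)

lemma bump_pos_0: "\<eta> > 0 \<Longrightarrow> bump \<eta> 0 > 0"
  by (simp add: bump_def smooth_exp_def)

lemma Ck_on_bump: "Ck_on k UNIV (bump \<eta>)"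
  unfolding bump_def [abs_def]
  by (intro Ck_on_UNIV_mult;
      (rule Ck_on_smooth_exp [of "\<lambda>z::real^2. - (z $ 1)" _ \<eta>] Ck_on_smooth_exp [of "\<lambda>z::real^2. z $ 1" _ \<eta>]
       Ck_on_smooth_exp [of "\<lambda>z::real^2. - (z $ 2)" _ \<eta>] Ck_on_smooth_exp [of "\<lambda>z::real^2. z $ 2" _ \<eta>]);
      simp add: bounded_linear_minus bounded_linear_vec_nth)

lemma Ck_on_bump_reflect: "Ck_on k UNIV (\<lambda>t. bump \<eta> (x - t))"
  unfolding bump_def
  by (intro Ck_on_UNIV_mult;
      (rule Ck_on_smooth_exp [of "\<lambda>z::real^2. z $ 1" _ "\<eta> - x $ 1"] Ck_on_smooth_exp [of "\<lambda>z::real^2. - (z $ 1)" _ "\<eta> + x $ 1"]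
       Ck_on_smooth_exp [of "\<lambda>z::real^2. z $ 2" _ "\<eta> - x $ 2"] Ck_on_smooth_exp [of "\<lambda>z::real^2. - (z $ 2)" _ "\<eta> + x $ 2"]);
      simp add: bounded_linear_minus bounded_linear_vec_nth)

section \<open>Gradients, and bumps as test functions\<close>

lemma gradient_inner:
  fixes f :: "real^2 \<Rightarrow> real"
  assumes "(f has_derivative D) (at x)"
  shows "gradient f x \<bullet> v = D v"
proof -
  have "frechet_derivative f (at x) = D" using frechet_derivative_at [OF assms] by simp
  then have "gradient f x $ i = D (axis i 1)" for i by (simp add: gradient_def partial_deriv_def)
  then have "gradient f x \<bullet> v = v $ 1 *\<^sub>R D (axis 1 1) + v $ 2 *\<^sub>R D (axis 2 1)"
    by (simp add: inner_2)
  also have "\<dots> = D v"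
    by (rule linear_vec2_expand [symmetric]) (rule has_derivative_linear [OF assms])
  finally show ?thesis .
qed

lemma gradient_unique:
  fixes f :: "real^2 \<Rightarrow> real"
  assumes "(f has_derivative (\<lambda>v. g \<bullet> v)) (at x)"
  shows "gradient f x = g"
  using gradient_inner [OF assms] by (metis vector_eq_rdot)

lemma has_derivative_gradient:
  fixes f :: "real^2 \<Rightarrow> real"
  assumes "f differentiable (at x)"
  shows "(f has_derivative (\<lambda>v. gradient f x \<bullet> v)) (at x)"
proof -
  obtain D where D: "(f has_derivative D) (at x)" using assms differentiable_def by blast
  then have "D = (\<lambda>v. gradient f x \<bullet> v)" using gradient_inner [OF D] by auto
  then show ?thesis using D by simp
qed

lemma continuous_on_gradient:
  fixes f :: "real^2 \<Rightarrow> real"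
  assumes "Ck_on 1 S f"
  shows "continuous_on S (gradient f)"
  using assms unfolding gradient_def [abs_def] partial_deriv_def
  by (auto intro!: continuous_on_vec_lambda)

lemma bump_has_derivative: "(bump \<eta> has_derivative (\<lambda>v. gradient (bump \<eta>) x \<bullet> v)) (at x)"
  using Ck_on_bump [of 1 \<eta>] by (intro has_derivative_gradient) simp

lemma bump_gradient_continuous: "continuous_on UNIV (gradient (bump \<eta>))"
  by (rule continuous_on_gradient) (rule Ck_on_bump)

lemma bump_continuous: "continuous_on UNIV (bump \<eta>)"
  using Ck_on_bump [of 0 \<eta>] by simp

lemma gradient_bump_reflect: "gradient (\<lambda>t. bump \<eta> (x - t)) t = - gradient (bump \<eta>) (x - t)"
proof (rule gradient_unique)
  have "((\<lambda>t. x - t) has_derivative (\<lambda>v. - v)) (at t)" by (auto intro!: derivative_eq_intros)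
  from has_derivative_compose [OF this bump_has_derivative]
  show "((\<lambda>t. bump \<eta> (x - t)) has_derivative (\<lambda>v. - gradient (bump \<eta>) (x - t) \<bullet> v)) (at t)" by simp
qed

lemma gradient_zero_outside:
  fixes f :: "real^2 \<Rightarrow> real"
  assumes "closed C" "\<And>t. t \<notin> C \<Longrightarrow> f t = 0" "t \<notin> C"
  shows "gradient f t = 0"
proof (rule gradient_unique)
  have "((\<lambda>_. 0) has_derivative (\<lambda>v. 0 \<bullet> v)) (at t)" by simp
  then show "(f has_derivative (\<lambda>v. 0 \<bullet> v)) (at t)"
    by (rule has_derivative_transform_within_open [of _ _ _ _ "- C"]) (use assms in auto)
qed

lemma test_function_bump:
  assumes "square \<eta> x \<subseteq> \<Omega>"
  shows "test_function_on \<Omega> (\<lambda>t. a * bump \<eta> (x - t))"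
proof -
  have const: "Ck_on k UNIV (\<lambda>_::real^2. a)" for k
  proof -
    \<comment> \<open>The constant \<open>a\<close> is exhibited as a member of the smooth family
      with \<open>l = 0\<close>.\<close>
    have "Ck_on k UNIV (\<lambda>z::real^2. a / smooth_exp 1 1 * smooth_exp 1 (0 + 1))"
      by (rule Ck_on_smooth_exp_affine [of "\<lambda>_. 0"]) simp
    then show ?thesis by (simp add: smooth_exp_1_eq_0_iff)
  qed
  have sub: "closure {t. a * bump \<eta> (x - t) \<noteq> 0} \<subseteq> square \<eta> x"
    by (rule closure_minimal) (use bump_zero_outside in \<open>auto simp: closed_cbox\<close>)
  have "compact (closure {t. a * bump \<eta> (x - t) \<noteq> 0})"
    using compact_Int_closed [OF compact_cbox closed_closure] sub by (metis inf.absorb2)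
  then show ?thesis
    unfolding test_function_on_def using sub assms Ck_on_UNIV_mult [OF const Ck_on_bump_reflect] by blast
qed

section \<open>Mollification with the bump\<close>

definition bump_mass :: "real \<Rightarrow> real" where
  "bump_mass \<eta> = integral (square \<eta> 0) (bump \<eta>)"

lemma bump_mass_translate:
  "((\<lambda>t. bump \<eta> (x - t)) has_integral bump_mass \<eta>) (square \<eta> x)"
proof -
  have "(bump \<eta> has_integral bump_mass \<eta>) (square \<eta> 0)"
    unfolding bump_mass_def
    by (intro integrable_integral integrable_continuous continuous_on_subset [OF bump_continuous]) auto
  from has_integral_shift_cbox [OF this, of "- x"]
  have "((\<lambda>t. bump \<eta> (t - x)) has_integral bump_mass \<eta>) (square \<eta> x)"
    by (simp add: algebra_simps)
  moreover have "bump \<eta> (t - x) = bump \<eta> (x - t)" for t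
    using bump_minus [of \<eta> "x - t"] by simp
  ultimately show ?thesis by simp
qed

lemma bump_mass_pos:
  assumes "\<eta> > 0"
  shows "bump_mass \<eta> > 0"
proof -
  have int: "(bump \<eta> has_integral bump_mass \<eta>) (square \<eta> 0)"
    unfolding bump_mass_def
    by (intro integrable_integral integrable_continuous continuous_on_subset [OF bump_continuous]) auto
  have "bump_mass \<eta> \<ge> 0"
    by (rule has_integral_nonneg [OF int]) (rule bump_nonneg)
  moreover have "bump_mass \<eta> \<noteq> 0"
  proof
    assume "bump_mass \<eta> = 0"
    then have "bump \<eta> 0 = 0"
    proof (intro has_integral_0_cbox_imp_0 [where f = "bump \<eta>"])
      show "continuous_on (square \<eta> 0) (bump \<eta>)" by (rule continuous_on_subset [OF bump_continuous]) simp
      show "(bump \<eta> has_integral 0) (square \<eta> 0)" using int \<open>bump_mass \<eta> = 0\<close> by simp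
      show "box (0 - (\<chi> i. \<eta>)) (0 + (\<chi> i. \<eta>)) \<noteq> ({} :: (real^2) set)"
        using assms by (auto simp: box_ne_empty Basis_vec_def inner_axis)
      show "0 \<in> square \<eta> 0" unfolding mem_square using assms by simp
    qed (rule bump_nonneg)
    then show False using bump_pos_0 [OF assms] by simp
  qed
  ultimately show ?thesis by simp
qed

text \<open>The quotient is a weighted mean of \<open>f\<close> over the square, with nonnegative
  weights of total mass one.\<close>

lemma mollify_close:
  fixes f :: "real^2 \<Rightarrow> real"
  assumes \<eta>: "\<eta> > 0" and f: "continuous_on (square \<eta> x) f"
    and close: "\<And>t. t \<in> square \<eta> x \<Longrightarrow> \<bar>f t - f x\<bar> \<le> \<omega>"
  shows "\<bar>integral (square \<eta> x) (\<lambda>t. bump \<eta> (x - t) * f t) / bump_mass \<eta> - f x\<bar> \<le> \<omega>"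
proof -
  let ?Q = "square \<eta> x" and ?c = "bump_mass \<eta>"
  have c: "?c > 0" by (rule bump_mass_pos [OF \<eta>])
  have cb: "continuous_on ?Q (\<lambda>t. bump \<eta> (x - t))"
    by (intro continuous_on_compose2 [OF bump_continuous] continuous_intros) auto
  have i1: "((\<lambda>t. bump \<eta> (x - t) * f t) has_integral integral ?Q (\<lambda>t. bump \<eta> (x - t) * f t)) ?Q"
    by (intro integrable_integral integrable_continuous continuous_intros cb f)
  have i2: "((\<lambda>t. bump \<eta> (x - t) * f x) has_integral ?c * f x) ?Q"
    by (rule has_integral_mult_left [OF bump_mass_translate])
  have i3: "((\<lambda>t. bump \<eta> (x - t) * \<omega>) has_integral ?c * \<omega>) ?Q"
    by (rule has_integral_mult_left [OF bump_mass_translate])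
  have d: "((\<lambda>t. bump \<eta> (x - t) * f t - bump \<eta> (x - t) * f x) has_integral
      (integral ?Q (\<lambda>t. bump \<eta> (x - t) * f t) - ?c * f x)) ?Q"
    by (rule has_integral_diff [OF i1 i2])
  have le: "\<bar>bump \<eta> (x - t) * f t - bump \<eta> (x - t) * f x\<bar> \<le> bump \<eta> (x - t) * \<omega>" if "t \<in> ?Q" for t
  proof -
    have "\<bar>bump \<eta> (x - t) * f t - bump \<eta> (x - t) * f x\<bar> = bump \<eta> (x - t) * \<bar>f t - f x\<bar>"
      using bump_nonneg [of \<eta> "x - t"] by (simp add: abs_mult right_diff_distrib [symmetric])
    also have "\<dots> \<le> bump \<eta> (x - t) * \<omega>"
      by (rule mult_left_mono [OF close [OF that] bump_nonneg])
    finally show ?thesis .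
  qed
  have "integral ?Q (\<lambda>t. bump \<eta> (x - t) * f t) - ?c * f x \<le> ?c * \<omega>"
    by (rule has_integral_le [OF d i3]) (use le in \<open>auto simp: abs_le_iff\<close>)
  moreover have "- (?c * \<omega>) \<le> integral ?Q (\<lambda>t. bump \<eta> (x - t) * f t) - ?c * f x"
  proof (rule has_integral_le [OF has_integral_neg [OF i3] d])
    show "- (bump \<eta> (x - t) * \<omega>) \<le> bump \<eta> (x - t) * f t - bump \<eta> (x - t) * f x" if "t \<in> ?Q" for t
      using le [OF that] by linarith
  qed
  ultimately have "\<bar>integral ?Q (\<lambda>t. bump \<eta> (x - t) * f t) - ?c * f x\<bar> \<le> ?c * \<omega>" by linarith
  moreover have "integral ?Q (\<lambda>t. bump \<eta> (x - t) * f t) / ?c - f x = (integral ?Q (\<lambda>t. bump \<eta> (x - t) * f t) - ?c * f x) / ?c"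
    using c by (simp add: field_simps)
  ultimately show ?thesis using c by (simp add: abs_divide divide_le_eq mult.commute)
qed

text \<open>All derivatives fall on the bump, so \<open>f\<close> may be merely continuous. The
  domain of integration is a fixed box, not the square around \<open>x\<close>, because the Leibniz
  rule differentiates only the integrand.\<close>

lemma mollify_derivative:
  fixes f :: "real^2 \<Rightarrow> real"
  assumes f: "continuous_on UNIV f"
  shows "((\<lambda>x. integral (cbox a b) (\<lambda>t. bump \<eta> (x - t) * f t)) has_derivative
      (\<lambda>v. integral (cbox a b) (\<lambda>t. (gradient (bump \<eta>) (x - t) \<bullet> v) * f t))) (at x)"
    and "continuous_on UNIV (\<lambda>x. integral (cbox a b) (\<lambda>t. (gradient (bump \<eta>) (x - t) \<bullet> v) * f t))"
proof -
  let ?fx = "\<lambda>x t. f t *\<^sub>R blinfun_inner_right (gradient (bump \<eta>) (x - t))"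
  have cg: "continuous_on S (\<lambda>p. gradient (bump \<eta>) (fst p - snd p))" for S :: "((real^2) \<times> (real^2)) set"
    by (intro continuous_on_compose2 [OF bump_gradient_continuous] continuous_intros) auto
  have cf: "continuous_on S (\<lambda>p. f (snd p))" for S :: "((real^2) \<times> (real^2)) set"
    by (intro continuous_on_compose2 [OF f] continuous_intros) auto
  have cfx: "continuous_on (UNIV \<times> cbox a b) (\<lambda>(x, t). ?fx x t)"
    unfolding case_prod_unfold
    by (intro continuous_intros cf bounded_linear.continuous_on [OF bounded_linear_blinfun_inner_right] cg)
  have der: "((\<lambda>x. bump \<eta> (x - t) * f t) has_derivative blinfun_apply (?fx x t)) (at x)" for x t
  proof -
    have "((\<lambda>x. x - t) has_derivative (\<lambda>v. v)) (at x)" by (auto intro!: derivative_eq_intros)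
    from has_derivative_compose [OF this bump_has_derivative]
    have "((\<lambda>x. bump \<eta> (x - t)) has_derivative (\<lambda>v. gradient (bump \<eta>) (x - t) \<bullet> v)) (at x)" .
    from has_derivative_mult_left [OF this, of "f t"]
    have "((\<lambda>x. bump \<eta> (x - t) * f t) has_derivative (\<lambda>v. gradient (bump \<eta>) (x - t) \<bullet> v * f t)) (at x)" .
    moreover have "blinfun_apply (?fx x t) = (\<lambda>v. gradient (bump \<eta>) (x - t) \<bullet> v * f t)"
      by (rule ext) (simp add: blinfun.scaleR_left mult.commute)
    ultimately show ?thesis by simp
  qed
  have L: "((\<lambda>x. integral (cbox a b) (\<lambda>t. bump \<eta> (x - t) * f t)) has_derivative
      blinfun_apply (integral (cbox a b) (?fx x))) (at x within UNIV)"
  proof (rule leibniz_rule [OF _ _ cfx])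
    show "(\<lambda>t. bump \<eta> (x - t) * f t) integrable_on cbox a b" for x
      by (intro integrable_continuous continuous_intros continuous_on_subset [OF f]
          continuous_on_compose2 [OF bump_continuous]) auto
  qed (use der in auto)
  have int: "?fx x integrable_on cbox a b" for x
  proof (rule integrable_continuous)
    have "continuous_on (cbox a b) (\<lambda>t. (case (x, t) of (x, t) \<Rightarrow> ?fx x t))"
      by (rule continuous_on_compose2 [OF cfx]) (auto intro!: continuous_intros)
    then show "continuous_on (cbox a b) (?fx x)" by simp
  qed
  have "blinfun_apply (integral (cbox a b) (?fx x)) v =
      integral (cbox a b) (\<lambda>t. (gradient (bump \<eta>) (x - t) \<bullet> v) * f t)" for v
    using blinfun_apply_integral [OF int, of x v] by (simp add: blinfun.bilinear_simps mult.commute)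
  then have "blinfun_apply (integral (cbox a b) (?fx x)) =
      (\<lambda>v. integral (cbox a b) (\<lambda>t. (gradient (bump \<eta>) (x - t) \<bullet> v) * f t))" by auto
  then show "((\<lambda>x. integral (cbox a b) (\<lambda>t. bump \<eta> (x - t) * f t)) has_derivative
      (\<lambda>v. integral (cbox a b) (\<lambda>t. (gradient (bump \<eta>) (x - t) \<bullet> v) * f t))) (at x)"
    using L by simp
  show "continuous_on UNIV (\<lambda>x. integral (cbox a b) (\<lambda>t. (gradient (bump \<eta>) (x - t) \<bullet> v) * f t))"
    by (rule integral_continuous_on_param) (simp add: case_prod_unfold, intro continuous_intros cf cg)
qed

section \<open>Weak solutions\<close>

lemma integral_superset:
  fixes f :: "'a::euclidean_space \<Rightarrow> 'b::euclidean_space"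
  assumes "f integrable_on S" "S \<subseteq> T" "\<And>x. x \<notin> S \<Longrightarrow> f x = 0"
  shows "integral T f = integral S f"
  using has_integral_on_superset [OF integrable_integral [OF assms(1)] assms(3,2)] by (simp add: integral_unique)

text \<open>Passes from the Lebesgue integrals of \<open>weak_solution\<close> to gauge integrals
  over the support of the test function, where the integrand may be replaced by a continuous
  \<open>g\<close>.\<close>

lemma set_lborel_integral_restrict:
  fixes f g :: "'a::euclidean_space \<Rightarrow> real"
  assumes "compact B" "B \<subseteq> A" "\<And>x. x \<in> A - B \<Longrightarrow> f x = 0" "\<And>x. x \<in> B \<Longrightarrow> f x = g x" "continuous_on B g"
  shows "(LBINT x:A. f x) = integral B g"
proof -
  have "(LBINT x:A. f x) = (LBINT x:B. g x)"
    unfolding set_lebesgue_integral_def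
    by (rule Bochner_Integration.integral_cong) (use assms(2,3,4) in \<open>auto simp: indicator_def\<close>)
  also have "\<dots> = integral B g"
    by (rule set_borel_integral_eq_integral)
      (use borel_integrable_compact [OF assms(1,5)] in \<open>simp add: set_integrable_def indicator_scaleR_eq_if\<close>)
  finally show ?thesis .
qed

lemma norm_le_sum_2: "norm (x :: real^2) \<le> \<bar>x $ 1\<bar> + \<bar>x $ 2\<bar>"
  using norm_le_l1_cart [of x] by (simp add: sum_2)

text \<open>On its nonsingular set the direction field \<open>sgn V\<close> is the normal rotated by a right angle,
  so the weak equation for the divergence of the normal, tested with translates of a bump
  function, says that the mollified field has the mollified rotation.\<close>

lemma weak_rot_of_weak_solution:
  fixes F V :: "real^2 \<Rightarrow> real^2" and H u k :: "real^2 \<Rightarrow> real"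
  assumes weak: "weak_solution \<Omega> F H u" and ball: "ball p \<rho> \<subseteq> \<Omega>"
    and V: "continuous_on UNIV V" and k: "continuous_on UNIV k"
    and VF: "\<And>x. x \<in> ball p \<rho> \<Longrightarrow> rot90 (V x) = gradient u x + F x"
    and kH: "\<And>x. x \<in> ball p \<rho> \<Longrightarrow> k x = - H x"
  shows "weak_rot {x \<in> ball p \<rho>. V x \<noteq> 0} (\<lambda>x. sgn (V x)) k"
  unfolding weak_rot_def
proof (intro allI impI)
  fix K :: "(real^2) set" and \<epsilon> :: real
  let ?G = "{x \<in> ball p \<rho>. V x \<noteq> 0}"
  assume "compact K \<and> K \<subseteq> ?G \<and> 0 < \<epsilon>"
  then have K: "compact K" "K \<subseteq> ?G" and \<epsilon>: "\<epsilon> > 0" by auto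
  have "open ?G"
  proof -
    have "open {x. V x \<noteq> 0}" by (rule open_Collect_neq) (use V in auto)
    moreover have "?G = ball p \<rho> \<inter> {x. V x \<noteq> 0}" by auto
    ultimately show ?thesis by (metis open_Int open_ball)
  qed
  then obtain e0 where e0: "e0 > 0" "(\<Union>x\<in>K. ball x e0) \<subseteq> ?G"
    using compact_subset_open_imp_ball_epsilon_subset [OF K(1) _ K(2)] by blast
  \<comment> \<open>A compact neighbourhood of \<open>K\<close> inside the nonsingular set, large
    enough to contain the supports of all bumps centred in \<open>K\<close>.\<close>
  define K2 where "K2 = {x + y | x y. x \<in> K \<and> y \<in> cball 0 (e0 / 2)}"
  have K2: "compact K2" unfolding K2_def by (intro compact_sums K(1) compact_cball)
  have K2_mem: "t \<in> K2" if "x \<in> K" "norm (t - x) \<le> e0 / 2" for x t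
    unfolding K2_def using that by (intro CollectI exI [of _ x] exI [of _ "t - x"]) auto
  have K2_G: "K2 \<subseteq> ?G"
  proof
    fix t assume "t \<in> K2"
    then obtain x y where "x \<in> K" "norm y \<le> e0 / 2" "t = x + y" by (auto simp: K2_def)
    then have "x \<in> K" "t \<in> ball x e0" using e0 by (auto simp: dist_norm)
    then show "t \<in> ?G" using e0 by blast
  qed
  obtain \<delta> where \<delta>: "\<delta> > 0" "\<And>x. x \<in> K2 \<Longrightarrow> \<delta> \<le> norm (V x)"
  proof (cases "K2 = {}")
    case True
    then show ?thesis using that [of 1] by auto
  next
    case False
    have "continuous_on K2 (\<lambda>x. norm (V x))" by (intro continuous_intros continuous_on_subset [OF V]) auto
    from continuous_attains_inf [OF K2 False this] obtain x where
      "x \<in> K2" "\<And>y. y \<in> K2 \<Longrightarrow> norm (V x) \<le> norm (V y)" by blast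
    then show ?thesis using that [of "norm (V x)"] K2_G by auto
  qed
  \<comment> \<open>Globally continuous, and equal to \<open>sgn (V x)\<close> on \<open>K2\<close>,
    hence on the support of every bump used; mollification over the fixed box \<open>Q\<close> needs
    a field without singularities.\<close>
  define T where "T = (\<lambda>x. V x /\<^sub>R max \<delta> (norm (V x)))"
  have cT: "continuous_on S T" for S
    unfolding T_def using \<delta> by (intro continuous_intros continuous_on_subset [OF V]) (auto simp: max_def)
  have cTi: "continuous_on S (\<lambda>x. T x $ i)" for S i by (intro continuous_intros cT)
  have T: "T x = sgn (V x)" if "x \<in> K2" for x
    using \<delta>(2) [OF that] by (simp add: T_def sgn_div_norm max_def)
  have "uniformly_continuous_on K2 T" "uniformly_continuous_on K2 k"
    by (rule compact_uniformly_continuous [OF _ K2], rule cT)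
      (rule compact_uniformly_continuous [OF continuous_on_subset [OF k] K2], simp)
  then obtain d1 d2 where d1: "d1 > 0" "\<And>x t. x \<in> K2 \<Longrightarrow> t \<in> K2 \<Longrightarrow> dist t x < d1 \<Longrightarrow> dist (T t) (T x) < \<epsilon> / 2"
    and d2: "d2 > 0" "\<And>x t. x \<in> K2 \<Longrightarrow> t \<in> K2 \<Longrightarrow> dist t x < d2 \<Longrightarrow> dist (k t) (k x) < \<epsilon>"
    unfolding uniformly_continuous_on_def using \<epsilon> by (metis half_gt_zero)
  \<comment> \<open>The factor 1/4 leaves room for the distance \<open>2 * \<eta>\<close>, which
    bounds how far a point of the square of half-side \<open>\<eta>\<close> lies from its
    centre.\<close>
  define \<eta> where "\<eta> = min (e0 / 2) (min d1 d2) / 4"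
  have \<eta>: "\<eta> > 0" "2 * \<eta> \<le> e0 / 2" "2 * \<eta> < d1" "2 * \<eta> < d2"
    using e0 d1 d2 by (auto simp: \<eta>_def)
  have sq: "t \<in> K2" "norm (t - x) \<le> 2 * \<eta>" if "x \<in> K" "t \<in> square \<eta> x" for x t
  proof -
    show "norm (t - x) \<le> 2 * \<eta>"
      using norm_le_sum_2 [of "t - x"] that(2) unfolding mem_square by (simp add: abs_minus_commute)
    then have "norm (t - x) \<le> e0 / 2" using \<eta>(2) by linarith
    then show "t \<in> K2" by (rule K2_mem [OF that(1)])
  qed
  obtain b where b: "K2 \<subseteq> cbox (- b) b" using bounded_subset_cbox_symmetric [OF compact_imp_bounded [OF K2]] by blast
  define Q where "Q = cbox (- b) b"
  define c where "c = bump_mass \<eta>"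
  have c: "c > 0" unfolding c_def by (rule bump_mass_pos [OF \<eta>(1)])
  define m where "m = (\<lambda>i x. integral Q (\<lambda>t. bump \<eta> (x - t) * T t $ i))"
  define m' where "m' = (\<lambda>i x v. integral Q (\<lambda>t. (gradient (bump \<eta>) (x - t) \<bullet> v) * T t $ i))"
  define A where "A = (\<lambda>x. \<chi> i. m i x / c)"
  define A' where "A' = (\<lambda>x v. \<chi> i. m' i x v / c)"
  have md: "(m i has_derivative m' i x) (at x)" for i x
    unfolding m_def m'_def Q_def by (rule mollify_derivative(1)) (rule cTi)
  have m'c: "continuous_on UNIV (\<lambda>x. m' i x v)" for i v
    unfolding m'_def Q_def by (rule mollify_derivative(2)) (rule cTi)
  have A_der: "(A has_derivative A' x) (at x)" for x
  proof -
    have comp: "((\<lambda>x. m i x / c) has_derivative (\<lambda>v. m' i x v / c)) (at x)" for i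
      by (rule bounded_linear.has_derivative [OF bounded_linear_divide md])
    show ?thesis
    proof (subst has_derivative_componentwise_within, rule ballI)
      fix i :: "real^2" assume "i \<in> Basis"
      then obtain j where i: "i = axis j 1" by (auto simp: Basis_vec_def)
      show "((\<lambda>x. A x \<bullet> i) has_derivative (\<lambda>v. A' x v \<bullet> i)) (at x)"
        using comp [of j] by (simp add: i A_def A'_def inner_axis)
    qed
  qed
  have A'_cont: "continuous_on UNIV (\<lambda>x. A' x v)" for v
    unfolding A'_def using c by (intro continuous_on_vec_lambda continuous_intros m'c) auto
  have gc: "continuous_on S (\<lambda>t. gradient (bump \<eta>) (x - t))" for S x
    by (intro continuous_on_compose2 [OF bump_gradient_continuous] continuous_intros) auto
  have bc: "continuous_on S (\<lambda>t. bump \<eta> (x - t))" for S x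
    by (intro continuous_on_compose2 [OF bump_continuous] continuous_intros) auto
  have g0: "gradient (bump \<eta>) (x - t) = 0" if "t \<notin> square \<eta> x" for x t
  proof -
    have "gradient (\<lambda>t. bump \<eta> (x - t)) t = 0"
      by (rule gradient_zero_outside [of "square \<eta> x"]) (use that bump_zero_outside in auto)
    then show ?thesis by (simp add: gradient_bump_reflect)
  qed
  have b0: "bump \<eta> (x - t) = 0" if "t \<notin> square \<eta> x" for x t
    using bump_zero_outside that by blast
  show "\<exists>A A'. (\<forall>x. (A has_derivative A' x) (at x)) \<and> (\<forall>v. continuous_on UNIV (\<lambda>x. A' x v)) \<and>
      (\<forall>x\<in>K. norm (A x - sgn (V x)) \<le> \<epsilon> \<and> \<bar>rot_of (A' x) - k x\<bar> \<le> \<epsilon>)"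
  proof (intro exI conjI allI ballI)
    show "(A has_derivative A' x) (at x)" for x by (rule A_der)
    show "continuous_on UNIV (\<lambda>x. A' x v)" for v by (rule A'_cont)
    fix x assume x: "x \<in> K"
    have xK2: "x \<in> K2" by (rule K2_mem [OF x]) (use e0 in auto)
    have sqK2: "square \<eta> x \<subseteq> K2" using sq(1) [OF x] by blast
    have sqQ: "square \<eta> x \<subseteq> Q" using sqK2 b by (auto simp: Q_def)
    have comp: "\<bar>m i x / c - T x $ i\<bar> \<le> \<epsilon> / 2" for i
    proof -
      have "m i x = integral (square \<eta> x) (\<lambda>t. bump \<eta> (x - t) * T t $ i)"
        unfolding m_def
        by (rule integral_superset [OF _ sqQ]) (use b0 in \<open>auto intro!: integrable_continuous continuous_intros bc cTi\<close>)
      moreover have "\<bar>T t $ i - T x $ i\<bar> \<le> \<epsilon> / 2" if t: "t \<in> square \<eta> x" for t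
      proof -
        have "dist (T t) (T x) < \<epsilon> / 2"
          by (rule d1(2) [OF xK2 sq(1) [OF x t]]) (use sq(2) [OF x t] \<eta> in \<open>simp add: dist_norm\<close>)
        then show ?thesis using component_le_norm_cart [of "T t - T x" i] by (simp add: dist_norm)
      qed
      ultimately show ?thesis
        unfolding c_def using mollify_close [OF \<eta>(1) cTi, of x i "\<epsilon> / 2"] by simp
    qed
    have "norm (A x - T x) \<le> \<bar>m 1 x / c - T x $ 1\<bar> + \<bar>m 2 x / c - T x $ 2\<bar>"
      using norm_le_sum_2 [of "A x - T x"] by (simp add: A_def)
    also have "\<dots> \<le> \<epsilon>" using comp [of 1] comp [of 2] by linarith
    finally show "norm (A x - sgn (V x)) \<le> \<epsilon>" using T [OF xK2] by simp
    let ?g = "\<lambda>t. gradient (bump \<eta>) (x - t)"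
    have N: "N_field F u t = rot90 (T t)" if "t \<in> square \<eta> x" for t
    proof -
      have "t \<in> K2" using that sqK2 by blast
      then have "t \<in> ball p \<rho>" using K2_G by auto
      then show ?thesis
        using T [OF \<open>t \<in> K2\<close>] unfolding N_field_def VF [symmetric, OF \<open>t \<in> ball p \<rho>\<close>]
        by (simp add: sgn_div_norm rot90_simps)
    qed
    have sq\<Omega>: "square \<eta> x \<subseteq> \<Omega>" using sqK2 K2_G ball by blast
    have sqS: "square \<eta> x \<inter> singular_set \<Omega> F u = {}"
    proof -
      have "gradient u t + F t \<noteq> 0" if t: "t \<in> square \<eta> x" for t
      proof -
        have "t \<in> ball p \<rho>" "V t \<noteq> 0" using t sqK2 K2_G by blast+
        then show ?thesis using VF [of t] by (metis norm_eq_zero norm_rot90)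
      qed
      then show ?thesis by (auto simp: singular_set_def)
    qed
    define I1 where "I1 = integral (square \<eta> x) (\<lambda>t. rot90 (T t) \<bullet> (- ?g t))"
    define I2 where "I2 = integral (square \<eta> x) (\<lambda>t. bump \<eta> (x - t) * k t)"
    \<comment> \<open>The weak inequality is used for positive and negative multiples of one bump.
      As the bump is supported off the singular set, the term with
      \<open>norm (gradient \<phi> t)\<close> vanishes and the rest is linear in \<open>a\<close>,
      which forces \<open>I1 = I2\<close>.\<close>
    have test: "0 \<le> a * (I1 - I2)" for a
    proof -
      define \<phi> where "\<phi> = (\<lambda>t. a * bump \<eta> (x - t))"
      have g\<phi>: "gradient \<phi> t = - (a *\<^sub>R ?g t)" for t
      proof (rule gradient_unique)
        have "((\<lambda>t. x - t) has_derivative (\<lambda>v. - v)) (at t)" by (auto intro!: derivative_eq_intros)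
        from has_derivative_compose [OF this bump_has_derivative]
        have "((\<lambda>t. bump \<eta> (x - t)) has_derivative (\<lambda>v. ?g t \<bullet> - v)) (at t)" .
        from has_derivative_mult_right [OF this, of a]
        show "(\<phi> has_derivative (\<lambda>v. - (a *\<^sub>R ?g t) \<bullet> v)) (at t)" by (simp add: \<phi>_def)
      qed
      have "test_function_on \<Omega> \<phi>" unfolding \<phi>_def by (rule test_function_bump [OF sq\<Omega>])
      then have "0 \<le> (LBINT t:singular_set \<Omega> F u. norm (gradient \<phi> t))
          + (LBINT t:\<Omega> - singular_set \<Omega> F u. N_field F u t \<bullet> gradient \<phi> t)
          + (LBINT t:\<Omega>. H t * \<phi> t)"
        using weak unfolding weak_solution_def by blast
      also have "(LBINT t:singular_set \<Omega> F u. norm (gradient \<phi> t)) = 0"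
      proof -
        have "indicator (singular_set \<Omega> F u) t *\<^sub>R norm (gradient \<phi> t) = 0" for t
          using g0 [of t x] sqS by (cases "t \<in> square \<eta> x") (auto simp: g\<phi> indicator_def)
        then show ?thesis
          unfolding set_lebesgue_integral_def by (simp only: Bochner_Integration.integral_zero)
      qed
      also have "(LBINT t:\<Omega> - singular_set \<Omega> F u. N_field F u t \<bullet> gradient \<phi> t) =
          integral (square \<eta> x) (\<lambda>t. a * (rot90 (T t) \<bullet> (- ?g t)))"
        by (rule set_lborel_integral_restrict)
          (use sq\<Omega> sqS N g0 [of _ x] in \<open>auto simp: g\<phi> intro!: continuous_intros cT gc\<close>)
      also have "\<dots> = a * I1" by (simp add: I1_def)
      also have "(LBINT t:\<Omega>. H t * \<phi> t) = integral (square \<eta> x) (\<lambda>t. - a * (bump \<eta> (x - t) * k t))"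
      proof (rule set_lborel_integral_restrict)
        show "H t * \<phi> t = - a * (bump \<eta> (x - t) * k t)" if t: "t \<in> square \<eta> x" for t
        proof -
          have "t \<in> ball p \<rho>" using t sqK2 K2_G by blast
          then show ?thesis using kH [of t] by (simp add: \<phi>_def)
        qed
      qed (use sq\<Omega> b0 [of _ x] in \<open>auto simp: \<phi>_def intro!: continuous_intros bc continuous_on_subset [OF k]\<close>)
      also have "\<dots> = - a * I2" unfolding I2_def by (rule integral_mult_right)
      finally show ?thesis by (simp add: algebra_simps)
    qed
    have I: "I1 = I2" using test [of 1] test [of "-1"] by simp
    have "rot_of (A' x) = (m' 2 x (axis 1 1) - m' 1 x (axis 2 1)) / c"
      by (simp add: rot_of_def A'_def diff_divide_distrib)
    \<comment> \<open>\<open>I1\<close> is the integral of \<open>rot90 (T t)\<close> against the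
      gradient of the translated bump; in coordinates this is the rotation of the mollified
      \<open>T\<close>, before division by \<open>c\<close>.\<close>
    also have "m' 2 x (axis 1 1) - m' 1 x (axis 2 1) = I1"
    proof -
      have i: "m' i x v = integral (square \<eta> x) (\<lambda>t. (?g t \<bullet> v) * T t $ i)" for i v
        unfolding m'_def
        by (rule integral_superset [OF _ sqQ]) (use g0 [of _ x] in \<open>auto intro!: integrable_continuous continuous_intros gc cTi\<close>)
      have "m' 2 x (axis 1 1) - m' 1 x (axis 2 1) =
          integral (square \<eta> x) (\<lambda>t. (?g t \<bullet> axis 1 1) * T t $ 2 - (?g t \<bullet> axis 2 1) * T t $ 1)"
        unfolding i by (rule integral_diff [symmetric]) (intro integrable_continuous continuous_intros gc cTi)+
      also have "\<dots> = I1"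
        unfolding I1_def by (intro integral_cong) (simp add: inner_2 axis_def mult.commute)
      finally show ?thesis .
    qed
    finally have rot: "rot_of (A' x) = I2 / c" using I by simp
    show "\<bar>rot_of (A' x) - k x\<bar> \<le> \<epsilon>"
      unfolding rot I2_def c_def
    proof (rule mollify_close [OF \<eta>(1) continuous_on_subset [OF k]])
      show "\<bar>k t - k x\<bar> \<le> \<epsilon>" if t: "t \<in> square \<eta> x" for t
        using d2(2) [OF xK2 sq(1) [OF x t]] sq(2) [OF x t] \<eta> by (simp add: dist_norm)
    qed simp
  qed
qed

section \<open>Reduction to a small ball\<close>

lemma Ck_on_1_lipschitz_on_compact_convex:
  fixes H :: "real^2 \<Rightarrow> real"
  assumes H: "Ck_on 1 \<Omega> H" and B: "compact B" "convex B" "B \<subseteq> \<Omega>"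
  shows "\<exists>M\<ge>0. \<forall>x\<in>B. \<forall>y\<in>B. \<bar>H x - H y\<bar> \<le> M * norm (x - y)"
proof -
  have g: "continuous_on B (gradient H)"
    by (rule continuous_on_subset [OF continuous_on_gradient [OF H] B(3)])
  obtain M where M: "0 \<le> M" "\<forall>x\<in>B. norm (gradient H x) \<le> M"
    using continuous_on_compact_norm_bound [OF B(1) g] by blast
  have diff: "H differentiable (at x)" if "x \<in> B" for x
    using H B(3) that by auto
  show ?thesis
  proof (intro exI [of _ M] conjI ballI M(1))
    fix x y assume xy: "x \<in> B" "y \<in> B"
    have "norm (H x - H y) \<le> M * norm (x - y)"
    proof (rule differentiable_bound [OF B(2)])
      show "(H has_derivative (\<lambda>v. gradient H x \<bullet> v)) (at x within B)" if "x \<in> B" for x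
        by (rule has_derivative_at_withinI [OF has_derivative_gradient [OF diff [OF that]]])
      show "onorm (\<lambda>v. gradient H x \<bullet> v) \<le> M" if "x \<in> B" for x
      proof (rule onorm_le)
        fix v :: "real^2"
        have "norm (gradient H x \<bullet> v) \<le> norm (gradient H x) * norm v" by (simp add: Cauchy_Schwarz_ineq2)
        also have "\<dots> \<le> M * norm v" by (rule mult_right_mono [OF bspec [OF M(2) that]]) simp
        finally show "norm (gradient H x \<bullet> v) \<le> M * norm v" .
      qed
    qed (use xy in auto)
    then show "\<bar>H x - H y\<bar> \<le> M * norm (x - y)" by simp
  qed
qed

lemma curl_eq_rot_of: "curl F x = rot_of (frechet_derivative F (at x))"
  by (simp add: curl_def rot_of_def partial_deriv_def)

text \<open>On a closed ball the curl has constant sign, by connectedness, and is bounded away from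
  zero, by compactness. A negative sign is reduced to a positive one by replacing \<open>u\<close>
  and \<open>F\<close> by their negatives, which reverses \<open>V\<close>, \<open>k\<close> and the
  curl.\<close>

lemma negligible_singular_set_near:
  fixes F :: "real^2 \<Rightarrow> real^2" and H u :: "real^2 \<Rightarrow> real"
  assumes F: "Ck_on 1 \<Omega> F" and H: "Ck_on 1 \<Omega> H" and weak: "weak_solution \<Omega> F H u"
    and curl: "\<forall>x\<in>\<Omega>. curl F x \<noteq> 0" and \<rho>: "\<rho> > 0" "cball p \<rho> \<subseteq> \<Omega>"
  shows "negligible {x \<in> ball p (\<rho> / 2). gradient u x + F x = 0}"
proof -
  let ?B = "cball p \<rho>"
  \<comment> \<open>Composition with the retraction onto the ball extends the data to the plane; the
    retraction being 1-Lipschitz, the Lipschitz constant of \<open>H\<close> is kept.\<close>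
  define pr where "pr = closest_point ?B"
  have pr: "pr x \<in> ?B" for x unfolding pr_def by (rule closest_point_in_set) (use \<rho> in auto)
  have pr_self: "pr x = x" if "x \<in> ?B" for x unfolding pr_def by (rule closest_point_self [OF that])
  have pr_lip: "norm (pr x - pr y) \<le> norm (x - y)" for x y
    using closest_point_lipschitz [of ?B x y] \<rho> by (simp add: pr_def dist_norm)
  have pr_cont: "continuous_on UNIV pr"
    unfolding pr_def by (rule continuous_on_closest_point) (use \<rho> in auto)
  have u: "Ck_on 1 \<Omega> u" using weak by (simp add: weak_solution_def)
  have F_der: "(F has_derivative frechet_derivative F (at x)) (at x)" if "x \<in> \<Omega>" for x
    using F that frechet_derivative_works by auto
  have F_cont: "continuous_on \<Omega> F"
    using F_der by (meson continuous_at_imp_continuous_on has_derivative_continuous)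
  have H_cont: "continuous_on \<Omega> H"
    using H by (auto intro!: continuous_at_imp_continuous_on differentiable_imp_continuous_within)
  have F'_cont: "continuous_on \<Omega> (\<lambda>x. frechet_derivative F (at x) v)" for v
    using F by simp
  have W_cont: "continuous_on \<Omega> (\<lambda>x. gradient u x + F x)"
    by (intro continuous_intros continuous_on_gradient [OF u] F_cont)
  \<comment> \<open>The minus sign makes the rotation clockwise, so that \<open>rot90 (V x)\<close>
    gives back \<open>gradient u x + F x\<close> on the ball.\<close>
  define V where "V = (\<lambda>x. - rot90 (gradient u (pr x) + F (pr x)))"
  define k where "k = (\<lambda>x. - H (pr x))"
  have pr_\<Omega>: "range pr \<subseteq> \<Omega>" using pr \<rho>(2) by blast
  have V_cont: "continuous_on UNIV V"
    using continuous_on_compose2 [OF W_cont pr_cont pr_\<Omega>] unfolding V_def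
    by (rule continuous_on_minus [OF continuous_on_rot90])
  have VF: "rot90 (V x) = gradient u x + F x" if "x \<in> ball p \<rho>" for x
    using that pr_self [of x] by (simp add: V_def rot90_simps)
  obtain M1 where M1: "M1 \<ge> 0" "\<And>x y. x \<in> ?B \<Longrightarrow> y \<in> ?B \<Longrightarrow> \<bar>H x - H y\<bar> \<le> M1 * norm (x - y)"
    using Ck_on_1_lipschitz_on_compact_convex [OF H compact_cball convex_cball \<rho>(2)] by blast
  obtain M2 where M2: "\<And>x. x \<in> ?B \<Longrightarrow> norm (H x) \<le> M2" "M2 \<ge> 0"
    using continuous_on_compact_norm_bound [OF compact_cball continuous_on_subset [OF H_cont \<rho>(2)]] by blast
  define M where "M = max 1 (max M1 M2)"
  have k_cont: "continuous_on UNIV k"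
    using continuous_on_compose2 [OF H_cont pr_cont pr_\<Omega>] unfolding k_def
    by (rule continuous_on_minus)
  have flow: "flow_field V k M p \<rho>"
  proof
    show "weak_rot {x \<in> ball p \<rho>. V x \<noteq> 0} (\<lambda>x. sgn (V x)) k"
    proof (rule weak_rot_of_weak_solution [OF weak _ V_cont k_cont VF])
      show "ball p \<rho> \<subseteq> \<Omega>" using \<rho>(2) ball_subset_cball by blast
      show "k x = - H x" if "x \<in> ball p \<rho>" for x using that pr_self [of x] by (simp add: k_def)
    qed
    show "1 \<le> M" by (simp add: M_def)
    show "\<bar>k x\<bar> \<le> M" for x
      using M2(1) [OF pr, of x] by (simp add: k_def M_def)
    show "\<bar>k x - k y\<bar> \<le> M * norm (x - y)" for x y
    proof -
      have "\<bar>H (pr x) - H (pr y)\<bar> \<le> M1 * norm (pr x - pr y)" by (rule M1(2) [OF pr pr])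
      also have "\<dots> \<le> M * norm (x - y)"
        using pr_lip [of x y] M1(1) by (intro mult_mono) (auto simp: M_def)
      finally show ?thesis by (simp add: k_def abs_minus_commute)
    qed
  qed (use V_cont \<rho> in auto)
  have c_cont: "continuous_on ?B (curl F)"
    unfolding curl_eq_rot_of [abs_def] rot_of_def
    by (intro continuous_intros continuous_on_subset [OF F'_cont \<rho>(2)])
  have "continuous_on ?B (\<lambda>x. \<bar>curl F x\<bar>)" by (intro continuous_intros c_cont)
  from continuous_attains_inf [OF compact_cball _ this] obtain z where
    z: "z \<in> ?B" "\<And>x. x \<in> ?B \<Longrightarrow> \<bar>curl F z\<bar> \<le> \<bar>curl F x\<bar>" using \<rho>(1) by force
  define c0 where "c0 = \<bar>curl F z\<bar>"
  have c0: "c0 > 0" using curl z(1) \<rho>(2) by (auto simp: c0_def)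
  have conn: "connected (curl F ` ?B)" by (rule connected_continuous_image [OF c_cont connected_cball])
  have zero: "0 \<notin> curl F ` ?B" using curl \<rho>(2) by force
  have sign: "(\<forall>x\<in>?B. c0 \<le> curl F x) \<or> (\<forall>x\<in>?B. c0 \<le> - curl F x)"
  proof (rule ccontr)
    assume "\<not> ?thesis"
    then obtain x y where xy: "x \<in> ?B" "y \<in> ?B" "curl F x < c0" "- curl F y < c0" by force
    then have "curl F x < 0" "0 < curl F y" using z(2) [of x] z(2) [of y] c0 by (auto simp: c0_def abs_if split: if_splits)
    then have "0 \<in> curl F ` ?B"
      using connectedD_interval [OF conn, of "curl F x" "curl F y" 0] xy by force
    then show False using zero by simp
  qed
  have in_\<Omega>: "x \<in> \<Omega>" "x \<in> ?B" if "x \<in> ball p \<rho>" for x using that \<rho>(2) by auto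
  have u_der: "(u has_derivative (\<lambda>v. (rot90 (V x) - F x) \<bullet> v)) (at x)" if "x \<in> ball p \<rho>" for x
    using has_derivative_gradient [of u x] u in_\<Omega>(1) [OF that] VF [OF that] by simp
  have F'_ball: "continuous_on (ball p \<rho>) (\<lambda>x. frechet_derivative F (at x) v)" for v
    by (rule continuous_on_subset [OF F'_cont]) (use in_\<Omega> in blast)
  have "negligible {x \<in> ball p (\<rho> / 2). V x = 0}"
    using sign
  proof
    assume c: "\<forall>x\<in>?B. c0 \<le> curl F x"
    interpret flow_field V k M p \<rho> by (rule flow)
    interpret curl_flow V k M p \<rho> u F "\<lambda>x. frechet_derivative F (at x)" c0
      by unfold_locales (use u_der F_der in_\<Omega> F'_ball c0 c in \<open>auto simp: curl_eq_rot_of\<close>)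
    show ?thesis by (rule negligible_zeros)
  next
    assume c: "\<forall>x\<in>?B. c0 \<le> - curl F x"
    interpret flow_field "\<lambda>x. - V x" "\<lambda>x. - k x" M p \<rho> by (rule flow_field.flow_field_minus [OF flow])
    interpret curl_flow "\<lambda>x. - V x" "\<lambda>x. - k x" M p \<rho> "\<lambda>x. - u x" "\<lambda>x. - F x" "\<lambda>x v. - frechet_derivative F (at x) v" c0
    proof
      show "((\<lambda>x. - u x) has_derivative (\<lambda>v. (rot90 (- V x) - - F x) \<bullet> v)) (at x)" if "x \<in> ball p \<rho>" for x
        using has_derivative_minus [OF u_der [OF that]] by (simp add: rot90_simps inner_diff_left inner_add_left algebra_simps)
      show "((\<lambda>x. - F x) has_derivative (\<lambda>v. - frechet_derivative F (at x) v)) (at x)" if "x \<in> ball p \<rho>" for x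
        by (rule has_derivative_minus [OF F_der [OF in_\<Omega>(1) [OF that]]])
      show "continuous_on (ball p \<rho>) (\<lambda>x. - frechet_derivative F (at x) v)" for v
        by (intro continuous_intros F'_ball)
      show "c0 \<le> rot_of (\<lambda>v. - frechet_derivative F (at x) v)" if "x \<in> ball p \<rho>" for x
      proof -
        have "rot_of (\<lambda>v. - frechet_derivative F (at x) v) = - curl F x"
          by (simp add: curl_eq_rot_of rot_of_def)
        then show ?thesis using c in_\<Omega>(2) [OF that] by simp
      qed
    qed (rule c0)
    show ?thesis using negligible_zeros by simp
  qed
  moreover have "{x \<in> ball p (\<rho> / 2). gradient u x + F x = 0} \<subseteq> {x \<in> ball p (\<rho> / 2). V x = 0}"
  proof
    fix x assume x: "x \<in> {x \<in> ball p (\<rho> / 2). gradient u x + F x = 0}"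
    then have "x \<in> ball p \<rho>" using \<rho>(1) by auto
    then have "norm (V x) = 0" using VF [of x] x by (metis (mono_tags, lifting) mem_Collect_eq norm_rot90 norm_zero)
    then show "x \<in> {x \<in> ball p (\<rho> / 2). V x = 0}" using x by simp
  qed
  ultimately show ?thesis by (rule negligible_subset)
qed

section \<open>Hausdorff measure of negligible sets\<close>

text \<open>The disc whose diameter is the diagonal of a square of side \<open>l\<close> has area
  \<open>pi * l^2 / 2\<close>, and \<open>pi < 4\<close>.\<close>

lemma hausdorff_weight_square:
  fixes u v :: "real^2"
  assumes uv: "\<And>i. i \<in> Basis \<Longrightarrow> v \<bullet> i - u \<bullet> i = l" and l: "0 \<le> l"
  shows "hausdorff_weight 2 (cbox u v) \<le> 2 * emeasure lebesgue (cbox u v)"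
proof -
  have le: "\<forall>i\<in>Basis. u \<bullet> i \<le> v \<bullet> i" using uv l by force
  have comp: "v $ i - u $ i = l" for i
    using uv [of "axis i 1"] by (simp add: inner_axis axis_in_Basis_iff)
  have "dist v u = sqrt (l\<^sup>2 + l\<^sup>2)"
    using comp [of 1] comp [of 2] by (simp add: dist_norm norm_eq_sqrt_inner inner_2 power2_eq_square)
  then have d: "diameter (cbox u v) = sqrt (l\<^sup>2 + l\<^sup>2)" using diameter_cbox [OF le] by (simp add: dist_commute)
  have "(\<Prod>b\<in>Basis. (v - u) \<bullet> b) = (\<Prod>b\<in>(Basis::(real^2) set). l)"
    by (intro prod.cong refl) (simp add: inner_diff_left uv)
  also have "\<dots> = l\<^sup>2" by simp
  finally have m: "emeasure lebesgue (cbox u v) = ennreal (l\<^sup>2)"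
    using le by (simp add: emeasure_lborel_cbox_eq)
  have "unit_ball_vol (real 2) * (diameter (cbox u v) / 2) ^ 2 = pi * ((l\<^sup>2 + l\<^sup>2) / 4)"
    using unit_ball_vol_2 by (simp add: d power_divide)
  also have "\<dots> \<le> 4 * ((l\<^sup>2 + l\<^sup>2) / 4)"
    using pi_less_4 by (intro mult_right_mono) auto
  also have "\<dots> = 2 * l\<^sup>2" by simp
  finally have "hausdorff_weight 2 (cbox u v) \<le> ennreal (2 * l\<^sup>2)"
    unfolding hausdorff_weight_def by (auto intro!: ennreal_leI)
  also have "\<dots> = 2 * emeasure lebesgue (cbox u v)"
    by (simp add: m ennreal_mult')
  finally show "hausdorff_weight 2 (cbox u v) \<le> 2 * emeasure lebesgue (cbox u v)" .
qed

text \<open>Choose an open \<open>W\<close> around \<open>S\<close> of small measure and cover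
  \<open>S\<close> by nonoverlapping dyadic squares so small that they lie in \<open>W\<close>;
  their weights add up to at most twice the measure of \<open>W\<close>. Squares are used because
  the weight of an elongated box is not controlled by its area.\<close>

lemma negligible_cover_bounded:
  fixes S :: "(real^2) set"
  assumes S: "negligible S" "S \<subseteq> cbox a b" "box a b \<noteq> {}"
    and ab: "\<And>i. i \<in> Basis \<Longrightarrow> b \<bullet> i - a \<bullet> i = m"
    and \<delta>: "\<delta> > 0" and e: "e > 0"
  shows "\<exists>U. S \<subseteq> (\<Union>i. U i) \<and> (\<forall>i::nat. bounded (U i) \<and> diameter (U i) \<le> \<delta>) \<and>
    (\<Sum>i. hausdorff_weight 2 (U i)) \<le> ennreal e"
proof -
  have "S \<in> sets lebesgue" by (rule negligible_imp_sets [OF S(1)])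
  then obtain W where W: "open W" "S \<subseteq> W" "W - S \<in> lmeasurable" "emeasure lebesgue (W - S) < ennreal (e / 2)"
    by (rule sets_lebesgue_outer_open [OF _ half_gt_zero [OF e]])
  have null: "S \<in> null_sets lebesgue" using S(1) negligible_iff_null_sets by blast
  have Wm: "emeasure lebesgue W < ennreal (e / 2)"
    using W(1,4) emeasure_Diff_null_set [OF null, of W] by simp
  have "\<forall>x\<in>W. \<exists>d>0. ball x d \<subseteq> W" using W(1) open_contains_ball by blast
  then obtain d where d: "\<And>x. x \<in> W \<Longrightarrow> d x > 0 \<and> ball x (d x) \<subseteq> W" by metis
  \<comment> \<open>Off \<open>W\<close> the value 1 merely makes \<open>g\<close> a gauge
    everywhere; the squares are tagged in \<open>S\<close>, which lies in \<open>W\<close>.\<close>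
  define g where "g = (\<lambda>x. ball x (if x \<in> W then min (d x) (\<delta> / 8) else 1))"
  have "gauge g" unfolding g_def gauge_def using d \<delta> by auto
  obtain \<D> where
    D: "countable \<D>" "\<Union>\<D> \<subseteq> cbox a b" "\<And>K. K \<in> \<D> \<Longrightarrow> interior K \<noteq> {} \<and> (\<exists>c d. K = cbox c d)"
      "pairwise (\<lambda>A B. interior A \<inter> interior B = {}) \<D>"
      "\<And>K. K \<in> \<D> \<Longrightarrow> \<exists>x \<in> S \<inter> K. K \<subseteq> g x"
      "\<And>u v. cbox u v \<in> \<D> \<Longrightarrow> \<exists>n. \<forall>i \<in> Basis. v \<bullet> i - u \<bullet> i = (b \<bullet> i - a \<bullet> i) / 2^n"
      "S \<subseteq> \<Union>\<D>" using covering_lemma [OF S(2,3) \<open>gauge g\<close>] by metis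
  have cube: "bounded K \<and> diameter K \<le> \<delta> \<and> K \<subseteq> W \<and> hausdorff_weight 2 K \<le> 2 * emeasure lebesgue (interior K)"
    if K: "K \<in> \<D>" for K
  proof -
    obtain u v where uv: "K = cbox u v" using D(3) K by blast
    obtain n where n: "\<And>i. i \<in> Basis \<Longrightarrow> v \<bullet> i - u \<bullet> i = m / 2 ^ n" using D(6) [of u v] K uv ab by auto
    have "box u v \<noteq> {}" using D(3) [OF K] uv interior_cbox by metis
    then have "u \<bullet> axis 1 1 < v \<bullet> axis 1 1" by (auto simp: box_ne_empty axis_in_Basis_iff)
    moreover have "v \<bullet> axis 1 1 - u \<bullet> axis 1 1 = m / 2 ^ n" by (rule n) (simp add: axis_in_Basis_iff)
    ultimately have "0 < m / 2 ^ n" by linarith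
    obtain x where x: "x \<in> S" "K \<subseteq> g x" using D(5) K by blast
    have xW: "x \<in> W" using x W by blast
    have "K \<subseteq> ball x (min (d x) (\<delta> / 8))" using x(2) xW by (simp add: g_def)
    moreover have "ball x (min (d x) (\<delta> / 8)) \<subseteq> ball x (\<delta> / 8)"
      "ball x (min (d x) (\<delta> / 8)) \<subseteq> ball x (d x)" by (auto intro: subset_ball)
    ultimately have Kb: "K \<subseteq> ball x (\<delta> / 8)" "K \<subseteq> W" using d [OF xW] by blast+
    have "diameter K \<le> diameter (ball x (\<delta> / 8))" by (rule diameter_subset [OF Kb(1)]) simp
    also have "\<dots> \<le> \<delta>" using \<delta> by (simp add: diameter_ball)
    finally have dK: "diameter K \<le> \<delta>" .
    have "hausdorff_weight 2 K \<le> 2 * emeasure lebesgue K"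
      unfolding uv by (rule hausdorff_weight_square [OF n]) (use \<open>0 < m / 2 ^ n\<close> in auto)
    also have "emeasure lebesgue K = emeasure lebesgue (interior K)"
      unfolding uv interior_cbox by (simp add: emeasure_lborel_cbox_eq emeasure_lborel_box_eq)
    finally show ?thesis using dK Kb uv by auto
  qed
  \<comment> \<open>Enumerates \<open>\<D>\<close>, which may be finite, along all natural numbers;
    the spare indices get the empty set, of weight zero.\<close>
  define U where "U = (\<lambda>i. if i \<in> to_nat_on \<D> ` \<D> then inv_into \<D> (to_nat_on \<D>) i else {})"
  have inj: "inj_on (to_nat_on \<D>) \<D>" using D(1) by (rule inj_on_to_nat_on)
  have U_in: "U i \<in> \<D> \<or> U i = {}" for i
    by (auto simp: U_def intro: inv_into_into)
  have U_cov: "\<Union>\<D> \<subseteq> (\<Union>i. U i)"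
  proof
    fix x assume "x \<in> \<Union>\<D>"
    then obtain K where K: "K \<in> \<D>" "x \<in> K" by blast
    then have "U (to_nat_on \<D> K) = K" using inj by (simp add: U_def)
    then show "x \<in> (\<Union>i. U i)" using K by blast
  qed
  have disj: "disjoint_family (\<lambda>i. interior (U i))"
    unfolding disjoint_family_on_def
  proof (intro ballI impI)
    fix i j :: nat assume ij: "i \<noteq> j"
    show "interior (U i) \<inter> interior (U j) = {}"
    proof (cases "i \<in> to_nat_on \<D> ` \<D> \<and> j \<in> to_nat_on \<D> ` \<D>")
      case True
      then have "U i \<in> \<D>" "U j \<in> \<D>" "U i \<noteq> U j"
        using ij inj by (auto simp: U_def)
      then show ?thesis using D(4) by (auto simp: pairwise_def)
    next
      case False
      then show ?thesis by (auto simp: U_def)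
    qed
  qed
  have "(\<Sum>i. hausdorff_weight 2 (U i)) \<le> (\<Sum>i. 2 * emeasure lebesgue (interior (U i)))"
  proof (rule suminf_le)
    show "hausdorff_weight 2 (U i) \<le> 2 * emeasure lebesgue (interior (U i))" for i
    proof (cases "U i = {}")
      case True
      then show ?thesis by (simp add: hausdorff_weight_def)
    next
      case False
      then show ?thesis using U_in [of i] cube [of "U i"] by blast
    qed
  qed auto
  also have "\<dots> = 2 * (\<Sum>i. emeasure lebesgue (interior (U i)))" by simp
  also have "(\<Sum>i. emeasure lebesgue (interior (U i))) = emeasure lebesgue (\<Union>i. interior (U i))"
    by (rule suminf_emeasure) (use disj in auto)
  also have "2 * emeasure lebesgue (\<Union>i. interior (U i)) \<le> 2 * emeasure lebesgue W"
  proof (intro mult_left_mono emeasure_mono)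
    show "(\<Union>i. interior (U i)) \<subseteq> W"
    proof
      fix x assume "x \<in> (\<Union>i. interior (U i))"
      then obtain i where "x \<in> U i" using interior_subset by blast
      then show "x \<in> W" using U_in [of i] cube [of "U i"] by blast
    qed
  qed (use W(1) in auto)
  also have "\<dots> \<le> 2 * ennreal (e / 2)"
    using Wm by (intro mult_left_mono) auto
  also have "\<dots> = ennreal e" using e by (simp add: ennreal_mult' [symmetric, of 2, simplified])
  finally have sum: "(\<Sum>i. hausdorff_weight 2 (U i)) \<le> ennreal e" .
  show ?thesis
  proof (intro exI conjI allI)
    show "S \<subseteq> (\<Union>i. U i)" using D(7) U_cov by blast
    show "bounded (U i)" "diameter (U i) \<le> \<delta>" for i
    proof -
      have "bounded (U i) \<and> diameter (U i) \<le> \<delta>"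
      proof (cases "U i = {}")
        case True
        then show ?thesis using \<delta> by simp
      next
        case False
        then show ?thesis using U_in [of i] cube [of "U i"] by blast
      qed
      then show "bounded (U i)" "diameter (U i) \<le> \<delta>" by auto
    qed
  qed (fact sum)
qed

text \<open>Exhaust the plane by the squares \<open>Q n\<close>, cover the part in each with total
  weight \<open>e / 2^(n + 1)\<close>, and merge the countably many covers into one
  sequence.\<close>

lemma hausdorff_measure_negligible:
  fixes S :: "(real^2) set"
  assumes S: "negligible S"
  shows "hausdorff_measure 2 S = 0"
proof -
  have content: "hausdorff_content 2 \<delta> S \<le> ennreal e" if \<delta>: "\<delta> > 0" and e: "e > 0" for \<delta> e :: real
  proof -
    \<comment> \<open>\<open>Suc n\<close> instead of \<open>n\<close> keeps the square
      nondegenerate for \<open>n = 0\<close>, as the covering lemma requires.\<close>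
    define Q where "Q = (\<lambda>n::nat. cbox (\<chi> i. - real (Suc n)) (\<chi> i. real (Suc n)) :: (real^2) set)"
    have "\<exists>U. S \<inter> Q n \<subseteq> (\<Union>i. U i) \<and> (\<forall>i::nat. bounded (U i) \<and> diameter (U i) \<le> \<delta>) \<and>
        (\<Sum>i. hausdorff_weight 2 (U i)) \<le> ennreal (e * (1 / 2) ^ Suc n)" for n
      unfolding Q_def
    proof (rule negligible_cover_bounded)
      show "negligible (S \<inter> cbox (\<chi> i. - real (Suc n)) (\<chi> i. real (Suc n)))"
        using S by (rule negligible_subset) auto
      show "box (\<chi> i. - real (Suc n)) (\<chi> i. real (Suc n)) \<noteq> ({} :: (real^2) set)"
        by (auto simp: box_ne_empty Basis_vec_def inner_axis)
      show "(\<chi> i. real (Suc n)) \<bullet> i - (\<chi> i. - real (Suc n)) \<bullet> i = 2 * real (Suc n)"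
        if "i \<in> Basis" for i :: "real^2"
        using that by (auto simp: Basis_vec_def inner_axis)
    qed (use \<delta> e in auto)
    then obtain U where U: "\<And>n. S \<inter> Q n \<subseteq> (\<Union>i. U n i)" "\<And>n i::nat. bounded (U n i) \<and> diameter (U n i) \<le> \<delta>"
      "\<And>n. (\<Sum>i. hausdorff_weight 2 (U n i)) \<le> ennreal (e * (1 / 2) ^ Suc n)" by metis
    define Y where "Y = (\<lambda>k. U (fst (prod_decode k)) (snd (prod_decode k)))"
    have cov: "S \<subseteq> (\<Union>k. Y k)"
    proof
      fix x assume x: "x \<in> S"
      obtain n where n: "norm x \<le> real n" using real_arch_simple by blast
      have "- real (Suc n) \<le> x $ i" "x $ i \<le> real (Suc n)" for i
        using component_le_norm_cart [of x i] n by linarith+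
      then have "x \<in> Q n" unfolding Q_def mem_box_cart by simp
      then obtain i where "x \<in> U n i" using U(1) x by blast
      then have "x \<in> Y (prod_encode (n, i))" by (simp add: Y_def)
      then show "x \<in> (\<Union>k. Y k)" by blast
    qed
    have "hausdorff_content 2 \<delta> S \<le> (\<Sum>k. hausdorff_weight 2 (Y k))"
      unfolding hausdorff_content_def
      by (rule INF_lower) (use cov U(2) in \<open>auto simp: Y_def\<close>)
    also have "\<dots> = (\<Sum>n. \<Sum>i. hausdorff_weight 2 (U n i))"
      using suminf_ennreal_2dimen [of "\<lambda>n. \<Sum>i. hausdorff_weight 2 (U n i)" "\<lambda>(n, i). hausdorff_weight 2 (U n i)"]
      by (simp add: Y_def o_def case_prod_unfold)
    also have "\<dots> \<le> (\<Sum>n. ennreal (e * (1 / 2) ^ Suc n))"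
      by (rule suminf_le [OF U(3)]) auto
    also have "\<dots> = ennreal e"
    proof -
      have "(\<lambda>n. e * (1 / 2 :: real) ^ Suc n) sums (e * 1)"
        by (rule sums_mult) (rule power_half_series)
      then have "(\<lambda>n. e * (1 / 2 :: real) ^ Suc n) sums e" by simp
      then show ?thesis
        by (intro suminf_ennreal_eq) (use e in auto)
    qed
    finally show ?thesis .
  qed
  have "hausdorff_content 2 \<delta> S = 0" if "\<delta> > 0" for \<delta>
  proof -
    have "hausdorff_content 2 \<delta> S \<le> 0"
      by (rule ennreal_le_epsilon) (use content [OF that] in simp)
    then show ?thesis by simp
  qed
  then have "hausdorff_measure 2 S = (SUP \<delta>\<in>({0<..} :: real set). 0)"
    unfolding hausdorff_measure_def by (intro SUP_cong) auto
  then show ?thesis by simp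
qed

theorem theoremF:
  fixes \<Omega> :: "(real^2) set"
    and F :: "real^2 \<Rightarrow> real^2"
    and H u :: "real^2 \<Rightarrow> real"
  assumes "open \<Omega>" and "connected \<Omega>"
    and "Ck_on 1 \<Omega> F"
    and "Ck_on 1 \<Omega> H"
    and "weak_solution \<Omega> F H u"
    and "derivative_along_extends \<Omega> (singular_set \<Omega> F u) (N_perp F u) (curl F)"
    and "derivative_along_extends \<Omega> (singular_set \<Omega> F u) (N_field F u) H"
    and "\<forall>x\<in>\<Omega>. curl F x \<noteq> 0"
  shows "hausdorff_measure 2 (singular_set \<Omega> F u) = 0"
proof (rule hausdorff_measure_negligible)
  let ?S = "singular_set \<Omega> F u"
  show "negligible ?S"
  \<comment> \<open>Negligibility is a local property, so it is enough to treat a ball around each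
    singular point.\<close>
  proof (rule locally_negligible_alt [THEN iffD2], rule ballI)
    fix p assume p: "p \<in> ?S"
    then have "p \<in> \<Omega>" by (simp add: singular_set_def)
    then obtain \<rho> where \<rho>: "\<rho> > 0" "cball p \<rho> \<subseteq> \<Omega>"
      using \<open>open \<Omega>\<close> open_contains_cball by blast
    have "?S \<inter> ball p (\<rho> / 2) \<subseteq> {x \<in> ball p (\<rho> / 2). gradient u x + F x = 0}"
      by (auto simp: singular_set_def)
    then have "negligible (?S \<inter> ball p (\<rho> / 2))"
      by (rule negligible_subset [OF negligible_singular_set_near [OF assms(3-5,8) \<rho>]])
    then show "\<exists>U. openin (top_of_set ?S) U \<and> p \<in> U \<and> negligible U"
      using p \<rho>(1) by (intro exI [of _ "?S \<inter> ball p (\<rho> / 2)"]) (auto intro: openin_open_Int)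
  qed
qed

end
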